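(* Let $S,T$ be totally irreducible automorphisms of the torus $\mathbb{T}^d=\mathbb{R}^d/\mathbb{Z}^d$ (induced by matrices in $\mathrm{GL}_d(\mathbb{Z})$). Assume that the weak stable subspaces of the two maps are different, i.e. $V_S^{0-}\neq V_T^{0-}$. Then $$\dim\bigl(Eq(S)\cap ND(T)\bigr)=d,$$ where $\dim$ denotes Hausdorff dimension.
   Context: A $d\times d$ integer matrix is irreducible if its characteristic polynomial is irreducible over $\mathbb{Q}$; it is totally irreducible if every power of it is irreducible. An automorphism of $\mathbb{T}^d$ is identified with the matrix in $\mathrm{GL}_d(\mathbb{Z})$ inducing it, which also acts linearly on $\mathbb{R}^d$. For such a matrix $T$ (diagonalizable over $\mathbb{C}$), a generalized eigenspace is either a real one-dimensional eigenspace or the real two-dimensional invariant subspace of $\mathbb{R}^d$ corresponding to a pair of complex conjugate non-real eigenvalues. The weak stable subspace $V_T^{0-}\subseteq\mathbb{R}^d$ is the sum of all generalized eigenspaces of $T$ for eigenvalues $\nu$ with $|\nu|\le 1$. $ND(T)=\{x\in\mathbb{T}^d : \overline{\{T^n x : n\ge 0\}}\subsetneq\mathbb{T}^d\}$ is the set of points with non-dense forward orbit. $Eq(S)=\{x\in\mathbb{T}^d : \frac1N\sum_{n=0}^{N-1}f(S^n x)\to\int f\,dm \text{ as } N\to\infty \text{ for every } f\in C(\mathbb{T}^d)\}$, where $m$ is the Lebesgue (Haar) probability measure on $\mathbb{T}^d$. *)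

theory Defs
  imports "HOL-Analysis.Analysis" "HOL-Computational_Algebra.Polynomial"
begin

section \<open>The torus\<close>

definition torus_rel :: "real ^ 'n \<Rightarrow> real ^ 'n \<Rightarrow> bool" where
  "torus_rel x y \<longleftrightarrow> (\<forall>i. x $ i - y $ i \<in> \<int>)"

lemma equivp_torus_rel: "equivp torus_rel"
proof (rule equivpI)
  show "reflp torus_rel"
    by (auto simp: reflp_def torus_rel_def)
  show "symp torus_rel"
    by (auto simp: symp_def torus_rel_def) (metis Ints_minus minus_diff_eq)
  show "transp torus_rel"
    unfolding transp_def torus_rel_def
  proof (intro allI impI)
    fix x y z :: "real ^ 'n" and i
    assume "\<forall>i. x $ i - y $ i \<in> \<int>" "\<forall>i. y $ i - z $ i \<in> \<int>"
    then have "(x $ i - y $ i) + (y $ i - z $ i) \<in> \<int>"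
      using Ints_add by blast
    then show "x $ i - z $ i \<in> \<int>" by simp
  qed
qed

quotient_type 'n torus = "real ^ ('n::finite)" / torus_rel
  by (rule equivp_torus_rel)


lemma closed_torus_rel: "closed {z. torus_rel (x :: real ^ 'n) z}"
proof -
  have eq: "{z. torus_rel x z} = (\<Inter>i. (\<lambda>z. x $ i - z $ i) -` \<int>)"
    by (auto simp: torus_rel_def)
  have "closed ((\<lambda>z :: real ^ 'n. x $ i - z $ i) -` \<int>)" for i
    by (rule continuous_closed_vimage) (auto intro!: continuous_intros)
  then show ?thesis unfolding eq by auto
qed

lemma infdist_torus_rel_le:
  fixes x x' y y' :: "real ^ 'n"
  assumes x: "torus_rel x x'" and y: "torus_rel y y'"
  shows "infdist x {z. torus_rel y z} \<le> infdist x' {z. torus_rel y' z}"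
proof -
  have ne: "{z. torus_rel y z} \<noteq> {}" "{z. torus_rel y' z} \<noteq> {}"
    using equivp_reflp[OF equivp_torus_rel] by auto
  have "infdist x {z. torus_rel y z} \<le> dist x' z" if z: "torus_rel y' z" for z
  proof -
    have "torus_rel z (z + (x - x'))"
      using x unfolding torus_rel_def
      by simp (metis Ints_minus minus_diff_eq)
    then have "z + (x - x') \<in> {z. torus_rel y z}"
      using y z equivp_transp[OF equivp_torus_rel] by (metis mem_Collect_eq)
    then have "infdist x {z. torus_rel y z} \<le> dist x (z + (x - x'))"
      by (rule infdist_le)
    also have "\<dots> = dist x' z"
      by (simp add: dist_norm algebra_simps)
    finally show ?thesis .
  qed
  then show ?thesis
    using ne by (auto simp: infdist_notempty intro!: cINF_greatest)
qed

instantiation torus :: (finite) metric_space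
begin

text \<open>The quotient metric: the distance between two cosets of the integer lattice.\<close>

lift_definition dist_torus :: "'a torus \<Rightarrow> 'a torus \<Rightarrow> real"
  is "\<lambda>x y. infdist x {z. torus_rel y z}"
  by (rule antisym) (auto intro!: infdist_torus_rel_le intro: equivp_symp[OF equivp_torus_rel])

definition uniformity_torus :: "('a torus \<times> 'a torus) filter" where
  "uniformity_torus = (INF e\<in>{0<..}. principal {(x, y). dist x y < e})"

definition open_torus :: "'a torus set \<Rightarrow> bool" where
  "open_torus U \<longleftrightarrow> (\<forall>x\<in>U. \<forall>\<^sub>F (x', y) in uniformity. x' = x \<longrightarrow> y \<in> U)"

lemma dist_torus_sym_le: "dist x y \<le> dist y (x :: 'a torus)"
proof (transfer)
  fix x y :: "real ^ 'a"
  have ne: "{z. torus_rel x z} \<noteq> {}"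
    using equivp_reflp[OF equivp_torus_rel] by auto
  have "infdist x {z. torus_rel y z} \<le> dist y z" if z: "torus_rel x z" for z
  proof -
    have "torus_rel y (y + (x - z))"
      using z unfolding torus_rel_def by simp (metis Ints_minus minus_diff_eq)
    then have "infdist x {z. torus_rel y z} \<le> dist x (y + (x - z))"
      by (intro infdist_le) simp
    also have "\<dots> = dist y z"
      by (simp add: dist_norm norm_minus_commute)
    finally show ?thesis .
  qed
  then show "infdist x {z. torus_rel y z} \<le> infdist y {z. torus_rel x z}"
    using ne by (auto simp: infdist_notempty intro!: cINF_greatest)
qed

lemma dist_torus_triangle: "dist x y \<le> dist x z + dist z (y :: 'a torus)"
proof (transfer)
  fix x y z :: "real ^ 'a"
  have ne: "{w. torus_rel z w} \<noteq> {}"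
    using equivp_reflp[OF equivp_torus_rel] by auto
  have "infdist x {w. torus_rel y w} - infdist z {w. torus_rel y w} \<le> dist x w"
    if w: "torus_rel z w" for w
  proof -
    have "infdist w {w. torus_rel y w} \<le> infdist z {w. torus_rel y w}"
      using w by (intro infdist_torus_rel_le)
        (auto intro: equivp_symp[OF equivp_torus_rel] equivp_reflp[OF equivp_torus_rel])
    moreover have "infdist x {w. torus_rel y w} \<le> infdist w {w. torus_rel y w} + dist x w"
      by (rule infdist_triangle)
    ultimately show ?thesis by linarith
  qed
  then have "infdist x {w. torus_rel y w} - infdist z {w. torus_rel y w}
      \<le> infdist x {w. torus_rel z w}"
    using ne by (auto simp: infdist_notempty intro!: cINF_greatest)
  then show "infdist x {w. torus_rel y w} \<le>
      infdist x {w. torus_rel z w} + infdist z {w. torus_rel y w}"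
    by linarith
qed

instance
proof
  fix x y z :: "'a torus"
  show "dist x y = 0 \<longleftrightarrow> x = y"
  proof transfer
    fix x y :: "real ^ 'a"
    have "{z. torus_rel y z} \<noteq> {}"
      using equivp_reflp[OF equivp_torus_rel] by auto
    then have "infdist x {z. torus_rel y z} = 0 \<longleftrightarrow> torus_rel y x"
      using in_closed_iff_infdist_zero[OF closed_torus_rel, of y x] by simp
    then show "infdist x {z. torus_rel y z} = 0 \<longleftrightarrow> torus_rel x y"
      using equivp_symp[OF equivp_torus_rel] by blast
  qed
  show "dist x y \<le> dist x z + dist y z"
    using dist_torus_triangle[of x y z] dist_torus_sym_le[of z y] by linarith
qed (rule uniformity_torus_def open_torus_def)+

end

lemma dist_abs_torus_le: "dist (abs_torus x) (abs_torus y) \<le> dist x (y :: real ^ 'n)"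
  by transfer (auto intro!: infdist_le simp: equivp_reflp[OF equivp_torus_rel])

lemma continuous_abs_torus: "continuous_on A (abs_torus :: real ^ 'n \<Rightarrow> ('n::finite) torus)"
  unfolding continuous_on_iff using dist_abs_torus_le by (metis order_le_less_trans)

lemma open_torus_iff:
  fixes U :: "('n::finite) torus set"
  shows "open U \<longleftrightarrow> open (abs_torus -` U :: (real ^ 'n) set)"
proof
  assume "open U"
  then show "open (abs_torus -` U :: (real ^ 'n) set)"
    by (rule open_vimage) (rule continuous_abs_torus)
next
  assume op: "open (abs_torus -` U :: (real ^ 'n) set)"
  show "open U"
    unfolding open_dist
  proof
    fix p assume "p \<in> U"
    obtain x where p: "p = abs_torus x"
      using Quotient_torus unfolding Quotient_def by metis
    with op \<open>p \<in> U\<close> obtain e where e: "e > 0" "\<And>y. dist y x < e \<Longrightarrow> abs_torus y \<in> U"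
      unfolding open_dist by (metis vimage_eq)
    have "q \<in> U" if q: "dist q p < e" for q
    proof -
      obtain y where y: "q = abs_torus y"
        using Quotient_torus unfolding Quotient_def by metis
      have "infdist x {z. torus_rel y z} < e"
        using q unfolding p y by (subst (asm) dist_commute) (simp add: dist_torus.abs_eq)
      moreover have ne: "{z. torus_rel y z} \<noteq> {}"
        using equivp_reflp[OF equivp_torus_rel] by auto
      ultimately obtain z where z: "torus_rel y z" "dist x z < e"
        by (auto simp: infdist_notempty cINF_less_iff)
      then have "q = abs_torus z"
        using y torus.abs_eq_iff by blast
      with e z show ?thesis by (simp add: dist_commute)
    qed
    with e(1) show "\<exists>e>0. \<forall>y. dist y p < e \<longrightarrow> y \<in> U" by blast
  qed
qed

definition haar_torus :: "('n::finite) torus measure" where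
  "haar_torus = distr (uniform_measure lborel (cbox 0 (\<chi> i. 1))) borel abs_torus"

lemma sets_haar_torus: "sets haar_torus = sets borel"
  by (simp add: haar_torus_def)

lemma abs_torus_measurable: "abs_torus \<in> borel_measurable (borel :: (real ^ 'n) measure)"
  by (intro borel_measurable_continuous_onI continuous_abs_torus)

lemma emeasure_haar_torus:
  assumes "A \<in> sets borel"
  shows "emeasure haar_torus A =
    emeasure lborel (cbox 0 (\<chi> i. 1) \<inter> abs_torus -` A :: (real ^ 'n) set)"
proof -
  have "emeasure lborel (cbox 0 (\<chi> i. 1) :: (real ^ 'n) set) = 1"
  proof -
    have "(0 :: real ^ 'n) \<bullet> b \<le> (\<chi> i. 1) \<bullet> b" if "b \<in> Basis" for b
      using that by (auto simp: Basis_vec_def inner_axis)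
    then have "emeasure lborel (cbox 0 (\<chi> i. 1) :: (real ^ 'n) set) =
        ennreal (\<Prod>b\<in>Basis. ((\<chi> i. 1) - (0 :: real ^ 'n)) \<bullet> b)"
      by (intro emeasure_lborel_cbox) auto
    also have "(\<Prod>b\<in>Basis. ((\<chi> i. 1) - (0 :: real ^ 'n)) \<bullet> b) = 1"
      by (rule prod.neutral) (auto simp: Basis_vec_def inner_axis)
    finally show ?thesis by simp
  qed
  moreover have "abs_torus -` A \<in> sets (borel :: (real ^ 'n) measure)"
    using measurable_sets[OF abs_torus_measurable assms] by simp
  ultimately show ?thesis
    unfolding haar_torus_def using assms abs_torus_measurable
    by (subst emeasure_distr)
      (auto simp: measurable_cong_sets[OF sets_uniform_measure refl] divide_ennreal_def)
qed

section \<open>Toral automorphisms\<close>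

lemma torus_rel_matrix:
  assumes "torus_rel x y"
  shows "torus_rel (map_matrix real_of_int A *v x) (map_matrix real_of_int A *v y)"
proof -
  have "(map_matrix real_of_int A *v x) $ i - (map_matrix real_of_int A *v y) $ i =
      (\<Sum>j\<in>UNIV. real_of_int (A $ i $ j) * (x $ j - y $ j))" for i
    by (simp add: matrix_vector_mult_def sum_subtractf algebra_simps)
  also have "\<dots> i \<in> \<int>" for i
    using assms by (intro Ints_sum Ints_mult) (auto simp: torus_rel_def)
  finally show ?thesis by (simp add: torus_rel_def)
qed

lift_definition torus_map :: "int ^ 'n ^ 'n \<Rightarrow> 'n torus \<Rightarrow> 'n torus"
  is "\<lambda>A x. map_matrix real_of_int A *v x"
  by (rule torus_rel_matrix)

definition char_polynomial :: "'a::comm_ring_1 ^ 'n ^ 'n \<Rightarrow> 'a poly" where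
  "char_polynomial A = det (mat [:0, 1:] - map_matrix (\<lambda>a. [:a:]) A)"

definition irreducible_matrix :: "int ^ 'n ^ 'n \<Rightarrow> bool" where
  "irreducible_matrix A \<longleftrightarrow> irreducible (char_polynomial (map_matrix rat_of_int A))"

text \<open>The operator \<open>^\<close> on vectors of vectors is the componentwise power, so powers of a
  matrix are written as iterated matrix products.\<close>

definition matrix_pow :: "'a::semiring_1 ^ 'n ^ 'n \<Rightarrow> nat \<Rightarrow> 'a ^ 'n ^ 'n" where
  "matrix_pow A n = (((**) A) ^^ n) (mat 1)"

definition totally_irreducible :: "int ^ 'n ^ 'n \<Rightarrow> bool" where
  "totally_irreducible A \<longleftrightarrow> (\<forall>n\<ge>1. irreducible_matrix (matrix_pow A n))"

section \<open>The weak stable subspace\<close>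

definition complex_eigenspace :: "int ^ 'n ^ 'n \<Rightarrow> complex \<Rightarrow> (complex ^ 'n) set" where
  "complex_eigenspace A \<nu> = {w. map_matrix of_int A *v w = \<nu> *s w}"

definition is_eigenvalue :: "int ^ 'n ^ 'n \<Rightarrow> complex \<Rightarrow> bool" where
  "is_eigenvalue A \<nu> \<longleftrightarrow> (\<exists>w \<in> complex_eigenspace A \<nu>. w \<noteq> 0)"

text \<open>The real parts of the vectors in the complex eigenspace of \<open>\<nu>\<close> form a real subspace, which
  also contains the imaginary parts, as the eigenspace is closed under multiplication by \<open>\<i>\<close>. For
  real \<open>\<nu>\<close> this is the real eigenspace; for non-real \<open>\<nu>\<close> it is the invariant real subspace belonging
  to the pair \<open>\<nu>\<close>, \<open>cnj \<nu>\<close> (two-dimensional if \<open>\<nu>\<close> is simple).\<close>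

definition gen_eigenspace :: "int ^ 'n ^ 'n \<Rightarrow> complex \<Rightarrow> (real ^ 'n) set" where
  "gen_eigenspace A \<nu> = (\<lambda>w. \<chi> i. Re (w $ i)) ` complex_eigenspace A \<nu>"

definition weak_stable_subspace :: "int ^ 'n ^ 'n \<Rightarrow> (real ^ 'n) set" where
  "weak_stable_subspace A = span (\<Union>\<nu>\<in>{\<nu>. is_eigenvalue A \<nu> \<and> cmod \<nu> \<le> 1}. gen_eigenspace A \<nu>)"

section \<open>Non-dense orbits and equidistribution\<close>

definition ND :: "('n::finite torus \<Rightarrow> 'n torus) \<Rightarrow> 'n torus set" where
  "ND T = {x. closure {(T ^^ n) x | n. True} \<subset> UNIV}"

definition Eq :: "('n::finite torus \<Rightarrow> 'n torus) \<Rightarrow> 'n torus set" where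
  "Eq S = {x. \<forall>f :: 'n torus \<Rightarrow> complex. continuous_on UNIV f \<longrightarrow>
     (\<lambda>N. (\<Sum>n<N. f ((S ^^ n) x)) / of_nat N) \<longlonglongrightarrow> (LINT y|haar_torus. f y)}"

section \<open>Hausdorff dimension\<close>

text \<open>The function \<^const>\<open>diameter\<close> is only meaningful on bounded sets, hence the boundedness
  condition on the covering sets.\<close>

definition hausdorff_premeasure :: "real \<Rightarrow> real \<Rightarrow> 'a::metric_space set \<Rightarrow> ennreal" where
  "hausdorff_premeasure s \<delta> X =
     (INF U \<in> {U :: nat \<Rightarrow> 'a set. X \<subseteq> (\<Union>n. U n) \<and> (\<forall>n. bounded (U n) \<and> diameter (U n) \<le> \<delta>)}.
        \<Sum>n. ennreal (diameter (U n) powr s))"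

definition hausdorff_measure :: "real \<Rightarrow> 'a::metric_space set \<Rightarrow> ennreal" where
  "hausdorff_measure s X = (SUP \<delta> \<in> {0<..}. hausdorff_premeasure s \<delta> X)"

text \<open>Only exponents \<open>s > 0\<close> are used, which does not change the infimum: as \<open>0 powr 0 = 0\<close>, the
  definition above would not give the counting measure at \<open>s = 0\<close>.\<close>

definition hausdorff_dim :: "'a::metric_space set \<Rightarrow> ennreal" where
  "hausdorff_dim X = Inf {ennreal s | s. 0 < s \<and> hausdorff_measure s X = 0}"

end

theory Submission
  imports Defs "HOL-Computational_Algebra.Fundamental_Theorem_Algebra"
    "HOL-Computational_Algebra.Polynomial_Factorial" "HOL-Computational_Algebra.Field_as_Ring"
    "HOL-Library.Discrete_Functions" "HOL-Real_Asymp.Real_Asymp"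
begin

text \<open>
  The argument combines two facts about lines in \<open>\<real>\<^sup>d\<close>. If \<open>w\<close> is not weakly stable for \<open>T\<close>, then the
  segment \<open>T\<^sup>n (y + [0, \<sigma>] w)\<close> grows exponentially, and a Cantor construction that at each level discards
  the few subintervals entering a small ball around \<open>0\<close> yields, on every line \<open>y + \<real> w\<close>, a subset of
  \<open>ND T\<close> of dimension close to \<open>1\<close>. If \<open>u\<close> is not weakly stable for \<open>S\<close>, then for every \<open>y\<close> and almost
  every \<open>t\<close> the whole translate \<open>y + t u + V\<close> of the weak stable subspace \<open>V\<close> of \<open>S\<close> lies in \<open>Eq S\<close>: the
  phases \<open>k \<bullet> S\<^sup>n (y + t u)\<close> are lacunary in \<open>t\<close> up to rare \<open>n\<close>, and moving within \<open>V\<close> changes them only by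
  an asymptotically almost periodic sequence with frequencies in a countable group.

  As the weak stable subspaces differ, \<open>u\<close> and \<open>w\<close> can be chosen such that moreover \<open>w\<close> is weakly
  stable for \<open>S\<close> or \<open>u\<close> is weakly stable for \<open>T\<close>. In the first case the Cantor sets on the lines
  \<open>y + t u + \<real> w\<close> consist of points of \<open>Eq S\<close> for almost all \<open>t\<close>; in the second case, the points of a
  Cantor set on \<open>y + \<real> w\<close> stay in \<open>ND T\<close> under small translations along \<open>u\<close>, and are moved into \<open>Eq S\<close>
  by almost all of them. Either way the intersection has dimension close to \<open>2\<close> in every plane
  \<open>y + \<real> u + \<real> w\<close>, uniformly in \<open>y\<close>, and integrating over \<open>y\<close> gives the full dimension.
\<close>

section \<open>Eigenbases of irreducible integer matrices\<close>

text \<open>Measurability is the obstacle. The Cantor set on a line is chosen separately for each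
  base point, and the null set where equidistribution fails also varies with it, so no measure on
  the intersection itself is assembled. Instead, a given cover is integrated: every slice forces a
  lower bound on the cover with a constant independent of the slice, and only the members of the
  cover have to be measurable. Irreducibility enters in two strengths. For the matrix itself it
  gives a simple spectrum, so that weakly stable orbits stay bounded, and it keeps every non-zero
  integer functional from vanishing on an eigenvector. For all powers it prevents ratios of distinct
  eigenvalues from being roots of unity. Dominant eigenvalues of equal modulus can still cancel in a
  functional, which is why some times have to be discarded; with a root of unity as ratio the
  cancellation could fill a whole arithmetic progression, whereas without one the times have
  arbitrarily small density. Each plane slice contributes the exponent \<open>1 + \<gamma>\<close>:
  the full dimension 1 from the direction \<open>u\<close>, and any \<open>\<gamma> < 1\<close> from
  the Cantor set in the direction \<open>w\<close>.\<close>

lemma poly_det: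
  fixes M :: "'a::comm_ring_1 poly ^ 'n ^ 'n"
  shows "poly (det M) x = det (map_matrix (\<lambda>p. poly p x) M)"
proof -
  show ?thesis by (simp add: det_def poly_sum poly_prod)
qed

lemma poly_char_polynomial:
  "poly (char_polynomial A) x = det (mat x - A)"
proof -
  have "map_matrix (\<lambda>p. poly p x) (mat [:0, 1:] - map_matrix (\<lambda>a. [:a:]) A) = mat x - A"
    by (simp add: vec_eq_iff mat_def)
  then show ?thesis by (simp add: char_polynomial_def poly_det)
qed

text \<open>In the Leibniz expansion, a permutation that moves \<open>k\<close> picks a constant
  entry in row \<open>k\<close>, so its term has degree below \<open>CARD('n)\<close>. The identity
  contributes a monic product of full degree.\<close>

lemma degree_char_polynomial:
  fixes A :: "'a::idom ^ 'n ^ 'n"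
  shows "degree (char_polynomial A) = CARD('n)"
proof -
  let ?M = "mat [:0, 1:] - map_matrix (\<lambda>a. [:a:]) A :: 'a poly ^ 'n ^ 'n"
  let ?P = "{p. p permutes (UNIV :: 'n set)}"
  let ?t = "\<lambda>p. of_int (sign p) * (\<Prod>i\<in>UNIV. ?M $ i $ p i)"
  have le: "degree (?M $ i $ j) \<le> (if i = j then 1 else 0)" for i j
    by (simp add: mat_def)
  have t0: "degree (?t p) < CARD('n)" if "p \<in> ?P - {id}" for p
  proof -
    have "p \<noteq> id" using that by blast
    then obtain k where k: "p k \<noteq> k" by (auto simp: fun_eq_iff)
    have "degree (\<Prod>i\<in>UNIV. ?M $ i $ p i) \<le> (\<Sum>i\<in>UNIV. degree (?M $ i $ p i))"
      using degree_prod_sum_le[of "UNIV :: 'n set" "\<lambda>i. ?M $ i $ p i"] by (simp add: o_def)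
    also have "\<dots> \<le> (\<Sum>i\<in>UNIV. if i = k then 0 else 1)"
    proof (rule sum_mono)
      fix i
      show "degree (?M $ i $ p i) \<le> (if i = k then 0 else 1)"
        using le[of i "p i"] k by (auto split: if_splits)
    qed
    also have "\<dots> < CARD('n)"
      by (simp add: sum.If_cases Compl_eq_Diff_UNIV card_Diff_singleton)
    finally have "degree (\<Prod>i\<in>UNIV. ?M $ i $ p i) < CARD('n)" .
    then show ?thesis
      by (auto simp: sign_def)
  qed
  have c0: "coeff (?t p) (CARD('n)) = 0" if "p \<in> ?P - {id}" for p
    by (rule coeff_eq_0) (rule t0[OF that])
  have diag: "(\<Prod>i\<in>UNIV. ?M $ i $ i) = (\<Prod>i\<in>UNIV. [:- (A $ i $ i), 1:])"
    by (rule prod.cong) (auto simp: mat_def)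
  have deg1: "degree (\<Prod>i\<in>(UNIV::'n set). [:- (A $ i $ i), 1:]) = CARD('n)"
    by (subst degree_prod_eq_sum_degree) auto
  have lc1: "lead_coeff (\<Prod>i\<in>(UNIV::'n set). [:- (A $ i $ i), 1:]) = 1"
    by (simp add: lead_coeff_prod)
  have split: "det ?M = ?t id + (\<Sum>p\<in>?P - {id}. ?t p)"
    unfolding det_def by (subst sum.remove[of _ id]) (auto simp: permutes_id finite_permutations)
  have "coeff (det ?M) (CARD('n)) = 1"
    unfolding split coeff_add coeff_sum using c0 diag deg1 lc1 by simp
  moreover have "degree (det ?M) \<le> CARD('n)"
    unfolding split
  proof (intro degree_add_le degree_sum_le)
    show "degree (?t id) \<le> CARD('n)" using diag deg1 by simp
  qed (use t0 finite_permutations in \<open>auto intro: less_imp_le\<close>)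
  ultimately show ?thesis
    unfolding char_polynomial_def by (metis antisym le_degree zero_neq_one)
qed

section \<open>Rational polynomials evaluated in larger fields\<close>

lemma map_poly_of_rat_add:
  "map_poly of_rat (p + q) = map_poly of_rat p + (map_poly of_rat q :: 'a::field_char_0 poly)"
  by (rule poly_eqI) (simp add: coeff_map_poly of_rat_add)

lemma map_poly_of_rat_mult:
  "map_poly of_rat (p * q) = map_poly of_rat p * (map_poly of_rat q :: 'a::field_char_0 poly)"
  by (rule poly_eqI) (simp add: coeff_map_poly coeff_mult of_rat_sum of_rat_mult)

lemma map_poly_of_rat_sum:
  "map_poly of_rat (sum f X) = (\<Sum>x\<in>X. map_poly of_rat (f x) :: 'a::field_char_0 poly)"
  by (induction X rule: infinite_finite_induct) (auto simp: map_poly_of_rat_add)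

lemma map_poly_of_rat_prod:
  "map_poly of_rat (prod f X) = (\<Prod>x\<in>X. map_poly of_rat (f x) :: 'a::field_char_0 poly)"
  by (induction X rule: infinite_finite_induct) (auto simp: map_poly_of_rat_mult)

text \<open>The bridge between irreducibility, a statement over the rationals, and eigenvalues,
  which are complex.\<close>

lemma map_poly_of_rat_char_polynomial:
  "map_poly of_rat (char_polynomial (map_matrix rat_of_int A))
    = char_polynomial (map_matrix of_int A :: 'a::field_char_0 ^ 'n ^ 'n)"
proof -
  have s: "map_poly of_rat (of_int k) = (of_int k :: 'a poly)" for k
    by (rule poly_eqI) (simp add: coeff_map_poly of_int_poly coeff_pCons split: nat.split)
  have e: "map_poly of_rat ((mat [:0, 1:] - map_matrix (\<lambda>a. [:a:]) (map_matrix rat_of_int A)) $ i $ j)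
     = (mat [:0, 1:] - map_matrix (\<lambda>a. [:a:]) (map_matrix of_int A) :: 'a poly ^ 'n ^ 'n) $ i $ j" for i j
    by (rule poly_eqI) (auto simp: coeff_map_poly mat_def of_rat_diff of_rat_minus coeff_pCons split: nat.split)
  show ?thesis
    unfolding char_polynomial_def det_def map_poly_of_rat_sum map_poly_of_rat_mult map_poly_of_rat_prod s e ..
qed

text \<open>A Bezout identity for the coprime polynomials \<open>p\<close> and \<open>q\<close>
  would read \<open>0 = 1\<close> at a common root. It is used for the derivative of the
  characteristic polynomial and for a polynomial relation along the orbit of an integer
  functional.\<close>

lemma irreducible_no_common_root:
  fixes p q :: "rat poly" and z :: "'a::field_char_0"
  assumes "irreducible p" "q \<noteq> 0" "degree q < degree p"
    and "poly (map_poly of_rat p) z = 0"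
  shows "poly (map_poly of_rat q) z \<noteq> 0"
proof
  assume q0: "poly (map_poly of_rat q) z = 0"
  have ndvd: "\<not> p dvd q"
    using assms(2,3) dvd_imp_degree_le leD by blast
  have "prime_elem p"
    using assms(1) by (rule irreducible_imp_prime_elem_gcd)
  then have "coprime p q"
    using ndvd by (rule prime_elem_imp_coprime)
  then obtain a b where "a * p + b * q = 1"
    by (metis bezout_coefficients_fst_snd coprime_imp_gcd_eq_1)
  then have "map_poly of_rat (a * p + b * q) = (1 :: 'a poly)"
    by simp
  then have "poly (map_poly of_rat a) z * poly (map_poly of_rat p) z
      + poly (map_poly of_rat b) z * poly (map_poly of_rat q) z = 1"
    by (metis map_poly_of_rat_add map_poly_of_rat_mult poly_add poly_mult poly_1)
  with q0 assms(4) show False by simp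
qed

section \<open>Diagonalisation over the complex numbers\<close>

lemma matrix_vector_mult_sum:
  fixes A :: "'a::field ^ 'n ^ 'm"
  shows "A *v (\<Sum>j\<in>J. c j *s W j) = (\<Sum>j\<in>J. c j *s (A *v W j))"
proof (induction J rule: infinite_finite_induct)
  case (insert x F)
  then show ?case
    by (simp add: matrix_vector_right_distrib vector_scalar_commute)
qed auto

text \<open>Applying \<open>A\<close> to a linear relation and subtracting \<open>\<nu> k\<close>
  times the relation removes the term of \<open>k\<close> and multiplies the other coefficients by
  non-zero factors.\<close>

lemma eigenvectors_independent:
  fixes A :: "'a::field ^ 'n ^ 'n" and W :: "'i \<Rightarrow> 'a ^ 'n"
  assumes "finite J" and "inj_on \<nu> J"
    and "\<And>j. j \<in> J \<Longrightarrow> A *v W j = \<nu> j *s W j" and "\<And>j. j \<in> J \<Longrightarrow> W j \<noteq> 0"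
    and "(\<Sum>j\<in>J. c j *s W j) = 0" and "j \<in> J"
  shows "c j = 0"
  using assms
proof (induction J arbitrary: c j rule: finite_induct)
  case (insert k J)
  have s0: "c k *s W k + (\<Sum>j\<in>J. c j *s W j) = 0"
    using insert by simp
  have "A *v (c k *s W k + (\<Sum>j\<in>J. c j *s W j)) = 0"
    unfolding s0 by simp
  then have s1: "(c k * \<nu> k) *s W k + (\<Sum>j\<in>J. (c j * \<nu> j) *s W j) = 0"
    using insert.prems by (simp add: matrix_vector_right_distrib matrix_vector_mult_sum vector_scalar_commute)
  have "(\<Sum>j\<in>J. (c j * (\<nu> j - \<nu> k)) *s W j)
     = ((c k * \<nu> k) *s W k + (\<Sum>j\<in>J. (c j * \<nu> j) *s W j)) - \<nu> k *s (c k *s W k + (\<Sum>j\<in>J. c j *s W j))"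
    by (simp add: vec_eq_iff sum_subtractf[symmetric] sum_distrib_left algebra_simps)
  also have "\<dots> = 0" using s0 s1 by simp
  finally have z: "(\<Sum>j\<in>J. (c j * (\<nu> j - \<nu> k)) *s W j) = 0" .
  have cJ: "c i = 0" if "i \<in> J" for i
  proof -
    have "c i * (\<nu> i - \<nu> k) = 0"
      using insert.IH[of "\<lambda>j. c j * (\<nu> j - \<nu> k)" i] insert.prems z that by (auto simp: inj_on_def)
    moreover have "\<nu> i \<noteq> \<nu> k"
      using insert.prems(1) insert.hyps(2) that by (auto simp: inj_on_def)
    ultimately show ?thesis by simp
  qed
  then have "c k *s W k = 0"
    using s0 by simp
  then have "c k = 0"
    using insert.prems(3)[of k] by (auto simp: vec_eq_iff)
  with cJ insert.prems show ?case by auto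
qed auto

text \<open>A diagonalisation with simple spectrum, indexed by the coordinate type itself.
  \<open>\<alpha> x j\<close> is the \<open>j\<close>-th coordinate of \<open>x\<close> with respect
  to \<open>W\<close>; demanding an explicit linear form makes it linear and bounded at
  once.\<close>

definition eigenbasis ::
  "int ^ 'n ^ 'n \<Rightarrow> ('n \<Rightarrow> complex) \<Rightarrow> ('n \<Rightarrow> complex ^ 'n) \<Rightarrow> (complex ^ 'n \<Rightarrow> 'n \<Rightarrow> complex) \<Rightarrow> bool" where
  "eigenbasis A \<nu> W \<alpha> \<longleftrightarrow> inj \<nu>
     \<and> (\<forall>j. map_matrix of_int A *v W j = \<nu> j *s W j) \<and> (\<forall>j. W j \<noteq> 0)
     \<and> (\<forall>x. x = (\<Sum>j\<in>UNIV. \<alpha> x j *s W j))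
     \<and> (\<forall>c j. \<alpha> (\<Sum>j\<in>UNIV. c j *s W j) j = c j)
     \<and> (\<forall>j. \<exists>v. \<forall>x. \<alpha> x j = (\<Sum>i\<in>UNIV. v $ i * x $ i))"

text \<open>An irreducible polynomial over the rationals shares no root with its derivative, so
  there are \<open>CARD('n)\<close> distinct eigenvalues and their eigenvectors form a
  basis.\<close>

lemma irreducible_matrix_eigenbasis:
  fixes A :: "int ^ 'n ^ 'n"
  assumes "irreducible_matrix A"
  shows "\<exists>\<nu> W \<alpha>. eigenbasis A \<nu> W \<alpha>"
proof -
  let ?p = "char_polynomial (map_matrix rat_of_int A)"
  let ?AC = "map_matrix of_int A :: complex ^ 'n ^ 'n"
  let ?q = "char_polynomial ?AC"
  have q: "?q = map_poly of_rat ?p" by (simp add: map_poly_of_rat_char_polynomial)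
  have irr: "irreducible ?p" using assms by (simp add: irreducible_matrix_def)
  have dq: "degree ?q = CARD('n)" and dp: "degree ?p = CARD('n)"
    by (simp_all add: degree_char_polynomial)
  have q0: "?q \<noteq> 0" using dq by (metis degree_0 neq0_conv zero_less_card_finite)
  have pd: "pderiv ?q = map_poly of_rat (pderiv ?p)"
    unfolding q by (rule poly_eqI) (simp add: coeff_map_poly coeff_pderiv of_rat_mult del: of_nat_Suc)
  have "rsquarefree ?q"
    unfolding rsquarefree_roots
  proof (intro allI notI)
    fix a assume a: "poly ?q a = 0 \<and> poly (pderiv ?q) a = 0"
    have "degree (pderiv ?p) < degree ?p" "pderiv ?p \<noteq> 0"
      using dp by (auto simp: degree_pderiv pderiv_eq_0_iff)
    then show False
      using irreducible_no_common_root[OF irr, of "pderiv ?p" a] a pd q by simp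
  qed
  then have "card {z. poly ?q z = 0} = CARD('n)"
    using arg_cong[OF complex_poly_decompose_rsquarefree[of ?q], of degree] dq q0
    by (simp add: degree_prod_eq_sum_degree split: if_splits)
  then obtain \<nu> where bij: "bij_betw \<nu> (UNIV :: 'n set) {z. poly ?q z = 0}"
    by (metis finite_same_card_bij finite_UNIV poly_roots_finite q0 finite)
  have "\<exists>w. w \<noteq> 0 \<and> ?AC *v w = \<nu> j *s w" for j
  proof -
    have "det (mat (\<nu> j) - ?AC) = 0"
      using bij_betwE[OF bij] poly_char_polynomial[of ?AC "\<nu> j"] by simp
    then obtain w where "w \<noteq> 0" "(mat (\<nu> j) - ?AC) *v w = 0"
      by (metis invertible_det_nz invertible_left_inverse matrix_left_invertible_ker)
    moreover have "mat (\<nu> j) *v w = \<nu> j *s w"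
      by (simp add: vec_eq_iff mat_def matrix_vector_mult_def if_distrib[of "\<lambda>x. x * _"] cong: if_cong)
    ultimately show ?thesis
      by (metis eq_iff_diff_eq_0 matrix_vector_mult_diff_rdistrib)
  qed
  then obtain W where W0: "\<And>j. W j \<noteq> 0" and W: "\<And>j. ?AC *v W j = \<nu> j *s W j"
    by metis
  have inj: "inj \<nu>" using bij by (simp add: bij_betw_def)
  \<comment> \<open>The eigenvectors are the columns of \<open>M\<close>; row \<open>j\<close> of
    the inverse \<open>N\<close> is the form that reads off the \<open>j\<close>-th
    coordinate.\<close>
  define M :: "complex ^ 'n ^ 'n" where "M = (\<chi> i j. W j $ i)"
  have M: "M *v c = (\<Sum>j\<in>UNIV. (c $ j) *s W j)" for c
    by (simp add: M_def vec_eq_iff matrix_vector_mult_def mult.commute)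
  have "invertible M"
    unfolding invertible_left_inverse matrix_left_invertible_ker M
    using eigenvectors_independent[OF finite inj W W0] by (auto simp: vec_eq_iff)
  then obtain N where N: "M ** N = mat 1" "N ** M = mat 1"
    by (auto simp: invertible_def)
  define \<alpha> where "\<alpha> = (\<lambda>x j. (N *v x) $ j)"
  have "x = (\<Sum>j\<in>UNIV. \<alpha> x j *s W j)" for x
    unfolding \<alpha>_def M[symmetric] by (simp add: matrix_vector_mul_assoc N)
  moreover have "\<alpha> (\<Sum>j\<in>UNIV. c j *s W j) j = c j" for c j
  proof -
    have "(\<Sum>j\<in>UNIV. c j *s W j) = M *v (\<chi> j. c j)" by (simp add: M)
    then show ?thesis by (simp add: \<alpha>_def matrix_vector_mul_assoc N)
  qed
  moreover have "\<exists>v. \<forall>x. \<alpha> x j = (\<Sum>i\<in>UNIV. v $ i * x $ i)" for j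
    unfolding \<alpha>_def by (intro exI[of _ "N $ j"]) (simp add: matrix_vector_mult_def)
  ultimately show ?thesis
    unfolding eigenbasis_def using inj W W0 by blast
qed

lemma eigenbasisD:
  assumes "eigenbasis A \<nu> W \<alpha>"
  shows "inj \<nu>" "map_matrix of_int A *v W j = \<nu> j *s W j" "W j \<noteq> 0"
    "(\<Sum>j\<in>UNIV. \<alpha> x j *s W j) = x" "\<alpha> (\<Sum>j\<in>UNIV. c j *s W j) j = c j"
    "\<exists>v. \<forall>x. \<alpha> x j = (\<Sum>i\<in>UNIV. v $ i * x $ i)"
  using assms unfolding eigenbasis_def by metis+

lemma eigenbasis_funpow:
  assumes "eigenbasis A \<nu> W \<alpha>"
  shows "(((*v) (map_matrix of_int A)) ^^ n) (\<Sum>j\<in>UNIV. c j *s W j)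
    = (\<Sum>j\<in>UNIV. (c j * \<nu> j ^ n) *s W j)"
  by (induction n) (simp_all add: matrix_vector_mult_sum eigenbasisD[OF assms] mult_ac)

lemma eigenbasis_coeff_funpow:
  assumes "eigenbasis A \<nu> W \<alpha>"
  shows "\<alpha> ((((*v) (map_matrix of_int A)) ^^ n) x) j = \<alpha> x j * \<nu> j ^ n"
  by (subst eigenbasisD(4)[OF assms, of x, symmetric])
    (simp only: eigenbasis_funpow[OF assms] eigenbasisD(5)[OF assms])

lemma eigenbasis_coeff_linear:
  assumes "eigenbasis A \<nu> W \<alpha>"
  shows "\<alpha> (x + y) j = \<alpha> x j + \<alpha> y j" "\<alpha> (c *s x) j = c * \<alpha> x j" "\<alpha> 0 j = 0"
proof -
  obtain v where v: "\<And>x. \<alpha> x j = (\<Sum>i\<in>UNIV. v $ i * x $ i)"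
    using eigenbasisD(6)[OF assms] by blast
  show "\<alpha> (x + y) j = \<alpha> x j + \<alpha> y j" "\<alpha> (c *s x) j = c * \<alpha> x j" "\<alpha> 0 j = 0"
    by (simp_all add: v algebra_simps sum.distrib sum_distrib_left)
qed

text \<open>Compares arbitrary eigenvectors, as they occur in \<open>gen_eigenspace\<close>, with
  the fixed eigenbasis.\<close>

lemma eigenbasis_eigenvector_coeff:
  assumes E: "eigenbasis A \<nu> W \<alpha>" and "map_matrix of_int A *v w = \<mu> *s w" and "\<alpha> w j \<noteq> 0"
  shows "\<nu> j = \<mu>"
proof -
  have "\<alpha> (map_matrix of_int A *v w) j = \<alpha> w j * \<nu> j"
    using eigenbasis_coeff_funpow[OF E, of 1 w j] by simp
  then show ?thesis
    using assms(2,3) by (simp add: eigenbasis_coeff_linear[OF E])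
qed

section \<open>Powers of the matrix and integer functionals\<close>

lemma matrix_pow_mult_vec:
  fixes x :: "'a::comm_ring_1 ^ 'n"
  shows "map_matrix of_int (matrix_pow A n) *v x = (((*v) (map_matrix of_int A)) ^^ n) x"
proof (induction n)
  case 0
  have "map_matrix of_int (mat 1) = (mat 1 :: 'a ^ 'n ^ 'n)"
    by (simp add: vec_eq_iff mat_def)
  then show ?case by (simp add: matrix_pow_def)
next
  case (Suc n)
  have "map_matrix of_int (A ** B) = map_matrix of_int A ** (map_matrix of_int B :: 'a ^ 'n ^ 'n)" for B
    by (simp add: vec_eq_iff matrix_matrix_mult_def)
  then show ?case using Suc by (simp add: matrix_pow_def matrix_vector_mul_assoc[symmetric])
qed

text \<open>The irreducible power has \<open>CARD('a)\<close> distinct eigenvalues, each of them an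
  \<open>h\<close>-th power of some \<open>\<nu> j\<close>; counting leaves no room for a
  coincidence among these powers. Only here is the irreducibility of proper powers used.\<close>

lemma eigenvalue_powers_distinct:
  assumes "totally_irreducible A" and E: "eigenbasis A \<nu> W \<alpha>" and "h \<ge> 1"
  shows "inj (\<lambda>j. \<nu> j ^ h)"
proof -
  have "irreducible_matrix (matrix_pow A h)"
    using assms by (auto simp: totally_irreducible_def)
  then obtain \<nu>' W' \<alpha>' where E': "eigenbasis (matrix_pow A h) \<nu>' W' \<alpha>'"
    using irreducible_matrix_eigenbasis by blast
  have "\<nu>' l \<in> range (\<lambda>j. \<nu> j ^ h)" for l
  proof -
    obtain j where j: "\<alpha> (W' l) j \<noteq> 0"
      using eigenbasisD(3)[OF E', of l] eigenbasisD(4)[OF E, of "W' l"]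
      by (metis (no_types, lifting) sum.neutral vec.scale_zero_left)
    have "\<alpha> (\<nu>' l *s W' l) j = \<alpha> (W' l) j * \<nu> j ^ h"
      using eigenbasisD(2)[OF E', of l] eigenbasis_coeff_funpow[OF E, of h "W' l" j]
      by (simp add: matrix_pow_mult_vec)
    then show ?thesis using j by (auto simp: eigenbasis_coeff_linear[OF E])
  qed
  then have "range \<nu>' \<subseteq> range (\<lambda>j. \<nu> j ^ h)" by auto
  then have "card (range \<nu>') \<le> card (range (\<lambda>j. \<nu> j ^ h))"
    by (intro card_mono) auto
  then have "card (range (\<lambda>j. \<nu> j ^ h)) \<ge> CARD('a)"
    using card_image[OF eigenbasisD(1)[OF E']] by simp
  moreover have "card (range (\<lambda>j. \<nu> j ^ h)) \<le> CARD('a)"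
    by (rule card_image_le) simp
  ultimately show ?thesis
    by (intro eq_card_imp_inj_on) auto
qed

text \<open>Bilinear, without conjugation, and over any commutative ring, so that one symbol serves
  real vectors and complex eigenvectors.\<close>

definition int_pairing :: "int ^ 'n \<Rightarrow> 'a::comm_ring_1 ^ 'n \<Rightarrow> 'a" where
  "int_pairing k w = (\<Sum>i\<in>UNIV. of_int (k $ i) * w $ i)"

lemma int_pairing_linear:
  "int_pairing k (x + y) = int_pairing k x + int_pairing k y"
  "int_pairing k (c *s x) = c * int_pairing k x"
  "int_pairing k (sum f J) = (\<Sum>j\<in>J. int_pairing k (f j))"
proof -
  show "int_pairing k (x + y) = int_pairing k x + int_pairing k y"
    "int_pairing k (c *s x) = c * int_pairing k x"
    by (simp_all add: int_pairing_def algebra_simps sum.distrib sum_distrib_left)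
  show "int_pairing k (sum f J) = (\<Sum>j\<in>J. int_pairing k (f j))"
    unfolding int_pairing_def by (simp add: sum_distrib_left) (rule sum.swap)
qed

lemma int_pairing_vec_matrix:
  "int_pairing (k v* A) w = int_pairing k (map_matrix of_int A *v w)"
  by (simp add: int_pairing_def vector_matrix_mult_def matrix_vector_mult_def
      sum_distrib_left sum_distrib_right mult_ac) (rule sum.swap)

lemma of_int_det: "of_int (det A) = det (map_matrix of_int A)"
  by (simp add: det_def of_int_sum of_int_prod)

text \<open>If \<open>k\<close> vanished on \<open>W j\<close>, so would all its iterates under
  \<open>A\<close>. The first \<open>CARD('n)\<close> of them are integer vectors annihilating a
  common non-zero vector, hence rationally dependent. Such a dependence is a non-zero polynomial of
  degree below \<open>CARD('n)\<close> that annihilates \<open>k\<close>, and it would have an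
  eigenvalue as a root.\<close>

lemma int_pairing_eigenvector_nonzero:
  fixes A :: "int ^ 'n ^ 'n"
  assumes irr: "irreducible_matrix A" and E: "eigenbasis A \<nu> W \<alpha>" and "k \<noteq> 0"
  shows "int_pairing k (W j) \<noteq> 0"
proof
  assume k0: "int_pairing k (W j) = 0"
  let ?d = "CARD('n)"
  \<comment> \<open>\<open>e\<close> turns indices into exponents, so that the first iterates of
    \<open>k\<close> become the rows of a square matrix.\<close>
  obtain e where e: "bij_betw e (UNIV :: 'n set) {..<?d}"
    by (metis card_lessThan finite_UNIV finite_lessThan finite_same_card_bij finite)
  define row where "row = (\<lambda>m. ((\<lambda>v. v v* A) ^^ m) k)"
  have row: "int_pairing (row m) (W l) = \<nu> l ^ m * int_pairing k (W l)" for m l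
    unfolding row_def
    by (induction m) (simp_all add: int_pairing_vec_matrix eigenbasisD(2)[OF E] int_pairing_linear)
  define R :: "int ^ 'n ^ 'n" where "R = (\<chi> l. row (e l))"
  have "map_matrix complex_of_int R *v W j = 0"
    using row[of _ j] k0 by (simp add: vec_eq_iff matrix_vector_mult_def R_def int_pairing_def)
  then have "det (map_matrix complex_of_int R) = 0"
    using eigenbasisD(3)[OF E] by (metis invertible_det_nz invertible_left_inverse matrix_left_invertible_ker)
  then have "det R = 0"
    using of_int_det[of R, where ?'a = complex] by simp
  then have "det (transpose (map_matrix rat_of_int R)) = 0"
    using of_int_det[of R, where ?'a = rat] by (simp add: det_transpose)
  then obtain c where c: "c \<noteq> 0" "transpose (map_matrix rat_of_int R) *v c = 0"
    by (metis invertible_det_nz invertible_left_inverse matrix_left_invertible_ker)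
  have c': "(\<Sum>l\<in>UNIV. of_int (row (e l) $ i) * c $ l) = 0" for i
    using c(2) by (simp add: vec_eq_iff matrix_vector_mult_def transpose_def R_def)
  \<comment> \<open>The rational dependence of the rows, read as a polynomial in the matrix.\<close>
  define g where "g = (\<Sum>l\<in>UNIV. monom (c $ l) (e l))"
  have deg: "degree g < ?d"
  proof -
    have "degree (monom (c $ l) (e l)) \<le> ?d - 1" for l
    proof -
      have "e l < ?d" using bij_betwE[OF e] by simp
      then show ?thesis using degree_monom_le[of "c $ l" "e l"] by linarith
    qed
    then have "degree g \<le> ?d - 1"
      unfolding g_def by (intro degree_sum_le) auto
    moreover have "?d > 0" by simp
    ultimately show ?thesis by linarith
  qed
  obtain l where l: "c $ l \<noteq> 0" using c(1) by (auto simp: vec_eq_iff)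
  have "coeff g (e l) = (\<Sum>m\<in>UNIV. if m = l then c $ l else 0)"
    unfolding g_def coeff_sum
    by (intro sum.cong) (use bij_betw_imp_inj_on[OF e] in \<open>auto simp: inj_on_def\<close>)
  then have "coeff g (e l) \<noteq> 0" using l by simp
  then have g0: "g \<noteq> 0" by auto
  \<comment> \<open>The eigenvectors span, so the non-zero functional \<open>k\<close> survives on
    some \<open>W m\<close>; there the relation forces \<open>\<nu> m\<close> to be a root of
    \<open>g\<close>.\<close>
  obtain i where i: "k $ i \<noteq> 0" using assms(3) by (auto simp: vec_eq_iff)
  have "int_pairing k (axis i 1 :: complex ^ 'n) = of_int (k $ i)"
    by (simp add: int_pairing_def axis_def if_distrib cong: if_cong)
  then have "int_pairing k (\<Sum>m\<in>UNIV. \<alpha> (axis i 1) m *s W m) \<noteq> 0"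
    using i eigenbasisD(4)[OF E] by simp
  then obtain m where m: "int_pairing k (W m) \<noteq> 0"
    unfolding int_pairing_linear using sum.not_neutral_contains_not_neutral by fastforce
  have "0 = (\<Sum>i\<in>UNIV. of_rat (\<Sum>l\<in>UNIV. of_int (row (e l) $ i) * c $ l) * W m $ i)"
    using c' by simp
  also have "\<dots> = (\<Sum>l\<in>UNIV. of_rat (c $ l) * int_pairing (row (e l)) (W m))"
    by (simp add: int_pairing_def of_rat_sum of_rat_mult sum_distrib_left sum_distrib_right mult_ac)
      (rule sum.swap)
  also have "\<dots> = (\<Sum>l\<in>UNIV. of_rat (c $ l) * \<nu> m ^ e l) * int_pairing k (W m)"
    by (simp only: row sum_distrib_right mult.assoc)
  also have "(\<Sum>l\<in>UNIV. of_rat (c $ l) * \<nu> m ^ e l) = poly (map_poly of_rat g) (\<nu> m)"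
    by (simp add: g_def map_poly_of_rat_sum poly_sum map_poly_monom poly_monom)
  finally have "poly (map_poly of_rat g) (\<nu> m) = 0" using m by simp
  moreover have "poly (map_poly of_rat g) (\<nu> m) \<noteq> 0"
  proof (rule irreducible_no_common_root)
    show "irreducible (char_polynomial (map_matrix rat_of_int A))"
      using irr by (simp add: irreducible_matrix_def)
    show "degree g < degree (char_polynomial (map_matrix rat_of_int A))"
      using deg by (simp add: degree_char_polynomial)
    have "(mat (\<nu> m) - map_matrix of_int A) *v W m = 0"
      using eigenbasisD(2)[OF E, of m]
      by (simp add: matrix_vector_mult_diff_rdistrib)
        (simp add: vec_eq_iff mat_def matrix_vector_mult_def if_distrib[of "\<lambda>x. x * _"] cong: if_cong)
    then have "det (mat (\<nu> m) - map_matrix of_int A) = 0"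
      using eigenbasisD(3)[OF E] by (metis invertible_det_nz invertible_left_inverse matrix_left_invertible_ker)
    then show "poly (map_poly of_rat (char_polynomial (map_matrix rat_of_int A))) (\<nu> m) = 0"
      by (simp add: map_poly_of_rat_char_polynomial poly_char_polynomial)
  qed (rule g0)
  ultimately show False by simp
qed

section \<open>Growth of vectors outside the weak stable subspace\<close>

definition cvec :: "real ^ 'n \<Rightarrow> complex ^ 'n" where
  "cvec x = (\<chi> i. complex_of_real (x $ i))"

lemma cvec_nth [simp]: "cvec x $ i = of_real (x $ i)"
  by (simp add: cvec_def)

lemma cvec_funpow:
  fixes A :: "int ^ 'n ^ 'n"
  shows "cvec ((((*v) (map_matrix of_int A)) ^^ n) x) = (((*v) (map_matrix of_int A)) ^^ n) (cvec x)"
proof (induction n)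
  case (Suc n)
  have "cvec (map_matrix of_int A *v y) = map_matrix of_int A *v cvec y" for y :: "real ^ 'n"
    by (simp add: vec_eq_iff matrix_vector_mult_def)
  then have "cvec (map_matrix of_int A *v ((((*v) (map_matrix of_int A)) ^^ n) x))
    = map_matrix of_int A *v cvec ((((*v) (map_matrix of_int A)) ^^ n) x)" .
  then show ?case unfolding Suc.IH by simp
qed simp

text \<open>A generator is the real part of an eigenvector, that is, the mean of this vector and its
  conjugate. Both have eigenvalues of modulus at most 1, hence no component along an expanding
  \<open>W j\<close>.\<close>

lemma weak_stable_subspace_coeff_zero:
  assumes E: "eigenbasis A \<nu> W \<alpha>" and x: "x \<in> weak_stable_subspace A" and j: "cmod (\<nu> j) > 1"
  shows "\<alpha> (cvec x) j = 0"
  using x unfolding weak_stable_subspace_def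
proof (induction rule: span_induct)
  case base
  have 1: "cvec (x + y) = cvec x + cvec y" for x y :: "real ^ 'a" by (simp add: vec_eq_iff)
  have 2: "cvec (c *\<^sub>R x) = of_real c *s cvec x" for c and x :: "real ^ 'a" by (simp add: vec_eq_iff)
  have 3: "cvec 0 = (0 :: complex ^ 'a)" by (simp add: vec_eq_iff)
  show ?case
    by (auto simp: subspace_def 1 2 3 eigenbasis_coeff_linear[OF E])
next
  case (step x)
  then obtain \<mu> w where \<mu>: "cmod \<mu> \<le> 1" and w: "map_matrix of_int A *v w = \<mu> *s w"
    and x: "x = (\<chi> i. Re (w $ i))"
    by (auto simp: gen_eigenspace_def complex_eigenspace_def)
  let ?w' = "\<chi> i. cnj (w $ i)"
  have w': "map_matrix of_int A *v ?w' = cnj \<mu> *s ?w'"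
    using w by (simp add: vec_eq_iff matrix_vector_mult_def)
      (metis (no_types, lifting) complex_cnj_mult complex_cnj_of_int cnj_sum sum.cong)
  have "\<alpha> w j = 0" using eigenbasis_eigenvector_coeff[OF E w] \<mu> j by force
  moreover have "\<alpha> ?w' j = 0" using eigenbasis_eigenvector_coeff[OF E w'] \<mu> j
    by (metis complex_mod_cnj leD)
  moreover have "cvec x = (1/2) *s (w + ?w')"
    by (auto simp: x vec_eq_iff complex_eq_iff)
  ultimately show ?case by (simp add: eigenbasis_coeff_linear[OF E])
qed

text \<open>Since \<open>x\<close> is real, it is the sum of the real parts of the terms of its
  expansion, and the expanding terms are absent.\<close>

lemma weak_stable_subspaceI:
  assumes E: "eigenbasis A \<nu> W \<alpha>" and x: "\<And>j. cmod (\<nu> j) > 1 \<Longrightarrow> \<alpha> (cvec x) j = 0"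
  shows "x \<in> weak_stable_subspace A"
proof -
  let ?y = "\<lambda>j. \<chi> i. Re ((\<alpha> (cvec x) j *s W j) $ i)"
  have "x = (\<Sum>j\<in>UNIV. ?y j)"
  proof (subst vec_eq_iff, intro allI)
    fix i
    have "x $ i = Re (cvec x $ i)" by simp
    also have "cvec x = (\<Sum>j\<in>UNIV. \<alpha> (cvec x) j *s W j)" by (simp only: eigenbasisD(4)[OF E])
    finally show "x $ i = (\<Sum>j\<in>UNIV. ?y j) $ i" by (simp add: Re_sum)
  qed
  also have "\<dots> \<in> weak_stable_subspace A"
    unfolding weak_stable_subspace_def
  proof (rule span_sum)
    fix j
    show "?y j \<in> span (\<Union>\<nu>\<in>{\<nu>. is_eigenvalue A \<nu> \<and> cmod \<nu> \<le> 1}. gen_eigenspace A \<nu>)"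
    proof (cases "cmod (\<nu> j) > 1")
      case True
      then have "?y j = 0" using x by (simp add: vec_eq_iff)
      then show ?thesis by (simp only: span_zero)
    next
      case False
      have "is_eigenvalue A (\<nu> j)"
        using eigenbasisD(2,3)[OF E, of j] by (auto simp: is_eigenvalue_def complex_eigenspace_def)
      moreover have "\<alpha> (cvec x) j *s W j \<in> complex_eigenspace A (\<nu> j)"
        by (simp add: complex_eigenspace_def vector_scalar_commute eigenbasisD(2)[OF E] mult.commute)
      then have "?y j \<in> gen_eigenspace A (\<nu> j)"
        unfolding gen_eigenspace_def by (rule image_eqI[rotated]) simp
      ultimately show ?thesis
        using False by (intro span_base) auto
    qed
  qed
  finally show ?thesis .
qed

lemma norm_funpow_le:
  assumes E: "eigenbasis A \<nu> W \<alpha>" and "\<And>j. \<alpha> (cvec x) j \<noteq> 0 \<Longrightarrow> cmod (\<nu> j) \<le> \<rho>" "\<rho> \<ge> 0"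
  shows "\<exists>C>0. \<forall>n. norm ((((*v) (map_matrix of_int A)) ^^ n) x) \<le> C * \<rho> ^ n"
proof -
  let ?a = "\<lambda>j. \<alpha> (cvec x) j"
  define C where "C = (\<Sum>i\<in>UNIV. \<Sum>j\<in>UNIV. cmod (?a j) * cmod (W j $ i))"
  have "norm ((((*v) (map_matrix of_int A)) ^^ n) x) \<le> C * \<rho> ^ n" for n
  proof -
    let ?y = "(((*v) (map_matrix of_int A)) ^^ n) x"
    have cy: "cvec ?y = (\<Sum>j\<in>UNIV. (?a j * \<nu> j ^ n) *s W j)"
      unfolding cvec_funpow by (subst eigenbasisD(4)[OF E, of "cvec x", symmetric]) (rule eigenbasis_funpow[OF E])
    have y: "of_real (?y $ i) = (\<Sum>j\<in>UNIV. ?a j * \<nu> j ^ n * W j $ i)" for i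
    proof -
      have "cvec ?y $ i = (\<Sum>j\<in>UNIV. (?a j * \<nu> j ^ n) *s W j) $ i"
        by (simp only: cy)
      then show ?thesis by (simp only: cvec_nth sum_component vector_smult_component)
    qed
    have "norm ?y \<le> (\<Sum>i\<in>UNIV. \<bar>?y $ i\<bar>)" by (rule norm_le_l1_cart)
    also have "\<dots> = (\<Sum>i\<in>UNIV. cmod (\<Sum>j\<in>UNIV. ?a j * \<nu> j ^ n * W j $ i))"
      by (simp add: y[symmetric])
    also have "\<dots> \<le> (\<Sum>i\<in>UNIV. \<Sum>j\<in>UNIV. cmod (?a j) * cmod (W j $ i) * \<rho> ^ n)"
    proof (intro sum_mono sum_norm_le)
      fix i j
      have "cmod (?a j) * cmod (\<nu> j) ^ n \<le> cmod (?a j) * \<rho> ^ n"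
        using assms(2)[of j] by (cases "?a j = 0") (auto intro!: mult_left_mono power_mono)
      then show "cmod (?a j * \<nu> j ^ n * W j $ i) \<le> cmod (?a j) * cmod (W j $ i) * \<rho> ^ n"
        by (simp add: norm_mult norm_power) (use mult_right_mono[of _ _ "cmod (W j $ i)"] in \<open>fastforce simp: mult_ac\<close>)
    qed
    also have "\<dots> = C * \<rho> ^ n" by (simp add: C_def sum_distrib_right)
    finally show ?thesis .
  qed
  moreover have "C * \<rho> ^ n \<le> (C + 1) * \<rho> ^ n" for n
    using assms(3) by (intro mult_right_mono) auto
  moreover have "C \<ge> 0" unfolding C_def by (intro sum_nonneg) auto
  \<comment> \<open>The added 1 keeps the constant positive even if all coordinates vanish.\<close>
  ultimately show ?thesis by (intro exI[of _ "C + 1"]) (auto intro: order_trans)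
qed

text \<open>Eigenvalues of modulus 1 are allowed here; as the matrix is diagonalisable, they cause
  no polynomial growth.\<close>

lemma weak_stable_subspace_bounded:
  assumes "irreducible_matrix A" and x: "x \<in> weak_stable_subspace A"
  shows "\<exists>C>0. \<forall>n. norm ((((*v) (map_matrix of_int A)) ^^ n) x) \<le> C"
proof -
  obtain \<nu> W \<alpha> where E: "eigenbasis A \<nu> W \<alpha>"
    using irreducible_matrix_eigenbasis assms by blast
  have "cmod (\<nu> j) \<le> 1" if "\<alpha> (cvec x) j \<noteq> 0" for j
    using weak_stable_subspace_coeff_zero[OF E x, of j] that by force
  then show ?thesis using norm_funpow_le[OF E, of x 1] by simp
qed

lemma exists_dominant_eigenvalue:
  assumes E: "eigenbasis A \<nu> W \<alpha>" and x: "x \<notin> weak_stable_subspace A"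
  obtains l where "cmod (\<nu> l) > 1" "\<alpha> (cvec x) l \<noteq> 0"
    "\<And>j. \<alpha> (cvec x) j \<noteq> 0 \<Longrightarrow> cmod (\<nu> j) \<le> cmod (\<nu> l)"
proof -
  let ?J = "{j. \<alpha> (cvec x) j \<noteq> 0}"
  obtain j0 where j0: "j0 \<in> ?J" "cmod (\<nu> j0) > 1"
    using weak_stable_subspaceI[OF E, of x] x by blast
  have fin: "finite ((\<lambda>j. cmod (\<nu> j)) ` ?J)" by simp
  have "Max ((\<lambda>j. cmod (\<nu> j)) ` ?J) \<in> (\<lambda>j. cmod (\<nu> j)) ` ?J"
    by (rule Max_in) (use j0 in auto)
  then obtain l where l: "l \<in> ?J" "cmod (\<nu> l) = Max ((\<lambda>j. cmod (\<nu> j)) ` ?J)" by auto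
  have "cmod (\<nu> j) \<le> cmod (\<nu> l)" if "j \<in> ?J" for j
    unfolding l(2) using that by (intro Max_ge) auto
  with that[of l] l(1) j0 show ?thesis by fastforce
qed

text \<open>The rate is the largest modulus among the eigenvalues occurring in \<open>x\<close>. The
  coordinate form of one dominant eigenvalue detects it, so that cancellation among eigenvalues of
  equal modulus cannot spoil the lower bound.\<close>

lemma exponential_growth:
  assumes "irreducible_matrix A" and x: "x \<notin> weak_stable_subspace A"
  shows "\<exists>\<rho>>1. \<exists>c>0. \<exists>C>0. \<forall>n. c * \<rho> ^ n \<le> norm ((((*v) (map_matrix of_int A)) ^^ n) x)
     \<and> norm ((((*v) (map_matrix of_int A)) ^^ n) x) \<le> C * \<rho> ^ n"
proof -
  obtain \<nu> W \<alpha> where E: "eigenbasis A \<nu> W \<alpha>"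
    using irreducible_matrix_eigenbasis assms by blast
  obtain l where l: "cmod (\<nu> l) > 1" "\<alpha> (cvec x) l \<noteq> 0"
    "\<And>j. \<alpha> (cvec x) j \<noteq> 0 \<Longrightarrow> cmod (\<nu> j) \<le> cmod (\<nu> l)"
    using exists_dominant_eigenvalue[OF E x] by blast
  obtain C where C: "C > 0" "\<And>n. norm ((((*v) (map_matrix of_int A)) ^^ n) x) \<le> C * cmod (\<nu> l) ^ n"
    using norm_funpow_le[OF E l(3), of x] by auto
  obtain v where v: "\<And>x. \<alpha> x l = (\<Sum>i\<in>UNIV. v $ i * x $ i)"
    using eigenbasisD(6)[OF E] by blast
  define K where "K = (\<Sum>i\<in>UNIV. cmod (v $ i)) + 1"
  have K: "K > 0" unfolding K_def by (rule add_nonneg_pos) (auto intro: sum_nonneg)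
  have "cmod (\<alpha> (cvec x) l) / K * cmod (\<nu> l) ^ n \<le> norm ((((*v) (map_matrix of_int A)) ^^ n) x)" for n
  proof -
    let ?y = "(((*v) (map_matrix of_int A)) ^^ n) x"
    have "cmod (\<alpha> (cvec x) l) * cmod (\<nu> l) ^ n = cmod (\<alpha> (cvec ?y) l)"
      by (simp add: cvec_funpow eigenbasis_coeff_funpow[OF E] norm_mult norm_power)
    also have "\<dots> \<le> (\<Sum>i\<in>UNIV. cmod (v $ i) * norm ?y)"
      unfolding v by (intro sum_norm_le) (auto simp: norm_mult intro!: mult_left_mono component_le_norm_cart)
    also have "\<dots> \<le> K * norm ?y"
      by (simp add: K_def sum_distrib_right[symmetric] algebra_simps)
    finally show ?thesis using K by (simp add: field_simps)
  qed
  moreover have "cmod (\<alpha> (cvec x) l) / K > 0" using l(2) K by simp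
  ultimately show ?thesis using C l(1) by blast
qed

text \<open>The only automorphisms of the circle are multiplication by 1 and by -1. This rules out
  dimension one in the theorem, where the two subspaces differ.\<close>

lemma weak_stable_subspace_one_dim:
  fixes A :: "int ^ 'n ^ 'n"
  assumes "CARD('n) = 1" "invertible A" "irreducible_matrix A"
  shows "weak_stable_subspace A = UNIV"
proof -
  obtain \<nu> W \<alpha> where E: "eigenbasis A \<nu> W \<alpha>"
    using irreducible_matrix_eigenbasis assms by blast
  obtain i :: 'n where i: "UNIV = {i}" using assms(1) by (auto simp: card_1_singleton_iff)
  obtain B where "A ** B = mat 1" using assms(2) by (auto simp: invertible_def)
  then have "A $ i $ i * B $ i $ i = 1"
    by (simp add: vec_eq_iff matrix_matrix_mult_def i mat_def)
  then have A1: "\<bar>A $ i $ i\<bar> = 1" by (metis zmult_eq_1_iff abs_minus_cancel abs_one)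
  have "cmod (\<nu> j) \<le> 1" for j
  proof -
    have ji: "j = i" using i by auto
    have "of_int (A $ i $ i) * W j $ i = \<nu> j * W j $ i"
      using eigenbasisD(2)[OF E, of j] by (simp add: vec_eq_iff matrix_vector_mult_def i)
    moreover have "W j $ i \<noteq> 0"
      using eigenbasisD(3)[OF E, of j] i by (metis UNIV_I singletonD vec_eq_iff zero_index)
    ultimately have "\<nu> j = of_int (A $ i $ i)" by simp
    then show ?thesis using A1 by (metis norm_of_int of_int_1 order_refl of_int_abs)
  qed
  then show ?thesis using weak_stable_subspaceI[OF E] by (metis UNIV_eq_I not_less)
qed

text \<open>Otherwise all powers of \<open>A\<close> would be integer matrices with uniformly
  bounded entries, so two powers would coincide and every eigenvalue would be a root of unity of one
  common order. By \<open>eigenvalue_powers_distinct\<close> this is possible only for a single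
  eigenvalue.\<close>

lemma weak_stable_subspace_proper:
  fixes A :: "int ^ 'n ^ 'n"
  assumes "CARD('n) \<noteq> 1" "invertible A" "totally_irreducible A"
  shows "weak_stable_subspace A \<noteq> UNIV"
proof
  assume V: "weak_stable_subspace A = UNIV"
  have "irreducible_matrix (matrix_pow A 1)"
    using assms(3) unfolding totally_irreducible_def by blast
  then have irr: "irreducible_matrix A" by (simp add: matrix_pow_def)
  obtain \<nu> W \<alpha> where E: "eigenbasis A \<nu> W \<alpha>"
    using irreducible_matrix_eigenbasis irr by blast
  have "\<forall>i. \<exists>C>0. \<forall>n. norm ((((*v) (map_matrix of_int A)) ^^ n) (axis i 1 :: real ^ 'n)) \<le> C"
    using weak_stable_subspace_bounded[OF irr] V by blast
  then obtain C where C: "\<And>i n. norm ((((*v) (map_matrix of_int A)) ^^ n) (axis i 1 :: real ^ 'n)) \<le> C i"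
    by metis
  have entry: "\<bar>real_of_int (matrix_pow A n $ i $ j)\<bar> \<le> C j" for n i j
  proof -
    have "(map_matrix of_int (matrix_pow A n) *v (axis j 1 :: real ^ 'n)) $ i = of_int (matrix_pow A n $ i $ j)"
      by (simp add: matrix_vector_mult_def axis_def if_distrib cong: if_cong)
    then show ?thesis
      using C[of n j] component_le_norm_cart order_trans unfolding matrix_pow_mult_vec by metis
  qed
  define N where "N = \<lceil>Max (range C)\<rceil>"
  have N: "\<bar>matrix_pow A n $ i $ j\<bar> \<le> N" for n i j
  proof -
    have "C j \<le> Max (range C)" by (intro Max_ge) auto
    then have "real_of_int \<bar>matrix_pow A n $ i $ j\<bar> \<le> real_of_int N"
      using entry[of n i j] unfolding N_def by linarith
    then show ?thesis by linarith
  qed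
  have "range (matrix_pow A) \<subseteq> (\<lambda>f. \<chi> i j. f i j) ` (UNIV \<rightarrow>\<^sub>E (UNIV \<rightarrow>\<^sub>E {-N..N}))"
  proof safe
    fix n
    have "matrix_pow A n = (\<chi> i j. (\<lambda>i j. matrix_pow A n $ i $ j) i j)" by simp
    moreover have "(\<lambda>i j. matrix_pow A n $ i $ j) \<in> UNIV \<rightarrow>\<^sub>E (UNIV \<rightarrow>\<^sub>E {-N..N})"
      using N by (auto simp: abs_le_iff) (metis minus_le_iff)
    ultimately show "matrix_pow A n \<in> (\<lambda>f. \<chi> i j. f i j) ` (UNIV \<rightarrow>\<^sub>E (UNIV \<rightarrow>\<^sub>E {-N..N}))"
      by (rule image_eqI)
  qed
  then have "finite (range (matrix_pow A))"
    by (rule finite_subset) (intro finite_imageI finite_PiE finite_atLeastAtMost_int, auto)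
  then have "\<not> inj (matrix_pow A)"
    using finite_imageD infinite_UNIV_nat by blast
  then obtain a b where ab: "a < b" "matrix_pow A a = matrix_pow A b"
    unfolding inj_def by (metis linorder_neqE_nat)
  have "\<nu> j ^ (b - a) = 1" for j
  proof -
    have "\<alpha> (map_matrix of_int (matrix_pow A n) *v W j) j = \<alpha> (W j) j * \<nu> j ^ n" for n
      unfolding matrix_pow_mult_vec by (rule eigenbasis_coeff_funpow[OF E])
    then have "\<alpha> (W j) j * \<nu> j ^ a = \<alpha> (W j) j * \<nu> j ^ b"
      using ab(2) by metis
    moreover have "W j = (\<Sum>i\<in>UNIV. (if i = j then 1 else 0) *s W i)"
      by (simp add: vec_eq_iff if_distrib[of "\<lambda>x. x * _"] cong: if_cong)
    then have "\<alpha> (W j) j = 1"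
      using eigenbasisD(5)[OF E, of "\<lambda>i. if i = j then 1 else 0" j] by simp
    moreover have "\<nu> j ^ b = \<nu> j ^ a * \<nu> j ^ (b - a)"
      using ab(1) by (simp add: power_add[symmetric])
    ultimately have eq: "\<nu> j ^ a = \<nu> j ^ a * \<nu> j ^ (b - a)"
      by (metis mult_1)
    \<comment> \<open>Invertibility of \<open>A\<close> permits cancelling
      \<open>\<nu> j ^ a\<close>.\<close>
    have "\<nu> j \<noteq> 0"
    proof
      assume "\<nu> j = 0"
      then have z: "map_matrix complex_of_int A *v W j = 0" using eigenbasisD(2)[OF E, of j] by simp
      obtain B where B: "B ** A = mat 1" using assms(2) by (auto simp: invertible_def)
      have "map_matrix complex_of_int B ** map_matrix complex_of_int A = map_matrix complex_of_int (B ** A)"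
        by (simp add: vec_eq_iff matrix_matrix_mult_def)
      also have "\<dots> = mat 1" unfolding B by (simp add: vec_eq_iff mat_def)
      finally have "map_matrix complex_of_int B *v (map_matrix complex_of_int A *v W j) = W j"
        by (simp add: matrix_vector_mul_assoc)
      then show False using z eigenbasisD(3)[OF E, of j] by simp
    qed
    with eq show ?thesis by simp
  qed
  then have "inj (\<lambda>j::'n. 1 :: complex)"
    using eigenvalue_powers_distinct[OF assms(3) E, of "b - a"] ab(1) by simp
  then have "\<exists>x. (UNIV :: 'n set) = {x}" by (auto simp: inj_def)
  then show False using assms(1) by (auto simp: card_1_singleton_iff)
qed

section \<open>Cantor sets avoiding a sequence of sparse sets\<close>

lemma card_separated_le:
  fixes a :: "nat \<Rightarrow> real"
  assumes L: "L > 0" and fin: "finite A"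
    and sep: "\<And>k k'. k \<in> A \<Longrightarrow> k' \<in> A \<Longrightarrow> k \<noteq> k' \<Longrightarrow> L \<le> \<bar>a k - a k'\<bar>"
    and range: "\<And>k. k \<in> A \<Longrightarrow> u \<le> a k \<and> a k \<le> u + real p * L"
  shows "card A \<le> Suc p"
proof -
  define f where "f = (\<lambda>k. \<lfloor>(a k - u) / L\<rfloor>)"
  have "inj_on f A"
  proof (rule inj_onI, rule ccontr)
    fix k k' assume *: "k \<in> A" "k' \<in> A" "f k = f k'" "k \<noteq> k'"
    then have "\<bar>(a k - u) / L - (a k' - u) / L\<bar> < 1"
      unfolding f_def by linarith
    then have "\<bar>a k - a k'\<bar> < L"
      using L by (simp add: diff_divide_distrib[symmetric] abs_divide field_simps)
    then show False using sep[of k k'] * by simp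
  qed
  moreover have "f ` A \<subseteq> {0..int p}"
    using range L by (auto simp: f_def floor_le_iff divide_le_eq field_simps)
      (smt (verit) L le_divide_eq mult.commute of_int_of_nat_eq floor_le_iff floor_of_nat floor_mono mult_le_cancel_right_pos)
  ultimately have "card A \<le> card {0..int p}"
    by (rule card_inj_on_le) simp
  then show ?thesis by simp
qed

text \<open>Passing to the coarser \<open>M\<close>-adic interval around \<open>\<omega>\<close>
  drops the last base-\<open>M\<close> digit of its index.\<close>

lemma floor_power_div:
  assumes "M > 0"
  shows "nat \<lfloor>real M ^ m * \<omega>\<rfloor> = nat \<lfloor>real M ^ Suc m * \<omega>\<rfloor> div M"
proof -
  have "\<lfloor>real M ^ Suc m * \<omega>\<rfloor> div int M = \<lfloor>real M ^ Suc m * \<omega> / real_of_int (int M)\<rfloor>"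
    by (rule floor_divide_real_eq_div[symmetric]) simp
  also have "real M ^ Suc m * \<omega> / real_of_int (int M) = real M ^ m * \<omega>"
    using assms by simp
  finally have eq: "\<lfloor>real M ^ m * \<omega>\<rfloor> = \<lfloor>real M ^ Suc m * \<omega>\<rfloor> div int M" by simp
  show ?thesis
  proof (cases "\<lfloor>real M ^ Suc m * \<omega>\<rfloor> \<ge> 0")
    case True
    then show ?thesis unfolding eq by (simp add: nat_div_distrib)
  next
    case False
    then have "\<lfloor>real M ^ Suc m * \<omega>\<rfloor> div int M < 0"
      using assms by (intro div_neg_pos_less0) auto
    then show ?thesis unfolding eq using False by simp
  qed
qed

text \<open>At each level exactly \<open>M\<close> children that avoid \<open>bad m\<close> are
  kept, and the base-\<open>M\<close> digits of \<open>\<omega>\<close> choose among them. The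
  parameters belonging to an interval of length \<open>\<sigma> * \<theta> ^ m\<close> thus fill an
  interval of length \<open>1 / M ^ m\<close>, and the condition on \<open>\<gamma>\<close> compares
  the two lengths, which gives a Frostman bound. The random variable \<open>x\<close> stands in for
  the measure on the Cantor set.\<close>

lemma moran_construction:
  fixes \<sigma> \<theta> \<gamma> :: real and Q M :: nat and bad :: "nat \<Rightarrow> real set"
  assumes \<sigma>: "0 < \<sigma>" and \<theta>: "0 < \<theta>" "\<theta> * real Q \<le> 1" and M: "M \<ge> 2"
    and \<gamma>: "0 < \<gamma>" "1 / real M \<le> \<theta> powr \<gamma>"
    and bad: "\<And>m x. card {j. j < Q \<and> bad m \<inter> {x + real j * (\<sigma> * \<theta> ^ Suc m) ..
        x + real (Suc j) * (\<sigma> * \<theta> ^ Suc m)} \<noteq> {}} + M \<le> Q"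
  shows "\<exists>x :: real \<Rightarrow> real. x \<in> borel_measurable borel \<and> (\<forall>\<omega>. 0 \<le> x \<omega> \<and> x \<omega> \<le> \<sigma>) \<and> (\<forall>\<omega> m. x \<omega> \<notin> bad m)
    \<and> (\<forall>a r. r \<ge> 0 \<longrightarrow> emeasure lborel {\<omega>\<in>{0..<1}. \<bar>x \<omega> - a\<bar> \<le> r} \<le> ennreal (4 * (r / (\<theta> * \<sigma>)) powr \<gamma>))"
proof -
  define L where "L = (\<lambda>m. \<sigma> * \<theta> ^ m)"
  define cell where "cell = (\<lambda>m x j. {x + real j * L (Suc m) .. x + real (Suc j) * L (Suc m)})"
  have L0: "L m > 0" for m using \<sigma> \<theta> by (simp add: L_def)
  have QL: "real Q * L (Suc m) \<le> L m" for m
    using \<theta> \<sigma> mult_right_mono[OF \<theta>(2), of "L m"] L0[of m] by (simp add: L_def mult_ac)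
  have "\<exists>c. inj_on c {..<M} \<and> c ` {..<M} \<subseteq> {j. j < Q \<and> bad m \<inter> cell m x j = {}}" for m x
  proof -
    let ?B = "{j. j < Q \<and> bad m \<inter> cell m x j \<noteq> {}}" and ?G = "{j. j < Q \<and> bad m \<inter> cell m x j = {}}"
    have "card ?B + card ?G = card (?B \<union> ?G)" by (rule card_Un_disjoint[symmetric]) auto
    also have "?B \<union> ?G = {..<Q}" by auto
    finally have "card ?B + card ?G = Q" by simp
    moreover have "card ?B + M \<le> Q" using bad[where m = m and x = x] by (simp add: cell_def L_def)
    ultimately have "card {..<M} \<le> card ?G" by simp
    then show ?thesis using card_le_inj[of "{..<M}" ?G] by auto
  qed
  then obtain c where c_inj: "\<And>m x. inj_on (c m x) {..<M}"
    and c_sub: "\<And>m x. c m x ` {..<M} \<subseteq> {j. j < Q \<and> bad m \<inter> cell m x j = {}}"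
    by metis
  have c: "c m x i < Q" "bad m \<inter> cell m x (c m x i) = {}" if "i < M" for m x i
    using c_sub[of m x] that by auto
  \<comment> \<open>\<open>a m k\<close> is the left endpoint of the interval addressed by the
    \<open>m\<close> base-\<open>M\<close> digits of \<open>k\<close>; the last digit
    \<open>k mod M\<close> is the most recent choice.\<close>
  define a where "a = rec_nat (\<lambda>k::nat. 0::real)
      (\<lambda>m f k. f (k div M) + real (c m (f (k div M)) (k mod M)) * L (Suc m))"
  have a0: "a 0 k = 0" for k by (simp add: a_def)
  have aS: "a (Suc m) k = a m (k div M) + real (c m (a m (k div M)) (k mod M)) * L (Suc m)" for m k
    by (simp add: a_def)
  have modM: "k mod M < M" for k using M by simp
  have lo: "a m (k div M) \<le> a (Suc m) k" for m k
    using L0[of "Suc m"] by (simp add: aS)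
  have hi: "a (Suc m) k + L (Suc m) \<le> a m (k div M) + L m" for m k
  proof -
    have "real (c m (a m (k div M)) (k mod M)) + 1 \<le> real Q"
      using c(1)[OF modM, of m "a m (k div M)" k] by linarith
    then have "(real (c m (a m (k div M)) (k mod M)) + 1) * L (Suc m) \<le> real Q * L (Suc m)"
      using L0[of "Suc m"] by (intro mult_right_mono) auto
    then show ?thesis using QL[of m] by (simp add: aS algebra_simps)
  qed
  have sep: "L m \<le> \<bar>a m k - a m k'\<bar>" if "k < M ^ m" "k' < M ^ m" "k \<noteq> k'" for m k k'
    using that
  proof (induction m arbitrary: k k')
    case (Suc m)
    show ?case
    proof (cases "k div M = k' div M")
      case False
      have "k div M < M ^ m" "k' div M < M ^ m"
        using Suc.prems by (simp_all add: less_mult_imp_div_less mult.commute)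
      then have "L m \<le> \<bar>a m (k div M) - a m (k' div M)\<bar>"
        using Suc.IH False by blast
      then show ?thesis
        using lo[of m k] lo[of m k'] hi[of m k] hi[of m k'] by linarith
    next
      case True
      then have "k mod M \<noteq> k' mod M" using Suc.prems(3) by (metis div_mod_decomp)
      then have "c m (a m (k div M)) (k mod M) \<noteq> c m (a m (k div M)) (k' mod M)"
        using c_inj[of m "a m (k div M)"] modM by (auto simp: inj_on_def)
      then have "1 \<le> \<bar>real (c m (a m (k div M)) (k mod M)) - real (c m (a m (k div M)) (k' mod M))\<bar>"
        by linarith
      then have "L (Suc m) \<le> \<bar>real (c m (a m (k div M)) (k mod M)) - real (c m (a m (k div M)) (k' mod M))\<bar> * L (Suc m)"
        using L0[of "Suc m"] by simp
      also have "\<dots> = \<bar>a (Suc m) k - a (Suc m) k'\<bar>"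
        using L0[of "Suc m"] by (simp add: aS True left_diff_distrib[symmetric] abs_mult)
      finally show ?thesis .
    qed
  qed simp
  define idx where "idx = (\<lambda>m \<omega>. nat \<lfloor>real M ^ m * \<omega>\<rfloor>)"
  have idx: "idx m \<omega> = idx (Suc m) \<omega> div M" for m \<omega>
    unfolding idx_def using M by (intro floor_power_div) simp
  define X where "X = (\<lambda>m \<omega>. a m (idx m \<omega>))"
  have Xlo: "X m \<omega> \<le> X (Suc m) \<omega>" and Xhi: "X (Suc m) \<omega> + L (Suc m) \<le> X m \<omega> + L m" for m \<omega>
    using lo[of m "idx (Suc m) \<omega>"] hi[of m "idx (Suc m) \<omega>"] by (simp_all add: X_def idx[symmetric])
  have inc: "incseq (\<lambda>m. X m \<omega>)" for \<omega> by (rule incseq_SucI) (rule Xlo)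
  have dec: "decseq (\<lambda>m. X m \<omega> + L m)" for \<omega> by (rule decseq_SucI) (rule Xhi)
  have X0: "X 0 \<omega> = 0" for \<omega> by (simp add: X_def a0)
  have L00: "L 0 = \<sigma>" by (simp add: L_def)
  have bound: "X m \<omega> \<le> \<sigma>" for m \<omega>
    using decseqD[OF dec, of 0 m \<omega>] L0[of m] by (simp add: X0 L00)
  define x where "x = (\<lambda>\<omega>. lim (\<lambda>m. X m \<omega>))"
  have lim: "(\<lambda>m. X m \<omega>) \<longlonglongrightarrow> x \<omega>" for \<omega>
  proof -
    have "convergent (\<lambda>m. X m \<omega>)"
      using incseq_convergent[OF inc, of \<omega> \<sigma>] bound by (metis convergentI)
    then show ?thesis by (simp add: x_def convergent_LIMSEQ_iff)
  qed
  have xlo: "X m \<omega> \<le> x \<omega>" for m \<omega>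
    by (rule incseq_le[OF inc lim])
  have xhi: "x \<omega> \<le> X m \<omega> + L m" for m \<omega>
  proof (rule LIMSEQ_le_const2[OF lim], intro exI[of _ m] allI impI)
    fix n assume "m \<le> n"
    then show "X n \<omega> \<le> X m \<omega> + L m" using decseqD[OF dec, of m n \<omega>] L0[of n] by linarith
  qed
  have meas: "x \<in> borel_measurable borel"
  proof -
    have "X m \<in> borel_measurable borel" for m unfolding X_def idx_def by measurable
    then show ?thesis unfolding x_def by (intro borel_measurable_lim_metric)
  qed
  have avoid: "x \<omega> \<notin> bad m" for \<omega> m
  proof -
    let ?j = "c m (X m \<omega>) (idx (Suc m) \<omega> mod M)"
    have "X (Suc m) \<omega> = X m \<omega> + real ?j * L (Suc m)"
      by (simp add: X_def aS idx[symmetric])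
    then have "x \<omega> \<in> cell m (X m \<omega>) ?j"
      using xlo[of "Suc m" \<omega>] xhi[of \<omega> "Suc m"] by (simp add: cell_def algebra_simps)
    then show ?thesis using c(2)[OF modM, of m "X m \<omega>"] by blast
  qed
  have fro: "emeasure lborel {\<omega>\<in>{0..<1}. \<bar>x \<omega> - b\<bar> \<le> r} \<le> ennreal (4 / real M ^ m)" if r: "r \<le> L m" for b r m
  proof -
    define A where "A = {k. k < M ^ m \<and> b - r - L m \<le> a m k \<and> a m k \<le> b + r}"
    have finA: "finite A" unfolding A_def by simp
    \<comment> \<open>The endpoints are \<open>L m\<close>-separated and lie in a window of length
      \<open>2 * r + L m\<close>, at most \<open>3 * L m\<close>; this is the origin of the factor
      4.\<close>
    have cA: "card A \<le> Suc 3"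
    proof (rule card_separated_le[OF L0[of m] finA, where u = "b - r - L m"])
      show "L m \<le> \<bar>a m k - a m k'\<bar>" if "k \<in> A" "k' \<in> A" "k \<noteq> k'" for k k'
        using sep that by (simp add: A_def)
    qed (use r in \<open>auto simp: A_def\<close>)
    let ?I = "\<lambda>k::nat. {real k / real M ^ m ..< (real k + 1) / real M ^ m}"
    have Mp: "real M ^ m > 0" using M by simp
    have sub: "{\<omega>\<in>{0..<1}. \<bar>x \<omega> - b\<bar> \<le> r} \<subseteq> (\<Union>k\<in>A. ?I k)"
    proof safe
      fix \<omega> :: real assume \<omega>: "\<omega> \<in> {0..<1}" "\<bar>x \<omega> - b\<bar> \<le> r"
      have pos: "0 \<le> real M ^ m * \<omega>" using \<omega> by simp
      have ri: "real (idx m \<omega>) = of_int \<lfloor>real M ^ m * \<omega>\<rfloor>" unfolding idx_def using pos by simp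
      have "real M ^ m * \<omega> < real M ^ m * 1" using \<omega> Mp by (intro mult_strict_left_mono) auto
      then have "real (idx m \<omega>) < real (M ^ m)" unfolding ri by simp linarith
      then have "idx m \<omega> < M ^ m" by linarith
      then have "idx m \<omega> \<in> A"
        using xlo[of m \<omega>] xhi[of \<omega> m] \<omega>(2) by (auto simp: A_def X_def)
      moreover have "\<omega> \<in> ?I (idx m \<omega>)"
        unfolding ri using Mp by (simp add: divide_le_eq less_divide_eq mult.commute)
      ultimately show "\<omega> \<in> (\<Union>k\<in>A. ?I k)" by blast
    qed
    have "emeasure lborel {\<omega>\<in>{0..<1}. \<bar>x \<omega> - b\<bar> \<le> r} \<le> emeasure lborel (\<Union>k\<in>A. ?I k)"
      using finA by (intro emeasure_mono sub) auto
    also have "\<dots> \<le> (\<Sum>k\<in>A. emeasure lborel (?I k))"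
      using finA by (intro emeasure_subadditive_finite) auto
    also have "\<dots> = (\<Sum>k\<in>A. ennreal (1 / real M ^ m))"
      using Mp by (intro sum.cong refl) (simp add: divide_right_mono add_divide_distrib)
    also have "\<dots> = ennreal (real (card A) * (1 / real M ^ m))"
      by (simp add: ennreal_of_nat_eq_real_of_nat ennreal_mult'[symmetric])
    also have "\<dots> \<le> ennreal (4 * (1 / real M ^ m))"
      using cA by (intro ennreal_leI mult_right_mono) auto
    finally show ?thesis by simp
  qed
  have powM: "1 / real M ^ m \<le> (L m / \<sigma>) powr \<gamma>" for m
  proof -
    have "1 / real M ^ m = (1 / real M) ^ m" by (simp add: power_one_over)
    also have "\<dots> \<le> (\<theta> powr \<gamma>) ^ m" using \<gamma> by (intro power_mono) auto
    also have "\<dots> = (L m / \<sigma>) powr \<gamma>"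
      using \<theta> \<sigma> by (simp add: L_def powr_powr powr_realpow[symmetric] powr_ge_zero mult.commute)
    finally show ?thesis .
  qed
  have Llim: "L \<longlonglongrightarrow> 0"
  proof -
    have "2 \<le> Q" using bad[of 0 0] M by linarith
    then have "\<theta> * 2 \<le> \<theta> * real Q" using \<theta> by simp
    then have "\<theta> < 1" using \<theta> by linarith
    then show ?thesis unfolding L_def using \<theta> by (auto intro!: tendsto_mult_right_zero LIMSEQ_power_zero)
  qed
  have frostman: "emeasure lborel {\<omega>\<in>{0..<1}. \<bar>x \<omega> - b\<bar> \<le> r} \<le> ennreal (4 * (r / (\<theta> * \<sigma>)) powr \<gamma>)"
    if r: "r > 0" for b r
  proof (cases "r \<le> \<sigma>")
    case False
    have "\<theta> * \<sigma> \<le> \<sigma>"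
    proof -
      have "2 \<le> Q" using bad[of 0 0] M by linarith
      then have "\<theta> * 2 \<le> \<theta> * real Q" using \<theta> by simp
      then have "\<theta> \<le> 1" using \<theta> by linarith
      then show ?thesis using \<sigma> by simp
    qed
    then have "\<theta> * \<sigma> \<le> r" using False by linarith
    then have "r / (\<theta> * \<sigma>) \<ge> 1" using \<theta> \<sigma> by (simp add: le_divide_eq)
    then have "1 \<le> (r / (\<theta> * \<sigma>)) powr \<gamma>" using \<gamma> by (intro ge_one_powr_ge_zero) auto
    have "emeasure lborel {\<omega>\<in>{0..<1}. \<bar>x \<omega> - b\<bar> \<le> r} \<le> emeasure lborel {0..<1::real}"
      by (intro emeasure_mono) auto
    also have "\<dots> = ennreal 1" by simp
    also have "\<dots> \<le> ennreal (4 * (r / (\<theta> * \<sigma>)) powr \<gamma>)"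
      using \<open>1 \<le> (r / (\<theta> * \<sigma>)) powr \<gamma>\<close> by (intro ennreal_leI) simp
    finally show ?thesis .
  next
    case True
    have ex: "\<exists>n. L n < r"
      using order_tendstoD(2)[OF Llim r] by (auto simp: eventually_sequentially)
    \<comment> \<open>The level with \<open>L (Suc m) < r \<le> L m\<close>. Replacing
      \<open>L m\<close> by \<open>r\<close> loses one factor \<open>\<theta>\<close>, which
      explains the \<open>\<theta>\<close> in the final bound.\<close>
    define n where "n = (LEAST n. L n < r)"
    have n: "L n < r" unfolding n_def using ex by (rule LeastI_ex)
    have "n \<noteq> 0" using n True L00 by (metis not_less)
    then obtain m where m: "n = Suc m" by (cases n) auto
    have rm: "r \<le> L m" using not_less_Least[of m "\<lambda>n. L n < r"] m n_def by simp
    have "emeasure lborel {\<omega>\<in>{0..<1}. \<bar>x \<omega> - b\<bar> \<le> r} \<le> ennreal (4 * (1 / real M ^ m))"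
      using fro[OF rm] by simp
    also have "\<dots> \<le> ennreal (4 * (L m / \<sigma>) powr \<gamma>)"
      using powM[of m] by (intro ennreal_leI mult_left_mono) auto
    also have "L m / \<sigma> = L (Suc m) / (\<theta> * \<sigma>)" using \<theta> by (simp add: L_def)
    also have "ennreal (4 * (L (Suc m) / (\<theta> * \<sigma>)) powr \<gamma>) \<le> ennreal (4 * (r / (\<theta> * \<sigma>)) powr \<gamma>)"
      using n m \<theta> \<sigma> \<gamma> L0[of "Suc m"]
      by (intro ennreal_leI mult_left_mono powr_mono2 divide_right_mono) auto
    finally show ?thesis .
  qed
  \<comment> \<open>For \<open>r = 0\<close> the right-hand side is
    \<open>0 powr \<gamma> = 0\<close>: single points carry no mass.\<close>
  have zero: "emeasure lborel {\<omega>\<in>{0..<1}. \<bar>x \<omega> - b\<bar> \<le> 0} \<le> ennreal (4 * (0 / (\<theta> * \<sigma>)) powr \<gamma>)" for b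
  proof -
    have "(\<lambda>m. ennreal (4 / real M ^ m)) \<longlonglongrightarrow> ennreal 0"
      using M by (intro tendsto_ennrealI LIMSEQ_divide_realpow_zero) auto
    then have "emeasure lborel {\<omega>\<in>{0..<1}. \<bar>x \<omega> - b\<bar> \<le> 0} \<le> ennreal 0"
      using fro L0 less_imp_le by (intro LIMSEQ_le_const) blast+
    then show ?thesis by simp
  qed
  show ?thesis
  proof (intro exI[of _ x] conjI allI impI meas avoid)
    show "0 \<le> x \<omega>" "x \<omega> \<le> \<sigma>" for \<omega>
      using xlo[of 0 \<omega>] xhi[of \<omega> 0] by (simp_all add: X0 L00)
    show "emeasure lborel {\<omega>\<in>{0..<1}. \<bar>x \<omega> - b\<bar> \<le> r} \<le> ennreal (4 * (r / (\<theta> * \<sigma>)) powr \<gamma>)"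
      if "r \<ge> 0" for b r
      using that frostman[of r b] zero[of b] by (cases "r = 0") auto
  qed
qed

section \<open>Points with non-dense orbits on lines\<close>

lemma torus_map_funpow:
  "(torus_map A ^^ n) (abs_torus x) = abs_torus ((((*v) (map_matrix of_int A)) ^^ n) x)"
  by (induction n) (simp_all add: torus_map.abs_eq)

text \<open>With a strict inequality the infimum in the quotient metric unfolds to a lattice vector
  without asking whether it is attained.\<close>

lemma dist_torus_less_iff:
  "dist (abs_torus x) (abs_torus y) < e \<longleftrightarrow> (\<exists>z. (\<forall>i. z $ i \<in> \<int>) \<and> norm (x - y - z) < e)"
proof -
  have ne: "{z. torus_rel y z} \<noteq> {}"
    using equivp_reflp[OF equivp_torus_rel] by auto
  have "dist (abs_torus x) (abs_torus y) < e \<longleftrightarrow> (\<exists>z. torus_rel y z \<and> dist x z < e)"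
    using ne by (auto simp: dist_torus.abs_eq infdist_notempty cINF_less_iff)
  also have "\<dots> \<longleftrightarrow> (\<exists>z. (\<forall>i. z $ i \<in> \<int>) \<and> norm (x - y - z) < e)"
  proof safe
    fix z assume "torus_rel y z" "dist x z < e"
    then show "\<exists>z. (\<forall>i. z $ i \<in> \<int>) \<and> norm (x - y - z) < e"
      by (intro exI[of _ "z - y"]) (auto simp: torus_rel_def dist_norm, metis Ints_minus minus_diff_eq)
  next
    fix z assume "\<forall>i. z $ i \<in> \<int>" "norm (x - y - z) < e"
    then show "\<exists>z. torus_rel y z \<and> dist x z < e"
      by (intro exI[of _ "y + z"]) (auto simp: torus_rel_def dist_norm algebra_simps)
  qed
  finally show ?thesis .
qed

lemma funpow_matrix_linear:
  fixes A :: "real ^ 'n ^ 'n"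
  shows "(((*v) A) ^^ n) (x + y) = (((*v) A) ^^ n) x + (((*v) A) ^^ n) y"
    and "(((*v) A) ^^ n) (c *\<^sub>R x) = c *\<^sub>R (((*v) A) ^^ n) x"
  by (induction n) (simp_all add: matrix_vector_right_distrib matrix_vector_mult_scaleR)

lemma norm_integer_vector_ge_1:
  fixes z :: "real ^ 'n"
  assumes "\<And>i. z $ i \<in> \<int>" "z \<noteq> 0"
  shows "norm z \<ge> 1"
proof -
  obtain i where "z $ i \<noteq> 0" using assms(2) by (auto simp: vec_eq_iff)
  then have "\<bar>z $ i\<bar> \<ge> 1" using assms(1)[of i] by (auto elim!: Ints_cases)
  then show ?thesis using component_le_norm_cart[of z i] by linarith
qed

lemma card_le_2_if_close:
  fixes H :: "nat set"
  assumes "finite H" "\<And>j j'. j \<in> H \<Longrightarrow> j' \<in> H \<Longrightarrow> j' < j + 2"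
  shows "card H \<le> 2"
proof (cases "H = {}")
  case False
  have "H \<subseteq> {Min H, Min H + 1}"
    using assms(2)[OF Min_in[OF assms(1) False]] Min_le[OF assms(1)] by force
  then have "card H \<le> card {Min H, Min H + 1}" by (intro card_mono) auto
  then show ?thesis by simp
qed simp

text \<open>The budget of one Cantor level that treats \<open>r\<close> iterates: about
  \<open>\<rho> ^ r\<close> children, at most \<open>2 * r\<close> of them discarded, more than
  \<open>(\<rho> ^ r) powr \<gamma>\<close> kept. The extra 3 pays for rounding and guarantees two
  survivors. As \<open>\<gamma> < 1\<close>, large \<open>r\<close> works.\<close>

lemma cantor_exponent:
  fixes \<rho> \<gamma> :: real
  assumes "\<rho> > 1" "0 < \<gamma>" "\<gamma> < 1"
  shows "\<exists>r\<ge>1. \<rho> ^ r \<ge> (\<rho> ^ r) powr \<gamma> + 2 * real r + 3"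
proof -
  define a where "a = ln \<rho>"
  have a: "a > 0" using assms by (simp add: a_def)
  define b where "b = a * (1 - \<gamma>)"
  have b: "b > 0" using a assms by (simp add: b_def)
  have "((\<lambda>t::real. exp (- (b * t)) + (2 * t + 3) * exp (- (a * t))) \<longlongrightarrow> 0) at_top"
  proof (rule tendsto_add_zero)
    show "((\<lambda>t::real. exp (- (b * t))) \<longlongrightarrow> 0) at_top" using b by real_asymp
    show "((\<lambda>t::real. (2 * t + 3) * exp (- (a * t))) \<longlongrightarrow> 0) at_top" using a by real_asymp
  qed
  then have "eventually (\<lambda>t::real. exp (- (b * t)) + (2 * t + 3) * exp (- (a * t)) < 1) at_top"
    by (rule order_tendstoD) simp
  then have "eventually (\<lambda>t::real. exp (a * t) \<ge> exp (a * \<gamma> * t) + 2 * t + 3) at_top"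
  proof eventually_elim
    case (elim t)
    have "exp (a * t) * (exp (- (b * t)) + (2 * t + 3) * exp (- (a * t))) \<le> exp (a * t) * 1"
      using elim by (intro mult_left_mono) auto
    moreover have "exp (a * t) * exp (- (b * t)) = exp (a * \<gamma> * t)"
      unfolding exp_add[symmetric] by (simp add: b_def algebra_simps)
    moreover have "exp (a * t) * ((2 * t + 3) * exp (- (a * t))) = 2 * t + 3"
      by (simp add: exp_minus field_simps)
    ultimately show ?case by (simp add: distrib_left)
  qed
  then have "eventually (\<lambda>r::nat. exp (a * real r) \<ge> exp (a * \<gamma> * real r) + 2 * real r + 3) at_top"
    by (rule eventually_compose_filterlim[OF _ filterlim_real_sequentially])
  then have "eventually (\<lambda>r::nat. r \<ge> 1 \<and> exp (a * real r) \<ge> exp (a * \<gamma> * real r) + 2 * real r + 3) at_top"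
    using eventually_ge_at_top[of 1] by eventually_elim auto
  then obtain r :: nat where r: "r \<ge> 1" "exp (a * real r) \<ge> exp (a * \<gamma> * real r) + 2 * real r + 3"
    by (auto dest!: eventually_happens)
  have "\<rho> ^ r = exp (a * real r)"
    using assms by (simp add: a_def powr_realpow[symmetric] powr_def mult.commute)
  moreover have "(\<rho> ^ r) powr \<gamma> = exp (a * \<gamma> * real r)"
    using assms by (simp add: a_def powr_def ln_realpow mult_ac)
  ultimately show ?thesis using r by auto
qed

text \<open>During the block of times treated at level \<open>m\<close>, a segment of that level is
  stretched to length at most 1/4, so it can approach only one lattice point at each time. By the
  lower growth bound, the parameters that do so fill less than one child and thus meet at most two.
  No constant depends on \<open>y\<close>, since only the direction \<open>w\<close> is
  stretched.\<close>

lemma nondense_cantor_set: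
  fixes T :: "int ^ 'n ^ 'n"
  assumes irr: "irreducible_matrix T" and w: "w \<notin> weak_stable_subspace T"
    and \<gamma>: "0 < \<gamma>" "\<gamma> < 1" and \<sigma>0: "0 < \<sigma>0"
  obtains \<sigma> \<epsilon> K where "0 < \<sigma>" "\<sigma> \<le> \<sigma>0" "0 < \<epsilon>" "0 < K"
    "\<And>y. \<exists>x :: real \<Rightarrow> real. x \<in> borel_measurable borel \<and> (\<forall>\<omega>. 0 \<le> x \<omega> \<and> x \<omega> \<le> \<sigma>)
       \<and> (\<forall>\<omega> n. \<epsilon> \<le> dist ((torus_map T ^^ n) (abs_torus (y + x \<omega> *\<^sub>R w))) (abs_torus 0))
       \<and> (\<forall>a r. r \<ge> 0 \<longrightarrow> emeasure lborel {\<omega>\<in>{0..<1}. \<bar>x \<omega> - a\<bar> \<le> r} \<le> ennreal (K * r powr \<gamma>))"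
proof -
  let ?F = "\<lambda>n x. (((*v) (map_matrix real_of_int T)) ^^ n) x"
  obtain \<rho> c C where \<rho>: "\<rho> > 1" and c: "c > 0" "\<And>n. c * \<rho> ^ n \<le> norm (?F n w)"
    and C: "C > 0" "\<And>n. norm (?F n w) \<le> C * \<rho> ^ n"
    using exponential_growth[OF irr w] by blast
  obtain r where r: "r \<ge> 1" "\<rho> ^ r \<ge> (\<rho> ^ r) powr \<gamma> + 2 * real r + 3"
    using cantor_exponent[OF \<rho> \<gamma>] by blast
  define \<theta> where "\<theta> = 1 / \<rho> ^ r"
  define Q where "Q = nat \<lfloor>\<rho> ^ r\<rfloor>"
  define M where "M = Q - 2 * r"
  \<comment> \<open>This makes \<open>\<sigma> * C * \<rho> ^ r\<close> at most 1/4, the stretched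
    length at the end of a block.\<close>
  define \<sigma> where "\<sigma> = min \<sigma>0 (1 / (4 * C * \<rho> ^ r))"
  \<comment> \<open>The bound 1/4 keeps two approached lattice points less than 1 apart; the other
    one makes the preimage of a ball shorter than a child.\<close>
  define \<epsilon> where "\<epsilon> = min (1/4) (c * \<sigma> * \<theta> / 2)"
  have \<rho>r: "\<rho> ^ r > 0" using \<rho> by simp
  have \<theta>0: "0 < \<theta>" unfolding \<theta>_def using \<rho>r by (rule divide_pos_pos[OF zero_less_one])
  have Qr: "real Q \<le> \<rho> ^ r" "\<rho> ^ r < real Q + 1" unfolding Q_def using \<rho>r by linarith+
  have \<theta>Q: "\<theta> * real Q \<le> 1" using Qr \<rho>r by (simp add: \<theta>_def divide_le_eq)
  have pp: "(\<rho> ^ r) powr \<gamma> > 0" using \<rho> by simp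
  have Q2: "real Q > (\<rho> ^ r) powr \<gamma> + 2 * real r + 2" using Qr r(2) by linarith
  then have "2 * r \<le> Q" using pp by linarith
  then have MQ: "M + 2 * r = Q" by (simp add: M_def)
  then have Mr: "real M > (\<rho> ^ r) powr \<gamma> + 2" using Q2 by linarith
  have M2: "M \<ge> 2" using Mr pp by linarith
  have M\<gamma>: "1 / real M \<le> \<theta> powr \<gamma>"
  proof -
    have "\<theta> powr \<gamma> = 1 / (\<rho> ^ r) powr \<gamma>" using \<rho>r by (simp add: \<theta>_def powr_divide)
    then show ?thesis using Mr pp by (simp add: frac_le)
  qed
  have C4: "4 * C * \<rho> ^ r > 0" using C \<rho>r by (intro mult_pos_pos) auto
  have "\<sigma> \<le> 1 / (4 * C * \<rho> ^ r)" by (simp add: \<sigma>_def)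
  then have "\<sigma> * (4 * C * \<rho> ^ r) \<le> 1" using C4 by (simp only: pos_le_divide_eq)
  moreover have "\<sigma> > 0" unfolding \<sigma>_def using \<sigma>0 C4 by (simp only: min_less_iff_conj) (simp only: zero_less_divide_1_iff)
  ultimately have \<sigma>: "0 < \<sigma>" "\<sigma> \<le> \<sigma>0" "\<sigma> * C * \<rho> ^ r \<le> 1/4"
    by (auto simp: \<sigma>_def)
  have \<epsilon>: "0 < \<epsilon>" "\<epsilon> \<le> 1/4" "2 * \<epsilon> \<le> c * \<sigma> * \<theta>"
    using c \<sigma> \<theta>0 by (auto simp: \<epsilon>_def)
  have main: "\<exists>x :: real \<Rightarrow> real. x \<in> borel_measurable borel \<and> (\<forall>\<omega>. 0 \<le> x \<omega> \<and> x \<omega> \<le> \<sigma>)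
       \<and> (\<forall>\<omega> n. \<epsilon> \<le> dist ((torus_map T ^^ n) (abs_torus (y + x \<omega> *\<^sub>R w))) (abs_torus 0))
       \<and> (\<forall>a r. r \<ge> 0 \<longrightarrow> emeasure lborel {\<omega>\<in>{0..<1}. \<bar>x \<omega> - a\<bar> \<le> r}
            \<le> ennreal (4 * (1 / (\<theta> * \<sigma>)) powr \<gamma> * r powr \<gamma>))" for y
  proof -
    \<comment> \<open>Closeness to \<open>abs_torus 0\<close> is lifted to closeness to a lattice
      point \<open>z\<close>. Level \<open>m\<close> takes care of the times from
      \<open>r * m\<close> to \<open>r * m + r - 1\<close>.\<close>
    define B where "B = (\<lambda>n. {s. \<exists>z. (\<forall>i. z $ i \<in> \<int>) \<and> norm (?F n (y + s *\<^sub>R w) - z) < \<epsilon>})"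
    define bad where "bad = (\<lambda>m. \<Union>n\<in>{r * m..<r * m + r}. B n)"
    define cell where "cell = (\<lambda>m x j. {x + real j * (\<sigma> * \<theta> ^ Suc m) .. x + real (Suc j) * (\<sigma> * \<theta> ^ Suc m)})"
    have hit: "card {j. j < Q \<and> B n \<inter> cell m x j \<noteq> {}} \<le> 2" if n: "n \<in> {r * m..<r * m + r}" for n m x
    proof (rule card_le_2_if_close)
      fix j j' assume "j \<in> {j. j < Q \<and> B n \<inter> cell m x j \<noteq> {}}" "j' \<in> {j. j < Q \<and> B n \<inter> cell m x j \<noteq> {}}"
      then obtain s s' where j: "j < Q" "j' < Q" and s: "s \<in> B n" "s \<in> cell m x j" and s': "s' \<in> B n" "s' \<in> cell m x j'"
        by auto
      let ?L = "\<sigma> * \<theta> ^ Suc m"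
      have L: "?L > 0" using \<sigma> \<theta>0 by simp
      have "x + real (Suc j) * ?L \<le> x + real Q * ?L" "x + real (Suc j') * ?L \<le> x + real Q * ?L"
        using j L by (auto intro!: mult_right_mono simp del: of_nat_Suc)
      moreover have "real Q * ?L \<le> \<sigma> * \<theta> ^ m"
        using mult_right_mono[OF \<theta>Q, of "\<sigma> * \<theta> ^ m"] \<sigma> \<theta>0 by (simp add: mult_ac)
      moreover have "x \<le> s" "x \<le> s'" using s(2) s'(2) L by (auto simp: cell_def intro: order_trans[rotated])
      ultimately have d: "\<bar>s - s'\<bar> \<le> \<sigma> * \<theta> ^ m"
        using s(2) s'(2) by (auto simp: cell_def abs_le_iff simp del: of_nat_Suc)
      obtain z z' where z: "\<And>i. z $ i \<in> \<int>" "norm (?F n (y + s *\<^sub>R w) - z) < \<epsilon>"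
        and z': "\<And>i. z' $ i \<in> \<int>" "norm (?F n (y + s' *\<^sub>R w) - z') < \<epsilon>"
        using s(1) s'(1) by (auto simp: B_def)
      let ?e = "?F n (y + s *\<^sub>R w) - z" and ?e' = "?F n (y + s' *\<^sub>R w) - z'"
      \<comment> \<open>The displacement between two hits is a lattice vector up to an error below
        \<open>2 * \<epsilon>\<close>. Being short, it forces \<open>z = z'\<close>, and then the
        error alone bounds the displacement.\<close>
      have eq: "(s - s') *\<^sub>R ?F n w = ?e - ?e' + (z - z')"
        by (simp add: funpow_matrix_linear algebra_simps)
      have ee: "norm (?e - ?e') < 2 * \<epsilon>" using z(2) z'(2) norm_triangle_ineq4[of ?e ?e'] by linarith
      have pn: "\<rho> ^ n \<le> \<rho> ^ (r * m) * \<rho> ^ r"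
        using n \<rho> by (simp add: power_add[symmetric] power_increasing)
      have \<theta>m: "\<theta> ^ m * \<rho> ^ (r * m) = 1"
        using \<rho> by (simp add: \<theta>_def power_mult power_one_over)
      have "norm ((s - s') *\<^sub>R ?F n w) \<le> (\<sigma> * \<theta> ^ m) * (C * \<rho> ^ n)"
        using d C(2)[of n] \<sigma> \<theta>0 by (simp add: mult_mono)
      also have "\<dots> \<le> (\<sigma> * \<theta> ^ m) * (C * (\<rho> ^ (r * m) * \<rho> ^ r))"
        using pn \<sigma> \<theta>0 C by (intro mult_left_mono) auto
      also have "\<dots> = (\<sigma> * C * \<rho> ^ r) * (\<theta> ^ m * \<rho> ^ (r * m))" by (simp only: mult_ac)
      also have "\<dots> \<le> 1/4" unfolding \<theta>m using \<sigma> by simp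
      finally have 1: "norm ((s - s') *\<^sub>R ?F n w) \<le> 1/4" .
      have "norm (z - z') \<le> norm ((s - s') *\<^sub>R ?F n w) + norm (?e - ?e')"
        using norm_triangle_ineq4[of "(s - s') *\<^sub>R ?F n w" "?e - ?e'"] eq by (simp add: algebra_simps)
      then have "norm (z - z') < 1" using 1 ee \<epsilon>(2) by linarith
      then have "z - z' = 0"
        using norm_integer_vector_ge_1[of "z - z'"] z(1) z'(1) by (force intro: Ints_diff)
      then have "\<bar>s - s'\<bar> * norm (?F n w) < 2 * \<epsilon>" using ee eq by (metis add_0_right norm_scaleR)
      moreover have "\<bar>s - s'\<bar> * (c * \<rho> ^ (r * m)) \<le> \<bar>s - s'\<bar> * norm (?F n w)"
      proof (rule mult_left_mono)
        have "c * \<rho> ^ (r * m) \<le> c * \<rho> ^ n" using n \<rho> c by (simp add: power_increasing)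
        then show "c * \<rho> ^ (r * m) \<le> norm (?F n w)" using c(2)[of n] by linarith
      qed simp
      ultimately have "\<bar>s - s'\<bar> * (c * \<rho> ^ (r * m)) < c * \<sigma> * \<theta>" using \<epsilon>(3) by linarith
      also have "c * \<sigma> * \<theta> = (c * \<sigma> * \<theta>) * (\<theta> ^ m * \<rho> ^ (r * m))" unfolding \<theta>m by simp
      also have "\<dots> = ?L * (c * \<rho> ^ (r * m))" by simp
      finally have "\<bar>s - s'\<bar> < ?L" using c \<rho> by (simp add: mult_less_cancel_right)
      moreover have "s \<le> x + (real j + 1) * ?L" "x + real j' * ?L \<le> s'"
        using s(2) s'(2) unfolding cell_def atLeastAtMost_iff of_nat_Suc by (simp_all only: add.commute)
      \<comment> \<open>Hits less than one child length apart lie in equal or adjacent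
        children.\<close>
      ultimately have "real j' * ?L < (real j + 1) * ?L + ?L" by linarith
      also have "\<dots> = (real j + 2) * ?L" by (simp only: distrib_right mult_1 add.assoc one_add_one[symmetric])
      finally have "real j' < real j + 2" using L mult_less_cancel_right_pos by blast
      then show "j' < j + 2" by linarith
    qed simp
    have bad: "card {j. j < Q \<and> bad m \<inter> {x + real j * (\<sigma> * \<theta> ^ Suc m) .. x + real (Suc j) * (\<sigma> * \<theta> ^ Suc m)} \<noteq> {}} + M \<le> Q" for m x
    proof -
      have "{j. j < Q \<and> bad m \<inter> cell m x j \<noteq> {}} = (\<Union>n\<in>{r * m..<r * m + r}. {j. j < Q \<and> B n \<inter> cell m x j \<noteq> {}})"
        by (auto simp: bad_def)
      also have "card \<dots> \<le> (\<Sum>n\<in>{r * m..<r * m + r}. card {j. j < Q \<and> B n \<inter> cell m x j \<noteq> {}})"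
        by (rule card_UN_le) simp
      also have "\<dots> \<le> (\<Sum>n\<in>{r * m..<r * m + r}. 2)" by (intro sum_mono hit)
      also have "\<dots> = 2 * r" by simp
      finally show ?thesis using MQ by (simp add: cell_def)
    qed
    obtain x :: "real \<Rightarrow> real" where X: "x \<in> borel_measurable borel \<and> (\<forall>\<omega>. 0 \<le> x \<omega> \<and> x \<omega> \<le> \<sigma>)
      \<and> (\<forall>\<omega> m. x \<omega> \<notin> bad m)
      \<and> (\<forall>a r. r \<ge> 0 \<longrightarrow> emeasure lborel {\<omega>\<in>{0..<1}. \<bar>x \<omega> - a\<bar> \<le> r} \<le> ennreal (4 * (r / (\<theta> * \<sigma>)) powr \<gamma>))"
      using moran_construction[OF \<sigma>(1) \<theta>0 \<theta>Q M2 \<gamma>(1) M\<gamma> bad] by (elim exE) (rule that)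
    then have x: "x \<in> borel_measurable borel" "\<And>\<omega>. 0 \<le> x \<omega> \<and> x \<omega> \<le> \<sigma>" "\<And>\<omega> m. x \<omega> \<notin> bad m"
      "\<And>a r. r \<ge> 0 \<Longrightarrow> emeasure lborel {\<omega>\<in>{0..<1}. \<bar>x \<omega> - a\<bar> \<le> r} \<le> ennreal (4 * (r / (\<theta> * \<sigma>)) powr \<gamma>)"
      by simp_all
    have av: "\<epsilon> \<le> dist ((torus_map T ^^ n) (abs_torus (y + x \<omega> *\<^sub>R w))) (abs_torus 0)" for \<omega> n
    proof (rule ccontr)
      assume "\<not> ?thesis"
      then have "x \<omega> \<in> B n"
        unfolding torus_map_funpow not_le dist_torus_less_iff by (simp add: B_def)
      moreover have "n \<in> {r * (n div r)..<r * (n div r) + r}"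
        using r(1) dividend_less_times_div[of r n] by simp
      ultimately have "x \<omega> \<in> bad (n div r)" unfolding bad_def by blast
      then show False using x(3) by blast
    qed
    have fr: "4 * (r / (\<theta> * \<sigma>)) powr \<gamma> = 4 * (1 / (\<theta> * \<sigma>)) powr \<gamma> * r powr \<gamma>" if "r \<ge> 0" for r
      using that \<theta>0 \<sigma> by (simp add: powr_divide powr_mult)
    show ?thesis
    proof (intro exI[of _ x] conjI allI impI x(1) av)
      show "0 \<le> x \<omega>" "x \<omega> \<le> \<sigma>" for \<omega>
        using x(2) by blast+
      show "emeasure lborel {\<omega>\<in>{0..<1}. \<bar>x \<omega> - a\<bar> \<le> r}
            \<le> ennreal (4 * (1 / (\<theta> * \<sigma>)) powr \<gamma> * r powr \<gamma>)" if "r \<ge> 0" for a r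
        using x(4)[OF that, of a] unfolding fr[OF that] .
    qed
  qed
  show ?thesis
    by (rule that[OF \<sigma>(1,2) \<epsilon>(1) _ main]) (use \<theta>0 \<sigma> in simp)
qed

section \<open>Almost sure convergence of averages\<close>

text \<open>Between consecutive squares \<open>M\<^sup>2\<close> and \<open>(Suc M)\<^sup>2\<close>
  at most \<open>2 * M\<close> bounded terms are added, which is negligible relative to
  \<open>M\<^sup>2\<close>.\<close>

lemma averages_tendsto_zero_squares:
  fixes z :: "nat \<Rightarrow> complex"
  assumes b: "\<And>n. cmod (z n) \<le> 1"
    and sq: "(\<lambda>M. (\<Sum>n<(Suc M)\<^sup>2. z n) / of_nat ((Suc M)\<^sup>2)) \<longlonglongrightarrow> 0"
  shows "(\<lambda>N. (\<Sum>n<N. z n) / of_nat N) \<longlonglongrightarrow> 0"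
proof -
  define A where "A = (\<lambda>M. cmod ((\<Sum>n<(Suc M)\<^sup>2. z n) / of_nat ((Suc M)\<^sup>2)))"
  have A: "A \<longlonglongrightarrow> 0" unfolding A_def using tendsto_norm_zero[OF sq] .
  \<comment> \<open>In \<open>A\<close> the index \<open>M\<close> belongs to the square of
    \<open>Suc M\<close>, which avoids the empty average. The largest square up to \<open>N\<close>
    therefore has index \<open>floor_sqrt N - 1\<close>.\<close>
  have tend: "filterlim (\<lambda>N. floor_sqrt N - 1) sequentially sequentially"
    unfolding filterlim_at_top eventually_sequentially
    by (metis diff_le_mono floor_sqrt_inverse_power2 le_diff_conv le_floor_sqrt_iff add_diff_cancel_right' order_refl)
  have lim: "(\<lambda>N. A (floor_sqrt N - 1) + 2 / real (floor_sqrt N - 1)) \<longlonglongrightarrow> 0"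
  proof (rule tendsto_add_zero)
    show "(\<lambda>N. A (floor_sqrt N - 1)) \<longlonglongrightarrow> 0" by (rule filterlim_compose[OF A tend])
    have "(\<lambda>n. 2 / real n) \<longlonglongrightarrow> 0" by (rule lim_const_over_n)
    then show "(\<lambda>N. 2 / real (floor_sqrt N - 1)) \<longlonglongrightarrow> 0" by (rule filterlim_compose[OF _ tend])
  qed
  show ?thesis
  proof (rule Lim_null_comparison[OF _ lim])
    show "\<forall>\<^sub>F N in sequentially. norm ((\<Sum>n<N. z n) / of_nat N) \<le> A (floor_sqrt N - 1) + 2 / real (floor_sqrt N - 1)"
      using eventually_ge_at_top[of 4]
    proof eventually_elim
      case (elim N)
      define M where "M = floor_sqrt N"
      have M2: "M \<ge> 2" unfolding M_def using elim by (simp add: le_floor_sqrt_iff)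
      have le: "M\<^sup>2 \<le> N" unfolding M_def by simp
      have lt: "N < (Suc M)\<^sup>2" unfolding M_def by (rule Suc_floor_sqrt_power2_gt)
      have N0: "real N > 0" using elim by simp
      have M0: "real M > 0" using M2 by simp
      have split: "(\<Sum>n<N. z n) = (\<Sum>n<M\<^sup>2. z n) + (\<Sum>n\<in>{M\<^sup>2..<N}. z n)"
        using le by (metis lessThan_atLeast0 sum.atLeastLessThan_concat zero_le)
      have "cmod (\<Sum>n\<in>{M\<^sup>2..<N}. z n) \<le> (\<Sum>n\<in>{M\<^sup>2..<N}. 1)"
        by (intro sum_norm_le b)
      also have "\<dots> = real (N - M\<^sup>2)" by simp
      also have "\<dots> \<le> real (2 * M)" using lt by (simp add: power2_eq_square)
      finally have 1: "cmod (\<Sum>n\<in>{M\<^sup>2..<N}. z n) \<le> 2 * real M" by simp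
      have "cmod (\<Sum>n<N. z n) \<le> cmod (\<Sum>n<M\<^sup>2. z n) + 2 * real M"
        unfolding split using norm_triangle_ineq 1 by (smt (verit))
      then have "cmod (\<Sum>n<N. z n) / real N \<le> cmod (\<Sum>n<M\<^sup>2. z n) / real N + 2 * real M / real N"
        using N0 by (simp add: divide_right_mono add_divide_distrib[symmetric])
      also have "cmod (\<Sum>n<M\<^sup>2. z n) / real N \<le> cmod (\<Sum>n<M\<^sup>2. z n) / real (M\<^sup>2)"
        using le M0 N0 by (intro divide_left_mono mult_pos_pos) (auto simp del: of_nat_power)
      also have "2 * real M / real N \<le> 2 * real M / real (M\<^sup>2)"
        using le M0 N0 by (intro divide_left_mono mult_pos_pos) (auto simp del: of_nat_power)
      also have "2 * real M / real (M\<^sup>2) = 2 / real M"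
        using M0 by (simp add: power2_eq_square)
      also have "2 / real M \<le> 2 / real (M - 1)"
        using M2 by (intro divide_left_mono) auto
      finally have "cmod (\<Sum>n<N. z n) / real N \<le> cmod (\<Sum>n<M\<^sup>2. z n) / real (M\<^sup>2) + 2 / real (M - 1)" by simp
      moreover have "A (M - 1) = cmod (\<Sum>n<M\<^sup>2. z n) / real (M\<^sup>2)"
        unfolding A_def using M2 by (simp add: norm_divide del: of_nat_power)
      ultimately show ?case unfolding M_def by (simp add: norm_divide)
    qed
  qed
qed

text \<open>Along squares \<open>N = m\<^sup>2\<close> the mean squares of the averages are of order
  \<open>1 / m\<^sup>2\<close>, hence summable, and the averages tend to zero almost everywhere.
  Interpolation supplies the other \<open>N\<close>.\<close>

lemma averages_AE_tendsto_zero: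
  fixes f :: "nat \<Rightarrow> 'a \<Rightarrow> complex"
  assumes meas: "\<And>n. f n \<in> borel_measurable M" and b: "\<And>n t. cmod (f n t) \<le> 1"
    and L2: "\<And>N. (\<integral>\<^sup>+t. ennreal ((cmod (\<Sum>n<N. f n t))\<^sup>2) \<partial>M) \<le> ennreal (C * real N)"
  shows "AE t in M. (\<lambda>N. (\<Sum>n<N. f n t) / of_nat N) \<longlonglongrightarrow> 0"
proof -
  define g where "g = (\<lambda>m t. (cmod ((\<Sum>n<(Suc m)\<^sup>2. f n t) / of_nat ((Suc m)\<^sup>2)))\<^sup>2)"
  have gm: "g m \<in> borel_measurable M" for m
    unfolding g_def using meas by measurable
  have g0: "g m t \<ge> 0" for m t by (simp add: g_def)
  have int: "(\<integral>\<^sup>+t. ennreal (g m t) \<partial>M) \<le> ennreal (\<bar>C\<bar> * (1 / (real (Suc m))\<^sup>2))" for m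
  proof -
    let ?N = "(Suc m)\<^sup>2"
    have eq: "g m t = (1 / (real ?N)\<^sup>2) * (cmod (\<Sum>n<?N. f n t))\<^sup>2" for t
      by (simp add: g_def norm_divide power_divide del: of_nat_power of_nat_Suc)
    have "(\<integral>\<^sup>+t. ennreal (g m t) \<partial>M) = (\<integral>\<^sup>+t. ennreal (1 / (real ?N)\<^sup>2) * ennreal ((cmod (\<Sum>n<?N. f n t))\<^sup>2) \<partial>M)"
      unfolding eq by (intro nn_integral_cong ennreal_mult) auto
    also have "\<dots> = ennreal (1 / (real ?N)\<^sup>2) * (\<integral>\<^sup>+t. ennreal ((cmod (\<Sum>n<?N. f n t))\<^sup>2) \<partial>M)"
      by (intro nn_integral_cmult) (use meas in measurable)
    also have "\<dots> \<le> ennreal (1 / (real ?N)\<^sup>2) * ennreal (C * real ?N)"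
      by (intro mult_left_mono L2) auto
    also have "\<dots> \<le> ennreal (1 / (real ?N)\<^sup>2) * ennreal (\<bar>C\<bar> * real ?N)"
      by (intro mult_left_mono ennreal_leI mult_right_mono) auto
    also have "\<dots> = ennreal (1 / (real ?N)\<^sup>2 * (\<bar>C\<bar> * real ?N))"
      by (rule ennreal_mult'[symmetric]) simp
    also have "1 / (real ?N)\<^sup>2 * (\<bar>C\<bar> * real ?N) = \<bar>C\<bar> * (1 / real ?N)"
      by (simp add: power2_eq_square del: of_nat_power of_nat_Suc of_nat_mult)
    finally show ?thesis by simp
  qed
  have summ: "summable (\<lambda>m. \<bar>C\<bar> * (1 / (real (Suc m))\<^sup>2))"
    using inverse_power_summable[of 2, where ?'a = real]
    by (intro summable_mult iffD2[OF summable_Suc_iff[of "\<lambda>n. 1 / (real n)\<^sup>2"]])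
      (simp add: inverse_eq_divide)
  have "(\<integral>\<^sup>+t. (\<Sum>m. ennreal (g m t)) \<partial>M) = (\<Sum>m. \<integral>\<^sup>+t. ennreal (g m t) \<partial>M)"
    using gm by (intro nn_integral_suminf) measurable
  also have "\<dots> \<le> (\<Sum>m. ennreal (\<bar>C\<bar> * (1 / (real (Suc m))\<^sup>2)))"
    by (intro suminf_le int) auto
  also have "\<dots> = ennreal (\<Sum>m. \<bar>C\<bar> * (1 / (real (Suc m))\<^sup>2))"
    by (intro suminf_ennreal2 summ) auto
  also have "\<dots> < \<infinity>" by simp
  finally have "(\<integral>\<^sup>+t. (\<Sum>m. ennreal (g m t)) \<partial>M) \<noteq> \<infinity>" by simp
  then have "AE t in M. (\<Sum>m. ennreal (g m t)) \<noteq> \<infinity>"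
    using gm by (intro nn_integral_PInf_AE) measurable
  then show ?thesis
  proof eventually_elim
    case (elim t)
    have "summable (\<lambda>m. g m t)"
    proof (rule summable_suminf_not_top[OF g0])
      show "(\<Sum>m. ennreal (g m t)) \<noteq> top" using elim by (simp only: infinity_ennreal_def) blast
    qed
    then have "(\<lambda>m. g m t) \<longlonglongrightarrow> 0" by (rule summable_LIMSEQ_zero)
    then have "(\<lambda>m. sqrt (g m t)) \<longlonglongrightarrow> sqrt 0" by (rule tendsto_real_sqrt)
    moreover have "sqrt (g m t) = norm ((\<Sum>n<(Suc m)\<^sup>2. f n t) / of_nat ((Suc m)\<^sup>2))" for m
      unfolding g_def by (rule real_sqrt_abs[THEN trans]) (rule abs_norm_cancel)
    ultimately have "(\<lambda>m. norm ((\<Sum>n<(Suc m)\<^sup>2. f n t) / of_nat ((Suc m)\<^sup>2))) \<longlonglongrightarrow> 0"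
      by (simp only: real_sqrt_zero)
    then have "(\<lambda>m. (\<Sum>n<(Suc m)\<^sup>2. f n t) / of_nat ((Suc m)\<^sup>2)) \<longlonglongrightarrow> 0"
      by (rule tendsto_norm_zero_cancel)
    then show ?case by (rule averages_tendsto_zero_squares[OF b])
  qed
qed

lemma oscillatory_integral_bound:
  fixes R \<beta> :: real
  assumes R: "R > 0"
  defines "I \<equiv> (LINT t:{-R..R}|lborel. cis (\<beta> * t))"
  shows "cmod I \<le> 2 * R" and "\<beta> \<noteq> 0 \<Longrightarrow> cmod I \<le> 2 / \<bar>\<beta>\<bar>"
proof -
  have int: "set_integrable lborel {-R..R} (\<lambda>t. cis (\<beta> * t))"
    by (intro borel_integrable_atLeastAtMost') (intro continuous_intros)
  have "cmod I \<le> (LINT t:{-R..R}|lborel. norm (cis (\<beta> * t)))"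
    unfolding I_def using int by (rule set_integral_norm_bound)
  also have "\<dots> = 2 * R" using R by (simp add: set_integral_const)
  finally show "cmod I \<le> 2 * R" .
  assume \<beta>: "\<beta> \<noteq> 0"
  let ?F = "\<lambda>t. cis (\<beta> * t) / (\<i> * of_real \<beta>)"
  have deriv: "(?F has_vector_derivative cis (\<beta> * t)) (at t within {-R..R})" for t
  proof -
    have "((\<lambda>t. exp (\<i> * of_real \<beta> * of_real t) / (\<i> * of_real \<beta>)) has_vector_derivative exp (\<i> * of_real \<beta> * of_real t)) (at t within {-R..R})"
      using \<beta> by (auto intro!: derivative_eq_intros has_vector_derivative_real_field simp: field_simps)
    then show ?thesis by (simp add: cis_conv_exp mult_ac)
  qed
  have "I = ?F R - ?F (-R)"
    unfolding I_def set_lebesgue_integral_def by (rule integral_FTC_atLeastAtMost) (use R deriv in \<open>auto intro!: continuous_intros\<close>)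
  also have "cmod \<dots> \<le> cmod (?F R) + cmod (?F (-R))" by (rule norm_triangle_ineq4)
  also have "\<dots> = 2 / \<bar>\<beta>\<bar>" by (simp add: norm_divide norm_mult)
  finally show "cmod I \<le> 2 / \<bar>\<beta>\<bar>" .
qed

text \<open>A row-sum estimate for the correlations. Away from the diagonal they are oscillatory
  integrals of size \<open>2 / \<bar>b n - b m\<bar>\<close>, and the pairs closer than
  \<open>h\<close> are bounded trivially; the mean square of the sum is therefore of order
  \<open>N\<close>. The coefficients \<open>u\<close> may vanish, so that unwanted times can be
  masked.\<close>

lemma lacunary_averages:
  fixes b :: "nat \<Rightarrow> real" and u :: "nat \<Rightarrow> complex"
  assumes u: "\<And>n. cmod (u n) \<le> 1" and \<rho>: "\<rho> > 1" and \<delta>: "\<delta> > 0" and R: "R > 0"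
    and gap: "\<And>m n. m + h \<le> n \<Longrightarrow> u m \<noteq> 0 \<Longrightarrow> u n \<noteq> 0 \<Longrightarrow> \<delta> * \<rho> ^ n \<le> \<bar>b n - b m\<bar>"
  shows "AE t in lborel. t \<in> {-R..R} \<longrightarrow> (\<lambda>N. (\<Sum>n<N. u n * cis (b n * t)) / of_nat N) \<longlonglongrightarrow> 0"
proof -
  let ?M = "restrict_space lborel {-R..R}"
  let ?f = "\<lambda>n t. u n * cis (b n * t)"
  define A where "A = (\<lambda>n m::nat. (if n < m + h \<and> m < n + h then 2 * R else 0) + 2 / \<delta> * (1 / \<rho>) ^ max n m)"
  have sum1: "summable (\<lambda>n. (1 / \<rho>) ^ n)" using \<rho> by (intro summable_geometric) simp
  have lim: "(\<lambda>n. real n * (1 / \<rho>) ^ n) \<longlonglongrightarrow> 0"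
    using \<rho> powser_times_n_limit_0[of "1 / \<rho>"] by simp
  then obtain K where K: "\<And>n. \<bar>real n * (1 / \<rho>) ^ n\<bar> \<le> K"
    using convergent_imp_Bseq[OF convergentI] by (fastforce simp: Bseq_def)
  define S where "S = (\<Sum>n. (1 / \<rho>) ^ n)"
  \<comment> \<open>At most \<open>2 * h\<close> near-diagonal entries \<open>2 * R\<close>, plus
    the two parts of the decaying sum.\<close>
  define C where "C = 4 * R * real h + 2 / \<delta> * (K + S)"
  have A0: "A n m \<ge> 0" for n m using R \<delta> \<rho> by (simp add: A_def)
  have row: "(\<Sum>m<N. A n m) \<le> C" if "n < N" for n N
  proof -
    have "(\<Sum>m<N. if n < m + h \<and> m < n + h then 2 * R else 0) \<le> (\<Sum>m\<in>{n - h..<n + h}. 2 * R)"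
    proof -
      have "(\<Sum>m<N. if n < m + h \<and> m < n + h then 2 * R else 0) = (\<Sum>m\<in>{m. m < N \<and> n < m + h \<and> m < n + h}. 2 * R)"
        by (subst sum.If_cases) (auto intro!: arg_cong[where f = card])
      also have "\<dots> \<le> (\<Sum>m\<in>{n - h..<n + h}. 2 * R)"
        by (rule sum_mono2) (use R in auto)
      finally show ?thesis .
    qed
    also have "\<dots> = 2 * R * real (n + h - (n - h))" by simp
    also have "\<dots> \<le> 2 * R * real (2 * h)" using R by (intro mult_left_mono of_nat_mono) auto
    finally have 1: "(\<Sum>m<N. if n < m + h \<and> m < n + h then 2 * R else 0) \<le> 4 * R * real h" by simp
    \<comment> \<open>Below \<open>n\<close> there are \<open>n\<close> equal terms, and
      \<open>real n * (1 / \<rho>) ^ n\<close> stays bounded; from \<open>n\<close> on the terms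
      belong to a geometric series.\<close>
    have "(\<Sum>m<N. (1 / \<rho>) ^ max n m) = (\<Sum>m<n. (1 / \<rho>) ^ max n m) + (\<Sum>m\<in>{n..<N}. (1 / \<rho>) ^ max n m)"
      using that by (metis less_imp_le lessThan_atLeast0 sum.atLeastLessThan_concat zero_le)
    also have "(\<Sum>m<n. (1 / \<rho>) ^ max n m) = (\<Sum>m<n. (1 / \<rho>) ^ n)" by (intro sum.cong) auto
    also have "\<dots> = real n * (1 / \<rho>) ^ n" by simp
    also have "\<dots> \<le> K" using K[of n] by linarith
    also have "(\<Sum>m\<in>{n..<N}. (1 / \<rho>) ^ max n m) = (\<Sum>m\<in>{n..<N}. (1 / \<rho>) ^ m)" by (intro sum.cong) auto
    also have "\<dots> \<le> S" unfolding S_def using \<rho> by (intro sum_le_suminf sum1) auto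
    finally have 2: "(\<Sum>m<N. (1 / \<rho>) ^ max n m) \<le> K + S" by simp
    have "(\<Sum>m<N. A n m) = (\<Sum>m<N. if n < m + h \<and> m < n + h then 2 * R else 0) + 2 / \<delta> * (\<Sum>m<N. (1 / \<rho>) ^ max n m)"
      by (simp only: A_def sum.distrib sum_distrib_left)
    also have "\<dots> \<le> C" unfolding C_def using 1 2 \<delta> by (intro add_mono mult_left_mono) auto
    finally show ?thesis .
  qed
  have pair: "cmod (u n * cnj (u m) * (LINT t:{-R..R}|lborel. cis ((b n - b m) * t))) \<le> A n m" for n m
  proof -
    let ?I = "LINT t:{-R..R}|lborel. cis ((b n - b m) * t)"
    have le: "cmod (u n * cnj (u m) * ?I) \<le> cmod ?I"
      using mult_mono[OF u[of n] u[of m]] by (simp add: norm_mult mult_left_le_one_le)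
    show ?thesis
    proof (cases "u n = 0 \<or> u m = 0")
      case True
      then show ?thesis using A0[of n m] by auto
    next
      case nz: False
      show ?thesis
      proof (cases "n < m + h \<and> m < n + h")
        case True
        then have "2 * R \<le> A n m" using \<delta> \<rho> by (simp add: A_def)
        then show ?thesis using le oscillatory_integral_bound(1)[OF R, of "b n - b m"] by linarith
      next
        case False
        then have "\<delta> * \<rho> ^ max n m \<le> \<bar>b n - b m\<bar>"
          using gap[of m n] gap[of n m] nz by (auto simp: max_def abs_minus_commute)
        moreover have "\<delta> * \<rho> ^ max n m > 0" using \<delta> \<rho> by simp
        ultimately have "b n - b m \<noteq> 0" "2 / \<bar>b n - b m\<bar> \<le> 2 / (\<delta> * \<rho> ^ max n m)"
          by (auto intro!: divide_left_mono)
        then have "cmod ?I \<le> 2 / (\<delta> * \<rho> ^ max n m)"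
          using oscillatory_integral_bound(2)[OF R, of "b n - b m"] by linarith
        also have "\<dots> \<le> A n m" using R by (simp add: A_def power_one_over)
        finally show ?thesis using le by linarith
      qed
    qed
  qed
  have L2: "(\<integral>\<^sup>+t. ennreal ((cmod (\<Sum>n<N. ?f n t))\<^sup>2) \<partial>?M) \<le> ennreal (C * real N)" for N
  proof -
    have int: "set_integrable lborel {-R..R} (\<lambda>t. u n * cnj (u m) * cis ((b n - b m) * t))" for n m
      by (intro borel_integrable_atLeastAtMost') (intro continuous_intros)
    have sq: "of_real ((cmod (\<Sum>n<N. ?f n t))\<^sup>2) = (\<Sum>n<N. \<Sum>m<N. u n * cnj (u m) * cis ((b n - b m) * t))" for t
    proof -
      have "of_real ((cmod (\<Sum>n<N. ?f n t))\<^sup>2) = (\<Sum>n<N. ?f n t) * cnj (\<Sum>m<N. ?f m t)"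
        by (rule complex_norm_square)
      also have "\<dots> = (\<Sum>n<N. \<Sum>m<N. ?f n t * cnj (?f m t))"
        by (simp add: sum_product)
      also have "\<dots> = (\<Sum>n<N. \<Sum>m<N. u n * cnj (u m) * cis ((b n - b m) * t))"
      proof (intro sum.cong refl)
        fix n m
        have "cis ((b n - b m) * t) = cis (b n * t) * cnj (cis (b m * t))"
          by (simp add: cis_cnj cis_mult left_diff_distrib)
        then show "?f n t * cnj (?f m t) = u n * cnj (u m) * cis ((b n - b m) * t)"
          by (simp only: complex_cnj_mult mult_ac)
      qed
      finally show ?thesis .
    qed
    have intsq: "set_integrable lborel {-R..R} (\<lambda>t. (cmod (\<Sum>n<N. ?f n t))\<^sup>2)"
      by (intro borel_integrable_atLeastAtMost') (intro continuous_intros)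
    have "complex_of_real (LINT t:{-R..R}|lborel. (cmod (\<Sum>n<N. ?f n t))\<^sup>2)
        = (LINT t:{-R..R}|lborel. complex_of_real ((cmod (\<Sum>n<N. ?f n t))\<^sup>2))"
      by (rule set_integral_complex_of_real[symmetric])
    also have "\<dots> = (LINT t:{-R..R}|lborel. (\<Sum>n<N. \<Sum>m<N. u n * cnj (u m) * cis ((b n - b m) * t)))"
      by (simp only: sq)
    also have "\<dots> = (\<Sum>n<N. \<Sum>m<N. (LINT t:{-R..R}|lborel. u n * cnj (u m) * cis ((b n - b m) * t)))"
      using int unfolding set_lebesgue_integral_def set_integrable_def scaleR_sum_right
      by (simp only: Bochner_Integration.integral_sum Bochner_Integration.integrable_sum)
    also have "\<dots> = (\<Sum>n<N. \<Sum>m<N. u n * cnj (u m) * (LINT t:{-R..R}|lborel. cis ((b n - b m) * t)))"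
      by simp
    finally have eq: "complex_of_real (LINT t:{-R..R}|lborel. (cmod (\<Sum>n<N. ?f n t))\<^sup>2)
        = (\<Sum>n<N. \<Sum>m<N. u n * cnj (u m) * (LINT t:{-R..R}|lborel. cis ((b n - b m) * t)))" .
    have "(LINT t:{-R..R}|lborel. (cmod (\<Sum>n<N. ?f n t))\<^sup>2) \<le> cmod (complex_of_real (LINT t:{-R..R}|lborel. (cmod (\<Sum>n<N. ?f n t))\<^sup>2))"
      by simp
    also have "\<dots> \<le> (\<Sum>n<N. \<Sum>m<N. A n m)"
      unfolding eq by (intro sum_norm_le pair)
    also have "\<dots> \<le> (\<Sum>n<N. C)" using row by (intro sum_mono) auto
    also have "\<dots> = C * real N" by simp
    finally have le: "(LINT t:{-R..R}|lborel. (cmod (\<Sum>n<N. ?f n t))\<^sup>2) \<le> C * real N" .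
    have "(\<integral>\<^sup>+t. ennreal ((cmod (\<Sum>n<N. ?f n t))\<^sup>2) \<partial>?M)
        = (\<integral>\<^sup>+t. ennreal ((cmod (\<Sum>n<N. ?f n t))\<^sup>2) * indicator {-R..R} t \<partial>lborel)"
      by (subst nn_integral_restrict_space) auto
    also have "\<dots> = (\<integral>\<^sup>+t. ennreal (indicator {-R..R} t *\<^sub>R (cmod (\<Sum>n<N. ?f n t))\<^sup>2) \<partial>lborel)"
      by (intro nn_integral_cong) (auto simp: indicator_def)
    also have "\<dots> = ennreal (LINT t:{-R..R}|lborel. (cmod (\<Sum>n<N. ?f n t))\<^sup>2)"
      unfolding set_lebesgue_integral_def
      using intsq by (intro nn_integral_eq_integral) (auto simp: set_integrable_def)
    finally show ?thesis using le by (simp add: ennreal_leI)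
  qed
  have "AE t in ?M. (\<lambda>N. (\<Sum>n<N. ?f n t) / of_nat N) \<longlonglongrightarrow> 0"
  proof (rule averages_AE_tendsto_zero[OF _ _ L2])
    show "?f n \<in> borel_measurable ?M" for n
    proof -
      have "?f n \<in> borel_measurable borel"
        by (intro borel_measurable_continuous_onI continuous_intros)
      then show ?thesis by (simp add: measurable_restrict_space1)
    qed
    show "cmod (?f n t) \<le> 1" for n t using u by (simp add: norm_mult)
  qed
  then show ?thesis by (subst (asm) AE_restrict_space_iff) auto
qed

section \<open>Times at which an exponential sum is small\<close>

lemma card_gaps_le:
  fixes A :: "nat set"
  assumes "finite A" "\<And>n. n \<in> A \<Longrightarrow> n < N" "\<And>n m. n \<in> A \<Longrightarrow> m \<in> A \<Longrightarrow> n < m \<Longrightarrow> n + H \<le> m" "H > 0"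
  shows "card A \<le> N div H + 1"
proof -
  have "inj_on (\<lambda>n. n div H) A"
  proof (rule inj_onI, rule ccontr)
    fix n m assume *: "n \<in> A" "m \<in> A" "n div H = m div H" "n \<noteq> m"
    have "x div H \<noteq> y div H" if "x + H \<le> y" for x y :: nat
    proof -
      have "(x + H) div H \<le> y div H" using that by (rule div_le_mono)
      moreover have "(x + H) div H = Suc (x div H)" using assms(4) by simp
      ultimately show ?thesis by simp
    qed
    moreover have "n + H \<le> m \<or> m + H \<le> n"
      using assms(3)[of n m] assms(3)[of m n] * by linarith
    ultimately show False using *(3) by force
  qed
  moreover have "(\<lambda>n. n div H) ` A \<subseteq> {..N div H}"
    using assms(2) by (intro image_subsetI) (simp add: div_le_mono less_imp_le)
  ultimately have "card A \<le> card {..N div H}" by (rule card_inj_on_le) simp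
  then show ?thesis by simp
qed

text \<open>Since the ratios of the frequencies are not roots of unity, \<open>g (n + h) - z k ^ h * g n\<close> is again
  an exponential sum with non-zero coefficients, but with one frequency less. By induction it is
  rarely small, so that two small values of \<open>g\<close> are rarely at a bounded distance.\<close>

lemma exponential_sum_rarely_small:
  fixes z \<gamma> :: "'i \<Rightarrow> complex"
  assumes "finite J" "J \<noteq> {}" "\<And>j. j \<in> J \<Longrightarrow> cmod (z j) = 1" "\<And>j. j \<in> J \<Longrightarrow> \<gamma> j \<noteq> 0"
    and "\<And>i j h. i \<in> J \<Longrightarrow> j \<in> J \<Longrightarrow> i \<noteq> j \<Longrightarrow> h \<ge> 1 \<Longrightarrow> z i ^ h \<noteq> z j ^ h" and "\<epsilon> > 0"
  shows "\<exists>\<delta>>0. \<forall>\<^sub>F N in sequentially. real (card {n. n < N \<and> cmod (\<Sum>j\<in>J. \<gamma> j * z j ^ n) < \<delta>}) \<le> \<epsilon> * real N"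
  using assms
proof (induction J arbitrary: \<gamma> \<epsilon> rule: finite_ne_induct)
  case (singleton k)
  have "{n. n < N \<and> cmod (\<Sum>j\<in>{k}. \<gamma> j * z j ^ n) < cmod (\<gamma> k)} = {}" for N
    using singleton.prems(1) by (auto simp: norm_mult norm_power)
  then have "real (card {n. n < N \<and> cmod (\<Sum>j\<in>{k}. \<gamma> j * z j ^ n) < cmod (\<gamma> k)}) \<le> \<epsilon> * real N" for N
    using singleton.prems(4) by (simp only: card.empty) simp
  then show ?case using singleton.prems(2) by (intro exI[of _ "cmod (\<gamma> k)"]) (simp add: always_eventually)
next
  case (insert k J)
  let ?g = "\<lambda>n. \<Sum>j\<in>insert k J. \<gamma> j * z j ^ n"
  \<comment> \<open>Half of the density \<open>\<epsilon>\<close> is spent on indices at least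
    \<open>H\<close> apart, since \<open>2 / H \<le> \<epsilon> / 2\<close>; the other half is
    shared by the exceptional sets of the \<open>H\<close> shifts.\<close>
  define H where "H = nat \<lceil>4 / \<epsilon>\<rceil> + 1"
  have H: "H > 0" "real H \<ge> 4 / \<epsilon>" unfolding H_def by linarith+
  let ?c = "\<lambda>h n. \<Sum>j\<in>J. (\<gamma> j * (z j ^ h - z k ^ h)) * z j ^ n"
  have "\<exists>\<delta>>0. \<forall>\<^sub>F N in sequentially. real (card {n. n < N \<and> cmod (?c h n) < \<delta>}) \<le> \<epsilon> / (2 * real H) * real N"
    if "h \<in> {1..H}" for h
  proof (rule insert.IH)
    show "\<gamma> j * (z j ^ h - z k ^ h) \<noteq> 0" if "j \<in> J" for j
      using insert.prems(2)[of j] insert.prems(3)[of j k h] insert.hyps that \<open>h \<in> {1..H}\<close> by auto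
  qed (use insert.prems H in auto)
  then have "\<forall>h\<in>{1..H}. \<exists>\<delta>. \<delta> > 0 \<and> (\<forall>\<^sub>F N in sequentially. real (card {n. n < N \<and> cmod (?c h n) < \<delta>}) \<le> \<epsilon> / (2 * real H) * real N)"
    by (intro ballI) blast
  from bchoice[OF this] obtain D where "\<forall>h\<in>{1..H}. D h > 0 \<and> (\<forall>\<^sub>F N in sequentially. real (card {n. n < N \<and> cmod (?c h n) < D h}) \<le> \<epsilon> / (2 * real H) * real N)"
    by (elim exE) (rule that)
  then have D: "\<And>h. h \<in> {1..H} \<Longrightarrow> D h > 0"
    "\<And>h. h \<in> {1..H} \<Longrightarrow> \<forall>\<^sub>F N in sequentially. real (card {n. n < N \<and> cmod (?c h n) < D h}) \<le> \<epsilon> / (2 * real H) * real N"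
    by (simp_all only: simp_thms)
  \<comment> \<open>Half of the minimum, because two values below \<open>\<delta>\<close> enter each
    difference.\<close>
  define \<delta> where "\<delta> = Min (D ` {1..H}) / 2"
  have \<delta>D: "2 * \<delta> \<le> D h" if "h \<in> {1..H}" for h
    using that by (simp add: \<delta>_def)
  have \<delta>0: "\<delta> > 0"
    using D(1) H(1) by (simp add: \<delta>_def)
  have ev: "\<forall>\<^sub>F N in sequentially. \<forall>h\<in>{1..H}. real (card {n. n < N \<and> cmod (?c h n) < D h}) \<le> \<epsilon> / (2 * real H) * real N"
    using D(2) by (intro eventually_ball_finite) auto
  have ev2: "\<forall>\<^sub>F N in sequentially. N \<ge> H" by (rule eventually_ge_at_top)
  show ?case
  proof (intro exI[of _ \<delta>] conjI \<delta>0, use ev ev2 in eventually_elim)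
    case (elim N)
    define A where "A = {n. n < N \<and> cmod (?g n) < \<delta>}"
    define B where "B = (\<Union>h\<in>{1..H}. {n. n < N \<and> cmod (?c h n) < D h})"
    have finA: "finite A" and finB: "finite B" unfolding A_def B_def by auto
    have "card B \<le> (\<Sum>h\<in>{1..H}. card {n. n < N \<and> cmod (?c h n) < D h})"
      unfolding B_def by (rule card_UN_le) simp
    then have "real (card B) \<le> (\<Sum>h\<in>{1..H}. real (card {n. n < N \<and> cmod (?c h n) < D h}))"
      by (simp only: of_nat_sum[symmetric] of_nat_le_iff)
    also have "\<dots> \<le> (\<Sum>h\<in>{1..H}. \<epsilon> / (2 * real H) * real N)" using elim(1) by (intro sum_mono) auto
    also have "\<dots> = \<epsilon> / 2 * real N" using H by simp
    finally have cB: "real (card B) \<le> \<epsilon> / 2 * real N" .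
    have "card (A - B) \<le> N div H + 1"
    proof (rule card_gaps_le)
      fix n m assume nm: "n \<in> A - B" "m \<in> A - B" "n < m"
      show "n + H \<le> m"
      proof (rule ccontr)
        assume neg: "\<not> n + H \<le> m"
        define h where "h = m - n"
        have h: "h \<in> {1..H}" "m = n + h" using nm(3) neg by (auto simp: h_def)
        have zk: "cmod (z k) = 1" using insert.prems by auto
        have "?c h n = ?g (n + h) - z k ^ h * ?g n"
          using insert.hyps by (simp add: sum_distrib_left sum_subtractf[symmetric] power_add algebra_simps)
        then have "cmod (?c h n) \<le> cmod (?g m) + cmod (z k ^ h * ?g n)"
          by (simp only: h(2) norm_triangle_ineq4)
        also have "cmod (z k ^ h * ?g n) = cmod (?g n)" by (simp only: norm_mult norm_power zk) simp
        also have "cmod (?g m) + cmod (?g n) < 2 * \<delta>" using nm by (auto simp: A_def)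
        finally have "cmod (?c h n) < D h" using \<delta>D[OF h(1)] by linarith
        then have "n \<in> B" using h(1) nm by (auto simp: A_def B_def)
        then show False using nm by simp
      qed
    qed (use finA H in \<open>auto simp: A_def\<close>)
    then have "real (card (A - B)) \<le> real (N div H) + 1" by linarith
    also have "\<dots> \<le> real N / real H + 1" using of_nat_div_le_of_nat[of N H] by simp
    also have "\<dots> \<le> real N / real H + real N / real H"
    proof (rule add_left_mono)
      show "1 \<le> real N / real H" using elim(2) H(1) by simp
    qed
    also have "\<dots> = 2 * real N / real H" by simp
    also have "\<dots> \<le> 2 * real N / (4 / \<epsilon>)"
      using H insert.prems(4) by (intro divide_left_mono mult_pos_pos) auto
    also have "\<dots> = \<epsilon> / 2 * real N" using insert.prems(4) by simp
    finally have cAB: "real (card (A - B)) \<le> \<epsilon> / 2 * real N" .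
    have "card A \<le> card (A - B \<union> B)"
      using finA finB by (intro card_mono) auto
    also have "\<dots> \<le> card (A - B) + card B" by (rule card_Un_le)
    finally have "card A \<le> card (A - B) + card B" .
    then show ?case unfolding A_def[symmetric] using cAB cB by linarith
  qed
qed

text \<open>Masking the times with \<open>\<bar>b n\<bar> < D k * \<rho> ^ n\<close> leaves lacunary
  frequencies: for a large gap \<open>h\<close> the upper bound at the earlier time is at most half
  of the lower bound at the later one. The masked times have density at most
  \<open>1 / Suc k\<close>, and \<open>k\<close> is arbitrary.\<close>

lemma averages_twisted_AE:
  fixes b :: "nat \<Rightarrow> real" and u :: "nat \<Rightarrow> complex"
  assumes u: "\<And>n. cmod (u n) \<le> 1" and \<rho>: "\<rho> > 1" and C: "\<And>n. \<bar>b n\<bar> \<le> C * \<rho> ^ n"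
    and rare: "\<And>\<epsilon>. \<epsilon> > 0 \<Longrightarrow> \<exists>\<delta>>0. \<forall>\<^sub>F N in sequentially. real (card {n. n < N \<and> \<bar>b n\<bar> < \<delta> * \<rho> ^ n}) \<le> \<epsilon> * real N"
  shows "AE t in lborel. (\<lambda>N. (\<Sum>n<N. u n * cis (b n * t)) / of_nat N) \<longlonglongrightarrow> 0"
proof -
  have "\<forall>k. \<exists>\<delta>>0. \<forall>\<^sub>F N in sequentially. real (card {n. n < N \<and> \<bar>b n\<bar> < \<delta> * \<rho> ^ n}) \<le> inverse (real (Suc k)) * real N"
    using rare by simp
  from choice[OF this] obtain D where "\<forall>k. D k > 0 \<and> (\<forall>\<^sub>F N in sequentially. real (card {n. n < N \<and> \<bar>b n\<bar> < D k * \<rho> ^ n}) \<le> inverse (real (Suc k)) * real N)"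
    by (elim exE) (rule that)
  then have D: "\<And>k. D k > 0"
    "\<And>k. \<forall>\<^sub>F N in sequentially. real (card {n. n < N \<and> \<bar>b n\<bar> < D k * \<rho> ^ n}) \<le> inverse (real (Suc k)) * real N"
    by blast+
  define v where "v = (\<lambda>k n. if \<bar>b n\<bar> < D k * \<rho> ^ n then 0 else u n)"
  \<comment> \<open>Countably many bounded intervals and thresholds \<open>k\<close> suffice, so the
    null sets combine; \<open>Suc\<close> keeps the radius positive.\<close>
  have "AE t in lborel. t \<in> {-real (Suc R)..real (Suc R)} \<longrightarrow> (\<lambda>N. (\<Sum>n<N. v k n * cis (b n * t)) / of_nat N) \<longlonglongrightarrow> 0" for k R
  proof -
    have C0: "C \<ge> 0" using C[of 0] by simp
    have "(\<lambda>h. C * (1 / \<rho>) ^ h) \<longlonglongrightarrow> C * 0" using \<rho> by (intro tendsto_mult_left LIMSEQ_power_zero) auto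
    then have "\<forall>\<^sub>F h in sequentially. C * (1 / \<rho>) ^ h < D k / 2"
      using D(1)[of k] by (intro order_tendstoD) auto
    then obtain h where h: "C * (1 / \<rho>) ^ h < D k / 2" by (auto dest: eventually_happens)
    show ?thesis
    proof (rule lacunary_averages[where \<delta> = "D k / 2" and h = h])
      fix m n assume mn: "m + h \<le> n" "v k m \<noteq> 0" "v k n \<noteq> 0"
      have "D k * \<rho> ^ n \<le> \<bar>b n\<bar>" using mn(3) by (auto simp: v_def split: if_splits)
      moreover have "\<bar>b m\<bar> \<le> D k / 2 * \<rho> ^ n"
      proof -
        have "\<bar>b m\<bar> \<le> C * \<rho> ^ m" by (rule C)
        also have "\<dots> = C * (1 / \<rho>) ^ h * \<rho> ^ (m + h)" using \<rho> by (simp add: power_add power_one_over)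
        also have "\<dots> \<le> D k / 2 * \<rho> ^ n"
          using h mn(1) \<rho> C0 D(1)[of k] by (intro mult_mono power_increasing) auto
        finally show ?thesis .
      qed
      ultimately show "D k / 2 * \<rho> ^ n \<le> \<bar>b n - b m\<bar>" by linarith
    qed (use u D(1) \<rho> in \<open>auto simp: v_def\<close>)
  qed
  then have "AE t in lborel. \<forall>R k. t \<in> {-real (Suc R)..real (Suc R)} \<longrightarrow> (\<lambda>N. (\<Sum>n<N. v k n * cis (b n * t)) / of_nat N) \<longlonglongrightarrow> 0"
    by (simp only: AE_all_countable) blast
  then show ?thesis
  proof eventually_elim
    case (elim t)
    obtain R :: nat where "\<bar>t\<bar> \<le> real R" using real_arch_simple by blast
    then have "t \<in> {-real (Suc R)..real (Suc R)}" by auto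
    then have lim: "(\<lambda>N. (\<Sum>n<N. v k n * cis (b n * t)) / of_nat N) \<longlonglongrightarrow> 0" for k using elim by blast
    show ?case
    proof (rule tendstoI)
      fix e :: real assume e: "e > 0"
      obtain k where k: "inverse (real (Suc k)) < e / 2" using e reals_Archimedean[of "e / 2"] by auto
      have "\<forall>\<^sub>F N in sequentially. cmod ((\<Sum>n<N. v k n * cis (b n * t)) / of_nat N) < e / 2"
        using order_tendstoD(2)[OF tendsto_norm_zero[OF lim[of k]], of "e / 2"] e by simp
      then show "\<forall>\<^sub>F N in sequentially. dist ((\<Sum>n<N. u n * cis (b n * t)) / of_nat N) 0 < e"
        using D(2)[of k] eventually_gt_at_top[of 0]
      proof eventually_elim
        case (elim N)
        let ?B = "{n. n < N \<and> \<bar>b n\<bar> < D k * \<rho> ^ n}"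
        have eq: "(\<Sum>n<N. u n * cis (b n * t)) = (\<Sum>n<N. v k n * cis (b n * t)) + (\<Sum>n<N. if n \<in> ?B then u n * cis (b n * t) else 0)"
          unfolding sum.distrib[symmetric] by (intro sum.cong) (auto simp: v_def)
        have "cmod (\<Sum>n<N. if n \<in> ?B then u n * cis (b n * t) else 0) \<le> (\<Sum>n<N. if n \<in> ?B then 1 else 0)"
          using u by (intro sum_norm_le) (auto simp: norm_mult)
        also have "\<dots> = real (card ?B)"
          by (subst sum.If_cases) (auto intro!: arg_cong[where f = card])
        finally have le: "cmod (\<Sum>n<N. if n \<in> ?B then u n * cis (b n * t) else 0) \<le> real (card ?B)" .
        have "cmod (\<Sum>n<N. u n * cis (b n * t)) \<le> cmod (\<Sum>n<N. v k n * cis (b n * t)) + real (card ?B)"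
          unfolding eq by (rule order_trans[OF norm_triangle_ineq add_left_mono[OF le]])
        also have "\<dots> \<le> cmod (\<Sum>n<N. v k n * cis (b n * t)) + inverse (real (Suc k)) * real N"
          using elim(2) by simp
        finally have "cmod (\<Sum>n<N. u n * cis (b n * t)) / real N
            \<le> (cmod (\<Sum>n<N. v k n * cis (b n * t)) + inverse (real (Suc k)) * real N) / real N"
          by (rule divide_right_mono) simp
        also have "\<dots> = cmod (\<Sum>n<N. v k n * cis (b n * t)) / real N + inverse (real (Suc k))"
          unfolding add_divide_distrib using elim(3) by simp
        finally have "cmod (\<Sum>n<N. u n * cis (b n * t)) / real N \<le> cmod (\<Sum>n<N. v k n * cis (b n * t)) / real N + inverse (real (Suc k))" .
        moreover have "cmod (\<Sum>n<N. v k n * cis (b n * t)) / real N < e / 2"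
          using elim(1) by (simp only: norm_divide norm_of_nat)
        ultimately have "cmod (\<Sum>n<N. u n * cis (b n * t)) / real N < e" using k by linarith
        then show ?case by (simp only: dist_0_norm dist_commute[of _ 0] norm_divide norm_of_nat)
      qed
    qed
  qed
qed

section \<open>The Weyl criterion on the torus\<close>

lemma integral_unit_interval_cis:
  "(LINT t|lborel. indicator {0..1} t *\<^sub>R cis (2 * pi * of_int m * t)) = (if m = 0 then 1 else 0)"
proof (cases "m = 0")
  case True
  then show ?thesis by simp
next
  case False
  let ?\<beta> = "2 * pi * of_int m :: real"
  let ?F = "\<lambda>t. cis (?\<beta> * t) / (\<i> * of_real ?\<beta>)"
  have \<beta>: "?\<beta> \<noteq> 0" using False by simp
  have deriv: "(?F has_vector_derivative cis (?\<beta> * t)) (at t within {0..1})" for t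
  proof -
    have "((\<lambda>t. exp (\<i> * of_real \<beta> * of_real t) / (\<i> * of_real \<beta>)) has_vector_derivative exp (\<i> * of_real \<beta> * of_real t)) (at t within {0..1})"
      if "\<beta> \<noteq> 0" for \<beta> :: real
      using that by (auto intro!: derivative_eq_intros has_vector_derivative_real_field simp: field_simps)
    from this[OF \<beta>] show ?thesis by (simp add: cis_conv_exp mult_ac)
  qed
  have "(LINT t|lborel. indicator {0..1} t *\<^sub>R cis (?\<beta> * t)) = ?F 1 - ?F 0"
    by (rule integral_FTC_atLeastAtMost) (use deriv in \<open>auto intro!: continuous_intros\<close>)
  moreover have "cis ?\<beta> = 1" using cis_multiple_2pi[of "of_int m"] by simp
  ultimately show ?thesis using False by simp
qed

lemma inner_eq_int_pairing: "int_pairing k x = (\<chi> i. real_of_int (k $ i)) \<bullet> x"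
  by (simp add: int_pairing_def inner_vec_def)

text \<open>\<open>lborel\<close> is the image of a product measure, so Fubini splits the integral
  into one-dimensional ones over full periods; a single non-zero frequency makes the product
  vanish.\<close>

lemma lborel_cube_character:
  fixes k :: "int ^ 'n"
  shows "(LINT x|lborel. indicator (cbox 0 (\<chi> i. 1)) x *\<^sub>R cis (2 * pi * int_pairing k x)) = (if k = 0 then 1 else 0)"
proof -
  interpret P: product_sigma_finite "\<lambda>_ :: real ^ 'n. interval_measure (\<lambda>x :: real. x)"
    unfolding product_sigma_finite_def lborel_eq_real[symmetric]
    using lborel.sigma_finite_measure_axioms by blast
  let ?K = "\<chi> i. real_of_int (k $ i)"
  let ?\<phi> = "\<lambda>b t. indicator {0..1::real} t *\<^sub>R cis (2 * pi * (?K \<bullet> b) * t)"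
  have kb: "\<exists>m. ?K \<bullet> b = of_int m" if "b \<in> Basis" for b
    using that by (auto simp: Basis_vec_def inner_axis)
  have ind: "indicator (cbox 0 (\<chi> i. 1)) x = (\<Prod>b\<in>Basis. indicator {0..1::real} (x \<bullet> b) :: real)" for x :: "real ^ 'n"
  proof -
    have "x \<in> cbox 0 (\<chi> i. 1) \<longleftrightarrow> (\<forall>b\<in>Basis. x \<bullet> b \<in> {0..1})"
      by (auto simp: mem_box Basis_vec_def inner_axis)
    then show ?thesis by (auto simp: indicator_def intro!: prod.neutral[symmetric])
  qed
  have cisp: "cis (2 * pi * int_pairing k x) = (\<Prod>b\<in>Basis. cis (2 * pi * (?K \<bullet> b) * (x \<bullet> b)))" for x
  proof -
    have "cis (sum f A) = (\<Prod>b\<in>A. cis (f b))" for f and A :: "(real ^ 'n) set"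
      by (induction A rule: infinite_finite_induct) (auto simp: cis_mult[symmetric])
    moreover have "2 * pi * int_pairing k x = (\<Sum>b\<in>Basis. 2 * pi * (?K \<bullet> b) * (x \<bullet> b))"
      unfolding inner_eq_int_pairing by (subst euclidean_inner) (simp add: sum_distrib_left mult_ac)
    ultimately show ?thesis by simp
  qed
  have fac: "indicator (cbox 0 (\<chi> i. 1)) x *\<^sub>R cis (2 * pi * int_pairing k x) = (\<Prod>b\<in>Basis. ?\<phi> b (x \<bullet> b))" for x
    unfolding ind cisp by (simp add: scaleR_conv_of_real prod.distrib)
  have meas: "(\<lambda>x. \<Prod>b\<in>Basis. ?\<phi> b (x \<bullet> b)) \<in> borel_measurable borel"
  proof -
    have "(\<lambda>x. cis (c * (x \<bullet> b))) \<in> borel_measurable borel" for c and b :: "real ^ 'n"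
      by (intro borel_measurable_continuous_onI continuous_intros)
    then show ?thesis by measurable
  qed
  have int: "integrable (interval_measure (\<lambda>x. x)) (?\<phi> b)" for b
    unfolding lborel_eq_real[symmetric]
    using borel_integrable_atLeastAtMost'[of 0 1 "\<lambda>t. cis (2 * pi * (?K \<bullet> b) * t)"]
    by (simp add: set_integrable_def continuous_intros)
  have "(LINT x|lborel. indicator (cbox 0 (\<chi> i. 1)) x *\<^sub>R cis (2 * pi * int_pairing k x))
      = (LINT x|lborel. (\<Prod>b\<in>Basis. ?\<phi> b (x \<bullet> b)))"
    by (simp only: fac)
  also have "\<dots> = integral\<^sup>L (PiM Basis (\<lambda>b. interval_measure (\<lambda>x. x))) (\<lambda>f. \<Prod>b\<in>Basis. ?\<phi> b (f b))"
    unfolding lborel_def by (subst integral_distr) (use meas in \<open>auto intro!: Bochner_Integration.integral_cong prod.cong\<close>)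
  also have "\<dots> = (\<Prod>b\<in>Basis. (LINT t|lborel. ?\<phi> b t))"
    unfolding lborel_eq_real by (rule P.product_integral_prod) (use int in auto)
  also have "\<dots> = (if k = 0 then 1 else 0)"
  proof (cases "k = 0")
    case True
    then have "(LINT t|lborel. ?\<phi> b t) = 1" for b by simp (simp add: zero_vec_def[symmetric])
    then show ?thesis using True by simp
  next
    case False
    then obtain i where i: "k $ i \<noteq> 0" by (auto simp: vec_eq_iff)
    have "?K \<bullet> axis i 1 = of_int (k $ i)" by (simp add: inner_axis)
    then have "(LINT t|lborel. ?\<phi> (axis i 1) t) = 0"
      using integral_unit_interval_cis[of "k $ i"] i by simp
    then have "(\<Prod>b\<in>Basis. (LINT t|lborel. ?\<phi> b t)) = 0"
      by (intro prod_zero) (auto simp: Basis_vec_def intro!: bexI[of _ "axis i 1"])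
    then show ?thesis using False by simp
  qed
  finally show ?thesis .
qed

text \<open>\<open>rep_torus\<close> picks an arbitrary representative;
  \<open>torus_char_abs\<close> shows that the value does not depend on it.\<close>

definition torus_char :: "int ^ 'n \<Rightarrow> 'n::finite torus \<Rightarrow> complex" where
  "torus_char k p = cis (2 * pi * int_pairing k (rep_torus p))"

lemma torus_char_abs: "torus_char k (abs_torus x) = cis (2 * pi * int_pairing k x)"
proof -
  have "torus_rel (rep_torus (abs_torus x)) x"
    using Quotient_abs_rep[OF Quotient_torus] by (simp add: torus.abs_eq_iff[symmetric])
  then have "\<forall>i. (rep_torus (abs_torus x) - x) $ i \<in> \<int>"
    by (simp add: torus_rel_def)
  then have "int_pairing k (rep_torus (abs_torus x) - x) \<in> \<int>"
    unfolding int_pairing_def by (intro Ints_sum Ints_mult) auto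
  moreover have "int_pairing k (rep_torus (abs_torus x)) = int_pairing k x + int_pairing k (rep_torus (abs_torus x) - x)"
    unfolding int_pairing_linear(1)[symmetric] by simp
  ultimately obtain m where "int_pairing k (rep_torus (abs_torus x)) = int_pairing k x + of_int m"
    by (auto elim: Ints_cases)
  then have "torus_char k (abs_torus x) = cis (2 * pi * int_pairing k x) * cis (2 * pi * of_int m)"
    by (simp only: torus_char_def cis_mult distrib_left)
  moreover have "cis (2 * pi * of_int m) = 1" using cis_multiple_2pi[of "of_int m"] by simp
  ultimately show ?thesis by (simp only: mult_1_right)
qed

section \<open>Topology and Haar measure of the torus\<close>

lemma abs_torus_surj: "\<exists>x. p = abs_torus x"
  using Quotient_torus unfolding Quotient_def by metis

text \<open>By \<open>open_torus_iff\<close> the metric topology is the quotient topology, so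
  continuity can be tested on lifts.\<close>

lemma continuous_on_torusI:
  fixes f :: "'n::finite torus \<Rightarrow> 'b::topological_space"
  assumes "continuous_on UNIV (\<lambda>x. f (abs_torus x))"
  shows "continuous_on UNIV f"
  using assms by (simp add: continuous_on_open_vimage open_torus_iff vimage_comp comp_def)

lemma continuous_torus_char: "continuous_on UNIV (torus_char k)"
  by (rule continuous_on_torusI)
    (auto simp: torus_char_abs inner_eq_int_pairing intro!: continuous_intros)

lemma compact_torus: "compact (UNIV :: 'n::finite torus set)"
proof -
  have "p \<in> abs_torus ` cbox 0 (\<chi> i. 1)" for p :: "'n torus"
  proof -
    obtain x where x: "p = abs_torus x" using abs_torus_surj by blast
    have "torus_rel x (\<chi> i. frac (x $ i))"
      by (simp add: torus_rel_def frac_def)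
    then have "p = abs_torus (\<chi> i. frac (x $ i))"
      unfolding x using torus.abs_eq_iff by blast
    moreover have "(\<chi> i. frac (x $ i)) \<in> cbox 0 (\<chi> i. 1)"
      by (auto simp: mem_box_cart frac_lt_1 less_imp_le)
    ultimately show ?thesis by blast
  qed
  then have "(UNIV :: 'n torus set) = abs_torus ` cbox 0 (\<chi> i. 1)" by blast
  then show ?thesis
    by (metis compact_cbox compact_continuous_image continuous_abs_torus)
qed

lemma emeasure_haar_torus_UNIV: "emeasure haar_torus (UNIV :: 'n::finite torus set) = 1"
proof -
  have "emeasure lborel (cbox 0 (\<chi> i. 1) :: (real ^ 'n) set) = ennreal (\<Prod>b\<in>Basis. ((\<chi> i. 1) - (0 :: real ^ 'n)) \<bullet> b)"
    by (intro emeasure_lborel_cbox) (auto simp: Basis_vec_def inner_axis)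
  also have "(\<Prod>b\<in>Basis. ((\<chi> i. 1) - (0 :: real ^ 'n)) \<bullet> b) = 1"
    by (rule prod.neutral) (auto simp: Basis_vec_def inner_axis)
  finally show ?thesis by (simp add: emeasure_haar_torus)
qed

lemma finite_measure_haar_torus: "finite_measure haar_torus"
proof (rule finite_measureI)
  have "space haar_torus = (UNIV :: 'a torus set)" by (simp add: haar_torus_def)
  then show "emeasure haar_torus (space (haar_torus :: 'a torus measure)) \<noteq> \<infinity>"
    by (simp add: emeasure_haar_torus_UNIV)
qed

lemma integrable_haar_torus:
  fixes f :: "'n::finite torus \<Rightarrow> 'b::{banach, second_countable_topology}"
  assumes "continuous_on UNIV f"
  shows "integrable haar_torus f"
proof -
  have "bounded (range f)"
    using compact_continuous_image[OF assms compact_torus] compact_imp_bounded by blast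
  then obtain B where B: "\<And>x. norm (f x) \<le> B" by (auto simp: bounded_iff)
  have "f \<in> borel_measurable haar_torus"
    using borel_measurable_continuous_onI[OF assms] by (simp add: measurable_cong_sets[OF sets_haar_torus refl])
  then show ?thesis
    by (intro finite_measure.integrable_const_bound[OF finite_measure_haar_torus, where B = B]) (use B in auto)
qed

lemma integral_torus_char: "(LINT y|haar_torus. torus_char k y) = (if k = 0 then 1 else 0)"
proof -
  let ?C = "cbox 0 (\<chi> i. 1) :: (real ^ 'a) set"
  have m1: "emeasure lborel ?C = 1"
    using emeasure_haar_torus[of "UNIV :: 'a torus set"] emeasure_haar_torus_UNIV[where ?'n = 'a] by simp
  have um: "uniform_measure lborel ?C = density lborel (\<lambda>x. ennreal (indicator ?C x))"
    unfolding uniform_measure_def by (intro density_cong) (auto simp: m1 indicator_def)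
  have cont: "(\<lambda>x. cis (2 * pi * int_pairing k x)) \<in> borel_measurable borel"
    by (auto intro!: borel_measurable_continuous_onI continuous_intros simp: inner_eq_int_pairing)
  have "(LINT y|haar_torus. torus_char k y) = (LINT x|uniform_measure lborel ?C. torus_char k (abs_torus x))"
    unfolding haar_torus_def
    by (intro integral_distr) (use abs_torus_measurable borel_measurable_continuous_onI[OF continuous_torus_char] in
        \<open>auto simp: measurable_cong_sets[OF sets_uniform_measure refl]\<close>)
  also have "\<dots> = (LINT x|lborel. indicator ?C x *\<^sub>R cis (2 * pi * int_pairing k x))"
    unfolding um torus_char_abs by (rule integral_density) (use cont in auto)
  finally show ?thesis unfolding lborel_cube_character .
qed

text \<open>Lists with possible repetitions in place of finitely supported coefficients: sums become
  concatenations and multiplication by a character becomes a \<open>map\<close>.\<close>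

definition trig_poly :: "('n::finite torus \<Rightarrow> complex) \<Rightarrow> bool" where
  "trig_poly f \<longleftrightarrow> (\<exists>xs. \<forall>p. f p = (\<Sum>(c, k)\<leftarrow>xs. c * torus_char k p))"

lemma trig_poly_char: "trig_poly (\<lambda>p. c * torus_char k p)"
  unfolding trig_poly_def by (intro exI[of _ "[(c, k)]"]) simp

lemma trig_poly_add: "trig_poly f \<Longrightarrow> trig_poly g \<Longrightarrow> trig_poly (\<lambda>p. f p + g p)"
  unfolding trig_poly_def
proof (elim exE)
  fix xs ys assume "\<forall>p. f p = (\<Sum>(c, k)\<leftarrow>xs. c * torus_char k p)" "\<forall>p. g p = (\<Sum>(c, k)\<leftarrow>ys. c * torus_char k p)"
  then show "\<exists>xs. \<forall>p. f p + g p = (\<Sum>(c, k)\<leftarrow>xs. c * torus_char k p)"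
    by (intro exI[of _ "xs @ ys"]) simp
qed

lemma torus_char_add: "torus_char (k + l) p = torus_char k p * torus_char l p"
  by (simp add: torus_char_def cis_mult int_pairing_def algebra_simps sum.distrib)

lemma trig_poly_mult:
  assumes "trig_poly f" "trig_poly g"
  shows "trig_poly (\<lambda>p. f p * g p)"
proof -
  obtain xs ys where f: "\<And>p. f p = (\<Sum>(c, k)\<leftarrow>xs. c * torus_char k p)" and g: "\<And>p. g p = (\<Sum>(c, k)\<leftarrow>ys. c * torus_char k p)"
    using assms by (auto simp: trig_poly_def)
  have "trig_poly (\<lambda>p. (\<Sum>(c, k)\<leftarrow>xs. c * torus_char k p) * g p)"
  proof (induction xs)
    case Nil
    then show ?case using trig_poly_char[of 0 0] by simp
  next
    case (Cons x xs)
    obtain c k where x: "x = (c, k)" by fastforce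
    have "c * torus_char k p * g p = (\<Sum>(d, l)\<leftarrow>map (\<lambda>(d, l). (c * d, k + l)) ys. d * torus_char l p)" for p
      unfolding g by (induction ys) (auto simp: torus_char_add algebra_simps)
    then have "trig_poly (\<lambda>p. c * torus_char k p * g p)" unfolding trig_poly_def by blast
    from trig_poly_add[OF this Cons] show ?case by (simp add: x distrib_right)
  qed
  then show ?thesis by (simp add: f)
qed

lemma continuous_trig_poly:
  assumes "trig_poly f"
  shows "continuous_on UNIV f"
proof -
  obtain xs where f: "\<And>p. f p = (\<Sum>(c, k)\<leftarrow>xs. c * torus_char k p)"
    using assms by (auto simp: trig_poly_def)
  have "continuous_on UNIV (\<lambda>p. \<Sum>(c, k)\<leftarrow>xs. c * torus_char k p)"
    by (induction xs) (auto intro!: continuous_intros continuous_torus_char)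
  then show ?thesis by (simp add: f)
qed

text \<open>The Stone-Weierstrass theorem is applied in its real form, to the real functions whose
  complexification is a trigonometric polynomial. The characters \<open>axis i 1\<close> separate
  points.\<close>

lemma trig_poly_dense:
  fixes f :: "'n::finite torus \<Rightarrow> real"
  assumes "continuous_on UNIV f" "e > 0"
  shows "\<exists>g. trig_poly (\<lambda>p. of_real (g p)) \<and> (\<forall>p. \<bar>f p - g p\<bar> < e)"
proof -
  let ?R = "{g :: 'n torus \<Rightarrow> real. trig_poly (\<lambda>p. of_real (g p))}"
  have half: "trig_poly (\<lambda>p. of_real (Re (c * torus_char k p)))" for c and k :: "int ^ 'n"
  proof -
    have "cnj (torus_char k p) = torus_char (- k) p" for p
      by (simp add: torus_char_def cis_cnj int_pairing_def sum_negf)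
    then have "of_real (Re (c * torus_char k p)) = (c / 2) * torus_char k p + (cnj c / 2) * torus_char (- k) p" for p
      by (simp add: complex_eq_iff add_divide_distrib diff_divide_distrib flip: \<open>\<And>p. cnj (torus_char k p) = torus_char (- k) p\<close>)
    then show ?thesis
      using trig_poly_add[OF trig_poly_char[of "c / 2" k] trig_poly_char[of "cnj c / 2" "- k"]] by (simp only:)
  qed
  interpret function_ring_on ?R UNIV
  proof
    show "compact (UNIV :: 'n torus set)" by (rule compact_torus)
    show "continuous_on UNIV g" if "g \<in> ?R" for g
    proof -
      have "continuous_on UNIV (\<lambda>p. Re (complex_of_real (g p)))"
        using that by (intro continuous_intros continuous_trig_poly) auto
      then show ?thesis by simp
    qed
    show "(\<lambda>p. g p + h p) \<in> ?R" "(\<lambda>p. g p * h p) \<in> ?R" if "g \<in> ?R" "h \<in> ?R" for g h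
      using that by (simp_all add: trig_poly_add trig_poly_mult)
    show "(\<lambda>_. c) \<in> ?R" for c
      using trig_poly_char[of "of_real c" 0] by (simp add: torus_char_def int_pairing_def)
    fix p q :: "'n torus" assume "p \<noteq> q"
    obtain x y where xy: "p = abs_torus x" "q = abs_torus y" using abs_torus_surj by metis
    have "\<not> torus_rel x y" using \<open>p \<noteq> q\<close> unfolding xy by (simp add: torus.abs_eq_iff)
    then obtain i where i: "x $ i - y $ i \<notin> \<int>" by (auto simp: torus_rel_def)
    have pair: "int_pairing (axis i 1) z = z $ i" for z :: "real ^ 'n"
      by (simp add: int_pairing_def axis_def if_distrib[of "\<lambda>x. x * _"] if_distrib[of real_of_int] cong: if_cong)
    have "torus_char (axis i 1) p \<noteq> torus_char (axis i 1) q"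
    proof
      assume "torus_char (axis i 1) p = torus_char (axis i 1) q"
      then have "cis (2 * pi * (x $ i)) = cis (2 * pi * (y $ i))"
        by (simp add: xy torus_char_abs pair)
      then have "cis (2 * pi * (x $ i) - 2 * pi * (y $ i)) = 1"
        by (simp flip: cis_divide)
      then have "cos (2 * pi * (x $ i - y $ i)) = 1"
        by (metis Re_complex_of_real cis.sel(1) of_real_1 right_diff_distrib)
      then obtain m :: int where "2 * pi * (x $ i - y $ i) = of_int m * 2 * pi"
        unfolding cos_one_2pi_int by auto
      then have "x $ i - y $ i = of_int m" by simp
      then show False using i by simp
    qed
    \<comment> \<open>Multiplication by \<open>- \<i>\<close> turns an imaginary part into a real
      part, so \<open>half\<close> covers both.\<close>
    then have "Re (torus_char (axis i 1) p) \<noteq> Re (torus_char (axis i 1) q) \<or> Re (- \<i> * torus_char (axis i 1) p) \<noteq> Re (- \<i> * torus_char (axis i 1) q)"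
      by (auto simp: complex_eq_iff)
    then show "\<exists>f\<in>?R. f p \<noteq> f q"
    proof
      assume "Re (torus_char (axis i 1) p) \<noteq> Re (torus_char (axis i 1) q)"
      then show ?thesis using half[of 1 "axis i 1"] by (intro bexI[of _ "\<lambda>p. Re (torus_char (axis i 1) p)"]) auto
    next
      assume "Re (- \<i> * torus_char (axis i 1) p) \<noteq> Re (- \<i> * torus_char (axis i 1) q)"
      then show ?thesis using half[of "- \<i>" "axis i 1"] by (intro bexI[of _ "\<lambda>p. Re (- \<i> * torus_char (axis i 1) p)"]) auto
    qed
  qed
  show ?thesis using Stone_Weierstrass_basic[OF assms] by auto
qed

definition equidistributed :: "(nat \<Rightarrow> 'n::finite torus) \<Rightarrow> ('n torus \<Rightarrow> complex) \<Rightarrow> bool" where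
  "equidistributed x f \<longleftrightarrow> (\<lambda>N. (\<Sum>n<N. f (x n)) / of_nat N) \<longlonglongrightarrow> (LINT y|haar_torus. f y)"

lemma equidistributed_add:
  assumes "equidistributed x f" "equidistributed x g" "continuous_on UNIV f" "continuous_on UNIV g"
  shows "equidistributed x (\<lambda>p. f p + g p)"
  using tendsto_add[OF assms(1,2)[unfolded equidistributed_def]] assms(3,4)
  by (simp add: equidistributed_def sum.distrib add_divide_distrib integrable_haar_torus)

lemma equidistributed_cmult:
  assumes "equidistributed x f"
  shows "equidistributed x (\<lambda>p. c * f p)"
  using tendsto_mult_left[OF assms[unfolded equidistributed_def], of c]
  by (simp add: equidistributed_def sum_distrib_left)

text \<open>Linearity extends the hypothesis to trigonometric polynomials. Orbit averages and the
  integral both change by at most the uniform distance of the functions, so real continuous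
  functions follow by density.\<close>

lemma weyl_criterion:
  fixes x :: "nat \<Rightarrow> 'n::finite torus"
  assumes W: "\<And>k. k \<noteq> 0 \<Longrightarrow> (\<lambda>N. (\<Sum>n<N. torus_char k (x n)) / of_nat N) \<longlonglongrightarrow> 0"
    and f: "continuous_on UNIV f"
  shows "equidistributed x f"
proof -
  have ch: "equidistributed x (torus_char k)" for k
  proof (cases "k = 0")
    \<comment> \<open>The average equals 1 only for \<open>N > 0\<close>; at \<open>N = 0\<close>
      the division yields 0.\<close>
    case True
    have "\<forall>\<^sub>F N in sequentially. 1 = (\<Sum>n<N. torus_char k (x n)) / of_nat N"
      using eventually_gt_at_top[of 0] by eventually_elim (simp add: True torus_char_def int_pairing_def)
    then show ?thesis unfolding equidistributed_def using True
      by (simp add: integral_torus_char tendsto_eventually eventually_mono)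
  next
    case False
    then show ?thesis using W by (simp add: equidistributed_def integral_torus_char)
  qed
  have tp: "equidistributed x g" if tg: "trig_poly g" for g
  proof -
    obtain xs where g: "\<And>p. g p = (\<Sum>(c, k)\<leftarrow>xs. c * torus_char k p)"
      using tg by (auto simp: trig_poly_def)
    have "equidistributed x (\<lambda>p. \<Sum>(c, k)\<leftarrow>xs. c * torus_char k p)"
    proof (induction xs)
      case Nil
      then show ?case by (simp add: equidistributed_def)
    next
      case (Cons a xs)
      have "trig_poly (\<lambda>p. \<Sum>(c, k)\<leftarrow>xs. c * torus_char k p)" unfolding trig_poly_def by blast
      then show ?case
        using equidistributed_add[OF equidistributed_cmult[OF ch] Cons] by (cases a) (auto intro!: continuous_trig_poly trig_poly_char)
    qed
    moreover have "g = (\<lambda>p. \<Sum>(c, k)\<leftarrow>xs. c * torus_char k p)" by (rule ext) (rule g)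
    ultimately show ?thesis by (simp only:)
  qed
  have re: "equidistributed x (\<lambda>p. of_real (h p))" if h: "continuous_on UNIV h" for h :: "'n torus \<Rightarrow> real"
    unfolding equidistributed_def
  proof (rule tendstoI)
    fix e :: real assume e: "e > 0"
    obtain g where g: "trig_poly (\<lambda>p. of_real (g p))" "\<And>p. \<bar>h p - g p\<bar> < e / 3"
      using trig_poly_dense[OF h, of "e / 3"] e by auto
    let ?c = "\<lambda>h p. complex_of_real (h p)"
    have int: "integrable haar_torus (?c h)" "integrable haar_torus (?c g)"
      using continuous_trig_poly[OF g(1)] h by (auto intro!: integrable_haar_torus continuous_intros)
    have d: "cmod (?c h p - ?c g p) \<le> e / 3" for p
      using g(2)[of p] by (metis less_imp_le norm_of_real of_real_diff)
    have "cmod ((LINT y|haar_torus. ?c h y) - (LINT y|haar_torus. ?c g y)) = cmod (LINT y|haar_torus. (?c h y - ?c g y))"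
      by (subst Bochner_Integration.integral_diff[OF int]) (rule refl)
    also have "\<dots> \<le> (LINT y|haar_torus. cmod (?c h y - ?c g y))"
      by (rule integral_norm_bound)
    also have "\<dots> \<le> (LINT y|(haar_torus :: 'n torus measure). e / 3)"
    proof (rule integral_mono)
      show "integrable haar_torus (\<lambda>y. cmod (?c h y - ?c g y))"
        using int by (intro integrable_norm Bochner_Integration.integrable_diff)
      show "integrable haar_torus (\<lambda>y :: 'n torus. e / 3)"
        by (intro integrable_haar_torus continuous_intros)
    qed (rule d)
    also have "\<dots> = e / 3"
    proof -
      have "space haar_torus = (UNIV :: 'n torus set)" by (simp add: haar_torus_def)
      then show ?thesis by (simp add: measure_def emeasure_haar_torus_UNIV)
    qed
    finally have I: "cmod ((LINT y|haar_torus. ?c h y) - (LINT y|haar_torus. ?c g y)) \<le> e / 3" .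
    have "\<forall>\<^sub>F N in sequentially. dist ((\<Sum>n<N. ?c g (x n)) / of_nat N) (LINT y|haar_torus. ?c g y) < e / 3"
      using tendstoD[OF tp[OF g(1), unfolded equidistributed_def], of "e / 3"] e by simp
    then show "\<forall>\<^sub>F N in sequentially. dist ((\<Sum>n<N. ?c h (x n)) / of_nat N) (LINT y|haar_torus. ?c h y) < e"
      using eventually_gt_at_top[of 0]
    proof eventually_elim
      case (elim N)
      have "cmod ((\<Sum>n<N. ?c h (x n)) - (\<Sum>n<N. ?c g (x n))) \<le> (\<Sum>n<N. e / 3)"
        unfolding sum_subtractf[symmetric] by (intro sum_norm_le d)
      also have "\<dots> = real N * (e / 3)" by simp
      finally have "cmod ((\<Sum>n<N. ?c h (x n)) - (\<Sum>n<N. ?c g (x n))) / real N \<le> real N * (e / 3) / real N"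
        by (intro divide_right_mono) auto
      then have A: "cmod ((\<Sum>n<N. ?c h (x n)) / of_nat N - (\<Sum>n<N. ?c g (x n)) / of_nat N) \<le> e / 3"
        using elim(2) by (simp only: diff_divide_distrib[symmetric] norm_divide norm_of_nat) simp
      let ?a = "(\<Sum>n<N. ?c h (x n)) / of_nat N" and ?b = "(\<Sum>n<N. ?c g (x n)) / of_nat N"
        and ?I = "LINT y|haar_torus. ?c h y" and ?J = "LINT y|haar_torus. ?c g y"
      show ?case
        using A I elim(1) dist_triangle[of ?a ?I ?b] dist_triangle[of ?b ?I ?J]
        unfolding dist_norm norm_minus_commute[of ?J ?I] by linarith
    qed
  qed
  have "equidistributed x (\<lambda>p. of_real (Re (f p)) + \<i> * of_real (Im (f p)))"
    using f by (intro equidistributed_add equidistributed_cmult re continuous_intros)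
  then show ?thesis by (simp add: complex_eq[symmetric])
qed

section \<open>Equidistribution on translates of the weak stable subspace\<close>

definition averages_to_zero :: "(nat \<Rightarrow> complex) \<Rightarrow> bool" where
  "averages_to_zero g \<longleftrightarrow> (\<lambda>N. (\<Sum>n<N. g n) / of_nat N) \<longlonglongrightarrow> 0"

lemma averages_to_zero_tendsto:
  assumes "g \<longlonglongrightarrow> 0"
  shows "averages_to_zero g"
  unfolding averages_to_zero_def
proof (rule tendstoI)
  fix e :: real assume e: "e > 0"
  obtain n0 where n0: "\<And>n. n \<ge> n0 \<Longrightarrow> cmod (g n) < e / 2"
    using tendstoD[OF assms, of "e / 2"] e by (auto simp: eventually_sequentially)
  define K where "K = (\<Sum>n<n0. cmod (g n))"
  have "(\<lambda>N. K / real N) \<longlonglongrightarrow> 0" by (rule lim_const_over_n)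
  then have "\<forall>\<^sub>F N in sequentially. K / real N < e / 2" using e by (intro order_tendstoD) auto
  then show "\<forall>\<^sub>F N in sequentially. dist ((\<Sum>n<N. g n) / of_nat N) 0 < e"
    using eventually_gt_at_top[of n0]
  proof eventually_elim
    case (elim N)
    have N0: "real N > 0" using elim by simp
    have "cmod (\<Sum>n<N. g n) \<le> (\<Sum>n<N. cmod (g n))" by (rule norm_sum)
    also have "(\<Sum>n<N. cmod (g n)) = K + (\<Sum>n\<in>{n0..<N}. cmod (g n))"
      unfolding K_def using elim by (simp add: lessThan_atLeast0 sum.atLeastLessThan_concat)
    also have "(\<Sum>n\<in>{n0..<N}. cmod (g n)) \<le> (\<Sum>n\<in>{n0..<N}. e / 2)"
      using n0 by (intro sum_mono) (simp add: less_imp_le)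
    also have "\<dots> \<le> real N * (e / 2)" using e by simp
    finally have "cmod (\<Sum>n<N. g n) / real N \<le> (K + real N * (e / 2)) / real N"
      using N0 by (simp add: divide_right_mono)
    also have "\<dots> = K / real N + e / 2" using N0 by (simp add: add_divide_distrib)
    finally have "cmod (\<Sum>n<N. g n) / real N < e" using elim(1) by linarith
    then show ?case by (simp add: norm_divide)
  qed
qed

lemma averages_to_zero_add:
  "averages_to_zero f \<Longrightarrow> averages_to_zero g \<Longrightarrow> averages_to_zero (\<lambda>n. f n + g n)"
  unfolding averages_to_zero_def using tendsto_add_zero by (fastforce simp: sum.distrib add_divide_distrib)

lemma averages_to_zero_cmult:
  "averages_to_zero f \<Longrightarrow> averages_to_zero (\<lambda>n. c * f n)"
  unfolding averages_to_zero_def using tendsto_mult_right_zero[of _ _ c] by (fastforce simp: sum_distrib_left[symmetric])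

lemma averages_to_zero_sum:
  assumes "\<And>i. i \<in> I \<Longrightarrow> averages_to_zero (f i)"
  shows "averages_to_zero (\<lambda>n. \<Sum>i\<in>I. f i n)"
  using assms
proof (induction I rule: infinite_finite_induct)
  case (insert i I)
  then show ?case by (simp add: averages_to_zero_add)
qed (simp_all add: averages_to_zero_def)

lemma averages_to_zero_uniform:
  assumes "\<And>e. e > 0 \<Longrightarrow> \<exists>h. averages_to_zero h \<and> (\<forall>n. cmod (g n - h n) \<le> e)"
  shows "averages_to_zero g"
  unfolding averages_to_zero_def
proof (rule tendstoI)
  fix e :: real assume e: "e > 0"
  obtain h where h: "averages_to_zero h" "\<And>n. cmod (g n - h n) \<le> e / 2"
    using assms[of "e / 2"] e by auto
  have "\<forall>\<^sub>F N in sequentially. dist ((\<Sum>n<N. h n) / of_nat N) 0 < e / 2"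
    using tendstoD[OF h(1)[unfolded averages_to_zero_def], of "e / 2"] e by simp
  then show "\<forall>\<^sub>F N in sequentially. dist ((\<Sum>n<N. g n) / of_nat N) 0 < e"
    using eventually_gt_at_top[of 0]
  proof eventually_elim
    case (elim N)
    have "cmod ((\<Sum>n<N. g n) - (\<Sum>n<N. h n)) \<le> (\<Sum>n<N. e / 2)"
      unfolding sum_subtractf[symmetric] by (intro sum_norm_le h)
    also have "\<dots> = real N * (e / 2)" by simp
    finally have "cmod ((\<Sum>n<N. g n) - (\<Sum>n<N. h n)) / real N \<le> real N * (e / 2) / real N"
      by (intro divide_right_mono) auto
    then have A: "dist ((\<Sum>n<N. g n) / of_nat N) ((\<Sum>n<N. h n) / of_nat N) \<le> e / 2"
      using elim(2) by (simp only: dist_norm diff_divide_distrib[symmetric] norm_divide norm_of_nat) simp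
    then show ?case
      using elim(1) dist_triangle[of "(\<Sum>n<N. g n) / of_nat N" 0 "(\<Sum>n<N. h n) / of_nat N"] by linarith
  qed
qed

text \<open>Multiplying by \<open>exp (\<kappa> * \<mu> ^ n)\<close> preserves twisted convergence: for \<open>cmod \<mu> < 1\<close> the factor tends
  to 1, and for \<open>cmod \<mu> = 1\<close> the exponential series converges uniformly in \<open>n\<close>.\<close>

lemma averages_to_zero_exp_twist:
  fixes g :: "nat \<Rightarrow> complex"
  assumes B: "\<And>n. cmod (g n) \<le> B" and G: "\<And>\<zeta>. \<zeta> \<in> G \<Longrightarrow> averages_to_zero (\<lambda>n. g n * \<zeta> ^ n)"
    and G1: "\<And>\<zeta>. \<zeta> \<in> G \<Longrightarrow> cmod \<zeta> = 1"
    and \<mu>: "\<kappa> \<noteq> 0 \<Longrightarrow> cmod \<mu> \<le> 1" and mult: "\<And>\<zeta>. cmod \<mu> = 1 \<Longrightarrow> \<zeta> \<in> G \<Longrightarrow> \<zeta> * \<mu> \<in> G" and \<zeta>: "\<zeta> \<in> G"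
  shows "averages_to_zero (\<lambda>n. g n * exp (\<kappa> * \<mu> ^ n) * \<zeta> ^ n)"
proof -
  have B0: "B \<ge> 0" using B[of 0] norm_ge_zero order_trans by blast
  \<comment> \<open>The first case admits an expanding \<open>\<mu>\<close>: its coefficient
    vanishes and the factor is 1.\<close>
  consider "\<kappa> = 0" | "cmod \<mu> < 1" | "cmod \<mu> = 1" using \<mu> by linarith
  then show ?thesis
  proof cases
    case 1
    then show ?thesis using G[OF \<zeta>] by simp
  next
    case 2
    have "(\<lambda>n. exp (\<kappa> * \<mu> ^ n) - 1) \<longlonglongrightarrow> exp (\<kappa> * 0) - 1"
      using 2 by (intro tendsto_intros LIMSEQ_power_zero)
    then have "(\<lambda>n. B * cmod (exp (\<kappa> * \<mu> ^ n) - 1)) \<longlonglongrightarrow> B * cmod 0"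
      by (intro tendsto_intros) simp
    then have lim: "(\<lambda>n. B * cmod (exp (\<kappa> * \<mu> ^ n) - 1)) \<longlonglongrightarrow> 0" by simp
    have "(\<lambda>n. g n * \<zeta> ^ n * (exp (\<kappa> * \<mu> ^ n) - 1)) \<longlonglongrightarrow> 0"
    proof (rule Lim_null_comparison[OF _ lim])
      show "\<forall>\<^sub>F n in sequentially. norm (g n * \<zeta> ^ n * (exp (\<kappa> * \<mu> ^ n) - 1)) \<le> B * cmod (exp (\<kappa> * \<mu> ^ n) - 1)"
        by (intro always_eventually allI) (simp add: norm_mult norm_power G1[OF \<zeta>] mult_right_mono[OF B])
    qed
    from averages_to_zero_add[OF G[OF \<zeta>] averages_to_zero_tendsto[OF this]]
    show ?thesis by (simp add: algebra_simps)
  next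
    case 3
    \<comment> \<open>The term of order \<open>a\<close> of the exponential series turns the twist
      \<open>\<zeta>\<close> into \<open>\<zeta> * \<mu> ^ a\<close>; hence the hypothesis for all
      twists in \<open>G\<close> at once.\<close>
    have pw: "\<zeta> * \<mu> ^ a \<in> G" for a
      by (induction a) (use \<zeta> mult[OF 3] in \<open>auto simp: mult.assoc[symmetric] power_Suc2 simp del: power_Suc\<close>)
    show ?thesis
    proof (rule averages_to_zero_uniform)
      fix e :: real assume e: "e > 0"
      let ?t = "\<lambda>a. cmod \<kappa> ^ a / fact a"
      have summ: "summable ?t" using summable_exp[of "cmod \<kappa>"] by (simp add: divide_inverse mult.commute)
      have "(\<lambda>m. B * (\<Sum>a. ?t (a + m))) \<longlonglongrightarrow> B * 0"
        by (intro tendsto_mult_left) (rule suminf_exist_split2[OF summ])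
      then have "\<forall>\<^sub>F m in sequentially. B * (\<Sum>a. ?t (a + m)) < e"
        using e by (intro order_tendstoD) auto
      then obtain m where m: "B * (\<Sum>a. ?t (a + m)) < e" by (auto dest: eventually_happens)
      let ?h = "\<lambda>n. g n * (\<Sum>a<m. (\<kappa> * \<mu> ^ n) ^ a / fact a) * \<zeta> ^ n"
      have "?h n = (\<Sum>a<m. (\<kappa> ^ a / fact a) * (g n * (\<zeta> * \<mu> ^ a) ^ n))" for n
        by (simp add: sum_distrib_left sum_distrib_right power_mult_distrib mult_ac power_mult[symmetric])
      then have "averages_to_zero ?h"
        by (simp only:) (intro averages_to_zero_sum averages_to_zero_cmult G pw)
      moreover have "cmod (g n * exp (\<kappa> * \<mu> ^ n) * \<zeta> ^ n - ?h n) \<le> e" for n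
      proof -
        let ?w = "\<kappa> * \<mu> ^ n"
        have cw: "cmod ?w = cmod \<kappa>" using 3 by (simp add: norm_mult norm_power)
        have sums: "(\<lambda>a. ?w ^ a / fact a) sums exp ?w"
          using exp_converges[of ?w] by (simp add: scaleR_conv_of_real divide_inverse mult.commute)
        have "exp ?w = (\<Sum>a. ?w ^ a / fact a)" using sums_unique[OF sums] .
        also have "\<dots> = (\<Sum>a. ?w ^ (a + m) / fact (a + m)) + (\<Sum>a<m. ?w ^ a / fact a)"
          by (rule suminf_split_initial_segment) (use sums in \<open>auto simp: sums_iff\<close>)
        finally have eq: "exp ?w - (\<Sum>a<m. ?w ^ a / fact a) = (\<Sum>a. ?w ^ (a + m) / fact (a + m))" by simp
        have nrm: "cmod (?w ^ (a + m) / fact (a + m)) = ?t (a + m)" for a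
          by (simp add: norm_divide norm_power cw del: fact_Suc)
        have s2: "summable (\<lambda>a. ?t (a + m))"
          using summ by (rule iffD2[OF summable_iff_shift[of ?t m]])
        have "cmod (exp ?w - (\<Sum>a<m. ?w ^ a / fact a)) \<le> (\<Sum>a. cmod (?w ^ (a + m) / fact (a + m)))"
          unfolding eq by (rule summable_norm) (simp only: nrm s2)
        then have "cmod (exp ?w - (\<Sum>a<m. ?w ^ a / fact a)) \<le> (\<Sum>a. ?t (a + m))"
          by (simp only: nrm)
        then have "B * cmod (exp ?w - (\<Sum>a<m. ?w ^ a / fact a)) \<le> B * (\<Sum>a. ?t (a + m))"
          using B0 by (intro mult_left_mono)
        then have le: "B * cmod (exp ?w - (\<Sum>a<m. ?w ^ a / fact a)) \<le> e" using m by linarith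
        have "g n * exp ?w * \<zeta> ^ n - ?h n = g n * (exp ?w - (\<Sum>a<m. ?w ^ a / fact a)) * \<zeta> ^ n"
          by (simp only: left_diff_distrib right_diff_distrib)
        then have "cmod (g n * exp ?w * \<zeta> ^ n - ?h n) = cmod (g n) * cmod (exp ?w - (\<Sum>a<m. ?w ^ a / fact a))"
          by (simp only: norm_mult norm_power G1[OF \<zeta>] power_one mult_1_right)
        also have "\<dots> \<le> B * cmod (exp ?w - (\<Sum>a<m. ?w ^ a / fact a))"
          using B by (intro mult_right_mono) auto
        finally show ?thesis using le by linarith
      qed
      ultimately show "\<exists>h. averages_to_zero h \<and> (\<forall>n. cmod (g n * exp (\<kappa> * \<mu> ^ n) * \<zeta> ^ n - h n) \<le> e)"
        by blast
    qed
  qed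
qed

section \<open>Characters along orbits\<close>

lemma int_pairing_cvec: "int_pairing k (cvec x) = complex_of_real (int_pairing k x)"
  by (simp add: int_pairing_def)

lemma int_pairing_funpow:
  assumes E: "eigenbasis A \<nu> W \<alpha>"
  shows "complex_of_real (int_pairing k ((((*v) (map_matrix of_int A)) ^^ n) x))
    = (\<Sum>j\<in>UNIV. \<alpha> (cvec x) j * int_pairing k (W j) * \<nu> j ^ n)"
proof -
  have "complex_of_real (int_pairing k ((((*v) (map_matrix of_int A)) ^^ n) x))
      = int_pairing k ((((*v) (map_matrix of_int A)) ^^ n) (\<Sum>j\<in>UNIV. \<alpha> (cvec x) j *s W j))"
    by (simp only: int_pairing_cvec[symmetric] cvec_funpow eigenbasisD(4)[OF E])
  also have "\<dots> = (\<Sum>j\<in>UNIV. \<alpha> (cvec x) j * \<nu> j ^ n * int_pairing k (W j))"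
    by (simp only: eigenbasis_funpow[OF E] int_pairing_linear)
  finally show ?thesis by (simp add: mult_ac)
qed

text \<open>After division by \<open>\<rho> ^ n\<close> the dominant eigenvalues form a unimodular
  exponential sum to which \<open>exponential_sum_rarely_small\<close> applies, and the others tend
  to zero. All dominant coefficients are non-zero by \<open>int_pairing_eigenvector_nonzero\<close>,
  so one \<open>\<rho>\<close> serves every \<open>k\<close>.\<close>

lemma functional_orbit_rarely_small:
  fixes S :: "int ^ 'n ^ 'n"
  assumes tot: "totally_irreducible S" and E: "eigenbasis S \<nu> W \<alpha>" and u: "u \<notin> weak_stable_subspace S"
  obtains \<rho> where "\<rho> > 1"
    "\<And>k. k \<noteq> 0 \<Longrightarrow> \<exists>C. \<forall>n. \<bar>int_pairing k ((((*v) (map_matrix of_int S)) ^^ n) u)\<bar> \<le> C * \<rho> ^ n"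
    "\<And>k \<epsilon>. k \<noteq> 0 \<Longrightarrow> \<epsilon> > 0 \<Longrightarrow> \<exists>\<delta>>0. \<forall>\<^sub>F N in sequentially.
       real (card {n. n < N \<and> \<bar>int_pairing k ((((*v) (map_matrix of_int S)) ^^ n) u)\<bar> < \<delta> * \<rho> ^ n}) \<le> \<epsilon> * real N"
proof -
  have "irreducible_matrix (matrix_pow S 1)"
    using tot unfolding totally_irreducible_def by blast
  then have irr: "irreducible_matrix S" by (simp add: matrix_pow_def)
  let ?a = "\<lambda>j. \<alpha> (cvec u) j"
  obtain l where l: "cmod (\<nu> l) > 1" "?a l \<noteq> 0" "\<And>j. ?a j \<noteq> 0 \<Longrightarrow> cmod (\<nu> j) \<le> cmod (\<nu> l)"
    using exists_dominant_eigenvalue[OF E u] by blast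
  define \<rho> where "\<rho> = cmod (\<nu> l)"
  have \<rho>: "\<rho> > 1" using l(1) by (simp add: \<rho>_def)
  let ?b = "\<lambda>k n. int_pairing k ((((*v) (map_matrix real_of_int S)) ^^ n) u)"
  let ?\<gamma> = "\<lambda>k j. ?a j * int_pairing k (W j)"
  have b: "complex_of_real (?b k n) = (\<Sum>j\<in>UNIV. ?\<gamma> k j * \<nu> j ^ n)" for k n
    by (rule int_pairing_funpow[OF E])
  have upper: "\<exists>C. \<forall>n. \<bar>?b k n\<bar> \<le> C * \<rho> ^ n" for k
  proof (intro exI allI)
    fix n
    have "\<bar>?b k n\<bar> = cmod (\<Sum>j\<in>UNIV. ?\<gamma> k j * \<nu> j ^ n)" unfolding b[symmetric] by simp
    also have "\<dots> \<le> (\<Sum>j\<in>UNIV. cmod (?\<gamma> k j) * \<rho> ^ n)"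
    proof (rule sum_norm_le)
      fix j
      show "cmod (?\<gamma> k j * \<nu> j ^ n) \<le> cmod (?\<gamma> k j) * \<rho> ^ n"
        using l(3)[of j] by (cases "?a j = 0") (auto simp: norm_mult norm_power \<rho>_def intro!: mult_left_mono power_mono)
    qed
    also have "\<dots> = (\<Sum>j\<in>UNIV. cmod (?\<gamma> k j)) * \<rho> ^ n" by (simp add: sum_distrib_right)
    finally show "\<bar>?b k n\<bar> \<le> (\<Sum>j\<in>UNIV. cmod (?\<gamma> k j)) * \<rho> ^ n" .
  qed
  have rare: "\<exists>\<delta>>0. \<forall>\<^sub>F N in sequentially. real (card {n. n < N \<and> \<bar>?b k n\<bar> < \<delta> * \<rho> ^ n}) \<le> \<epsilon> * real N"
    if k: "k \<noteq> 0" and \<epsilon>: "\<epsilon> > 0" for k \<epsilon>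
  proof -
    define J where "J = {j. ?a j \<noteq> 0 \<and> cmod (\<nu> j) = \<rho>}"
    define z where "z = (\<lambda>j. \<nu> j / of_real \<rho>)"
    have fJ: "finite J" by simp
    have J0: "J \<noteq> {}" using l by (auto simp: J_def \<rho>_def)
    have "\<exists>\<delta>>0. \<forall>\<^sub>F N in sequentially. real (card {n. n < N \<and> cmod (\<Sum>j\<in>J. ?\<gamma> k j * z j ^ n) < \<delta>}) \<le> \<epsilon> / 2 * real N"
    proof (rule exponential_sum_rarely_small[OF fJ J0])
      show "cmod (z j) = 1" if "j \<in> J" for j using that \<rho> by (simp add: J_def z_def norm_divide)
      show "?\<gamma> k j \<noteq> 0" if "j \<in> J" for j
        using that int_pairing_eigenvector_nonzero[OF irr E k, of j] by (simp add: J_def)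
      show "z i ^ h \<noteq> z j ^ h" if "i \<noteq> j" "h \<ge> 1" for i j h
        using eigenvalue_powers_distinct[OF tot E that(2)] that(1) \<rho> by (auto simp: z_def power_divide inj_def)
      show "\<epsilon> / 2 > 0" using \<epsilon> by simp
    qed
    then obtain \<delta> where \<delta>: "\<delta> > 0"
      "\<forall>\<^sub>F N in sequentially. real (card {n. n < N \<and> cmod (\<Sum>j\<in>J. ?\<gamma> k j * z j ^ n) < \<delta>}) \<le> \<epsilon> / 2 * real N"
      by blast
    have "(\<lambda>n. \<Sum>j\<in>-J. ?\<gamma> k j * z j ^ n) \<longlonglongrightarrow> (\<Sum>j\<in>-J. 0)"
    proof (rule tendsto_sum)
      fix j assume j: "j \<in> - J"
      show "(\<lambda>n. ?\<gamma> k j * z j ^ n) \<longlonglongrightarrow> 0"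
      proof (cases "?a j = 0")
        case False
        then have "cmod (\<nu> j) < \<rho>" using j l(3)[of j] by (auto simp: J_def \<rho>_def)
        then have "cmod (z j) < 1" using \<rho> by (simp add: z_def norm_divide)
        then show ?thesis by (intro tendsto_mult_right_zero LIMSEQ_power_zero)
      qed simp
    qed
    then have "\<forall>\<^sub>F n in sequentially. dist (\<Sum>j\<in>-J. ?\<gamma> k j * z j ^ n) 0 < \<delta> / 2"
      using \<delta>(1) by (intro tendstoD) auto
    then obtain n0 where n0: "\<And>n. n \<ge> n0 \<Longrightarrow> cmod (\<Sum>j\<in>-J. ?\<gamma> k j * z j ^ n) < \<delta> / 2"
      by (auto simp: eventually_sequentially)
    \<comment> \<open>The second half of \<open>\<epsilon>\<close> absorbs the first
      \<open>n0\<close> times, at which the non-dominant part need not be small.\<close>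
    have ev: "\<forall>\<^sub>F N in sequentially. real n0 \<le> \<epsilon> / 2 * real N"
      using \<epsilon> by real_asymp
    have "\<forall>\<^sub>F N in sequentially. real (card {n. n < N \<and> \<bar>?b k n\<bar> < \<delta> / 2 * \<rho> ^ n}) \<le> \<epsilon> * real N"
      using \<delta>(2) ev
    proof eventually_elim
      case (elim N)
      have "{n. n < N \<and> \<bar>?b k n\<bar> < \<delta> / 2 * \<rho> ^ n} \<subseteq> {n. n < N \<and> cmod (\<Sum>j\<in>J. ?\<gamma> k j * z j ^ n) < \<delta>} \<union> {..<n0}"
      proof
        fix n assume n: "n \<in> {n. n < N \<and> \<bar>?b k n\<bar> < \<delta> / 2 * \<rho> ^ n}"
        show "n \<in> {n. n < N \<and> cmod (\<Sum>j\<in>J. ?\<gamma> k j * z j ^ n) < \<delta>} \<union> {..<n0}"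
        proof (cases "n < n0")
          case False
          have zn: "?\<gamma> k j * z j ^ n = ?\<gamma> k j * \<nu> j ^ n / of_real (\<rho> ^ n)" for j
            by (simp add: z_def power_divide)
          have "(\<Sum>j\<in>J. ?\<gamma> k j * z j ^ n) + (\<Sum>j\<in>-J. ?\<gamma> k j * z j ^ n) = (\<Sum>j\<in>UNIV. ?\<gamma> k j * z j ^ n)"
            by (subst sum.union_disjoint[symmetric]) (auto simp: Compl_partition)
          also have "\<dots> = of_real (?b k n) / of_real (\<rho> ^ n)"
            unfolding b zn by (rule sum_divide_distrib[symmetric])
          finally have eq: "(\<Sum>j\<in>J. ?\<gamma> k j * z j ^ n) = of_real (?b k n / \<rho> ^ n) - (\<Sum>j\<in>-J. ?\<gamma> k j * z j ^ n)"
            by (simp add: algebra_simps)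
          have "cmod (\<Sum>j\<in>J. ?\<gamma> k j * z j ^ n) \<le> cmod (of_real (?b k n / \<rho> ^ n)) + cmod (\<Sum>j\<in>-J. ?\<gamma> k j * z j ^ n)"
            unfolding eq by (rule norm_triangle_ineq4)
          moreover have "cmod (of_real (?b k n / \<rho> ^ n)) < \<delta> / 2"
            using n \<rho> by (simp add: abs_divide divide_less_eq del: of_real_divide)
          ultimately have "cmod (\<Sum>j\<in>J. ?\<gamma> k j * z j ^ n) < \<delta>"
            using n0[of n] False by simp
          then show ?thesis using n by simp
        qed simp
      qed
      then have "card {n. n < N \<and> \<bar>?b k n\<bar> < \<delta> / 2 * \<rho> ^ n} \<le> card ({n. n < N \<and> cmod (\<Sum>j\<in>J. ?\<gamma> k j * z j ^ n) < \<delta>} \<union> {..<n0})"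
        by (intro card_mono) auto
      also have "\<dots> \<le> card {n. n < N \<and> cmod (\<Sum>j\<in>J. ?\<gamma> k j * z j ^ n) < \<delta>} + n0"
        using card_Un_le[of _ "{..<n0}"] by simp
      finally show ?case using elim by linarith
    qed
    then show ?thesis using \<delta>(1) by (intro exI[of _ "\<delta> / 2"]) auto
  qed
  show ?thesis by (rule that[OF \<rho> upper rare])
qed

text \<open>The phase of \<open>y\<close> and the twist \<open>\<zeta> ^ n\<close> are unimodular
  and independent of \<open>t\<close>, so they are absorbed in the bounded coefficients of
  \<open>averages_twisted_AE\<close>. As the vectors \<open>k\<close> and the twists are countable,
  one null set serves all of them.\<close>

lemma character_orbit_averages_AE:
  fixes S :: "int ^ 'n ^ 'n"
  assumes tot: "totally_irreducible S" and u: "u \<notin> weak_stable_subspace S"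
    and E: "eigenbasis S \<nu> W \<alpha>" and G: "countable G" "\<And>\<zeta>. \<zeta> \<in> G \<Longrightarrow> cmod \<zeta> = 1"
  shows "AE t in lborel. \<forall>k. k \<noteq> 0 \<longrightarrow> (\<forall>\<zeta>\<in>G. averages_to_zero
    (\<lambda>n. cis (2 * pi * int_pairing k ((((*v) (map_matrix of_int S)) ^^ n) (y + t *\<^sub>R u))) * \<zeta> ^ n))"
proof -
  let ?F = "\<lambda>n x. (((*v) (map_matrix real_of_int S)) ^^ n) x"
  obtain \<rho> where \<rho>: "\<rho> > 1"
    "\<And>k. k \<noteq> 0 \<Longrightarrow> \<exists>C. \<forall>n. \<bar>int_pairing k (?F n u)\<bar> \<le> C * \<rho> ^ n"
    "\<And>k \<epsilon>. k \<noteq> 0 \<Longrightarrow> \<epsilon> > 0 \<Longrightarrow> \<exists>\<delta>>0. \<forall>\<^sub>F N in sequentially.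
       real (card {n. n < N \<and> \<bar>int_pairing k (?F n u)\<bar> < \<delta> * \<rho> ^ n}) \<le> \<epsilon> * real N"
    using functional_orbit_rarely_small[OF tot E u] by blast
  have one: "AE t in lborel. averages_to_zero (\<lambda>n. cis (2 * pi * int_pairing k (?F n (y + t *\<^sub>R u))) * \<zeta> ^ n)"
    if k: "k \<noteq> 0" and \<zeta>: "\<zeta> \<in> G" for k \<zeta>
  proof -
    let ?b = "\<lambda>n. 2 * pi * int_pairing k (?F n u)" and ?v = "\<lambda>n. cis (2 * pi * int_pairing k (?F n y)) * \<zeta> ^ n"
    obtain C where C: "\<And>n. \<bar>int_pairing k (?F n u)\<bar> \<le> C * \<rho> ^ n" using \<rho>(2)[OF k] by blast
    have "AE t in lborel. (\<lambda>N. (\<Sum>n<N. ?v n * cis (?b n * t)) / of_nat N) \<longlonglongrightarrow> 0"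
    proof (rule averages_twisted_AE[OF _ \<rho>(1)])
      show "cmod (?v n) \<le> 1" for n using G(2)[OF \<zeta>] by (simp add: norm_mult norm_power)
      show "\<bar>?b n\<bar> \<le> 2 * pi * C * \<rho> ^ n" for n using C[of n] by (simp add: abs_mult mult.assoc)
      fix \<epsilon> :: real assume "\<epsilon> > 0"
      from \<rho>(3)[OF k this] obtain \<delta> where \<delta>: "\<delta> > 0"
        "\<forall>\<^sub>F N in sequentially. real (card {n. n < N \<and> \<bar>int_pairing k (?F n u)\<bar> < \<delta> * \<rho> ^ n}) \<le> \<epsilon> * real N"
        by blast
      have "\<forall>\<^sub>F N in sequentially. real (card {n. n < N \<and> \<bar>?b n\<bar> < \<delta> * \<rho> ^ n}) \<le> \<epsilon> * real N"
        using \<delta>(2)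
      proof eventually_elim
        case (elim N)
        have "\<bar>int_pairing k (?F n u)\<bar> \<le> \<bar>?b n\<bar>" for n
          using mult_right_mono[of 1 "2 * pi" "\<bar>int_pairing k (?F n u)\<bar>"] pi_ge_two by (simp add: abs_mult)
        then have "card {n. n < N \<and> \<bar>?b n\<bar> < \<delta> * \<rho> ^ n} \<le> card {n. n < N \<and> \<bar>int_pairing k (?F n u)\<bar> < \<delta> * \<rho> ^ n}"
          by (intro card_mono) (auto intro: order_le_less_trans)
        then show ?case using elim by linarith
      qed
      then show "\<exists>\<delta>>0. \<forall>\<^sub>F N in sequentially. real (card {n. n < N \<and> \<bar>?b n\<bar> < \<delta> * \<rho> ^ n}) \<le> \<epsilon> * real N"
        using \<delta>(1) by blast
    qed
    moreover have "?v n * cis (?b n * t) = cis (2 * pi * int_pairing k (?F n (y + t *\<^sub>R u))) * \<zeta> ^ n" for n t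
    proof -
      have sc: "int_pairing k (t *\<^sub>R x) = t * int_pairing k x" for x :: "real ^ 'n"
        by (simp add: int_pairing_def sum_distrib_left mult_ac)
      have "cis (2 * pi * int_pairing k (?F n y)) * cis (?b n * t) = cis (2 * pi * int_pairing k (?F n (y + t *\<^sub>R u)))"
        by (simp add: cis_mult funpow_matrix_linear int_pairing_linear(1) sc algebra_simps)
      then show ?thesis by (simp only: mult.assoc mult.commute[of "\<zeta> ^ n"]) (simp only: mult.assoc[symmetric])
    qed
    ultimately show ?thesis by (simp only: averages_to_zero_def)
  qed
  have "AE t in lborel. \<forall>k. k \<noteq> 0 \<longrightarrow> (\<forall>\<zeta>\<in>G. averages_to_zero (\<lambda>n. cis (2 * pi * int_pairing k (?F n (y + t *\<^sub>R u))) * \<zeta> ^ n))"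
    unfolding AE_all_countable
  proof
    fix k :: "int ^ 'n"
    show "AE t in lborel. k \<noteq> 0 \<longrightarrow> (\<forall>\<zeta>\<in>G. averages_to_zero (\<lambda>n. cis (2 * pi * int_pairing k (?F n (y + t *\<^sub>R u))) * \<zeta> ^ n))"
      using AE_ball_countable[OF G(1), of "\<lambda>t \<zeta>. averages_to_zero (\<lambda>n. cis (2 * pi * int_pairing k (?F n (y + t *\<^sub>R u))) * \<zeta> ^ n)" lborel] one[of k]
      by (cases "k = 0") simp_all
  qed
  then show ?thesis .
qed

text \<open>The null set must not depend on \<open>c\<close>, which ranges over a possibly
  uncountable subspace. Randomness in \<open>t\<close> is therefore used only for countably many
  twisted averages; the passage from these to a given \<open>c\<close> is deterministic.\<close>

lemma AE_equidistributed_translates: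
  fixes S :: "int ^ 'n ^ 'n"
  assumes tot: "totally_irreducible S" and u: "u \<notin> weak_stable_subspace S"
  shows "AE t in lborel. \<forall>c\<in>weak_stable_subspace S. abs_torus (y + t *\<^sub>R u + c) \<in> Eq (torus_map S)"
proof -
  let ?F = "\<lambda>n x. (((*v) (map_matrix real_of_int S)) ^^ n) x"
  have "irreducible_matrix (matrix_pow S 1)"
    using tot unfolding totally_irreducible_def by blast
  then have "irreducible_matrix S" by (simp add: matrix_pow_def)
  then obtain \<nu> W \<alpha> where E: "eigenbasis S \<nu> W \<alpha>" using irreducible_matrix_eigenbasis by blast
  define Z where "Z = {\<mu>. \<mu> \<in> range \<nu> \<and> cmod \<mu> = 1}"
  \<comment> \<open>The monoid generated by the unimodular eigenvalues; indexing it by finite lists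
    makes it countable.\<close>
  define G where "G = prod_list ` lists Z"
  have "finite Z" unfolding Z_def by simp
  then have cG: "countable G" unfolding G_def by (intro countable_image countable_lists countable_finite)
  have G1: "cmod \<zeta> = 1" if "\<zeta> \<in> G" for \<zeta>
  proof -
    have "cmod (prod_list xs) = 1" if "xs \<in> lists Z" for xs
      using that by (induction xs) (auto simp: norm_mult Z_def)
    then show ?thesis using that by (auto simp: G_def)
  qed
  have one: "1 \<in> G" unfolding G_def by (rule image_eqI[of _ _ "[]"]) auto
  have Gmult: "\<zeta> * \<nu> j \<in> G" if \<zeta>: "\<zeta> \<in> G" and j: "cmod (\<nu> j) = 1" for \<zeta> j
  proof -
    obtain xs where "\<zeta> = prod_list xs" "xs \<in> lists Z" using \<zeta> by (auto simp: G_def)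
    then show ?thesis unfolding G_def using j by (intro image_eqI[of _ _ "\<nu> j # xs"]) (auto simp: Z_def)
  qed
  have "AE t in lborel. \<forall>k. k \<noteq> 0 \<longrightarrow> (\<forall>\<zeta>\<in>G. averages_to_zero
      (\<lambda>n. cis (2 * pi * int_pairing k (?F n (y + t *\<^sub>R u))) * \<zeta> ^ n))"
    by (rule character_orbit_averages_AE[OF tot u E cG]) (rule G1)
  then show ?thesis
  proof (eventually_elim, intro ballI)
    case (elim t)
    fix c assume c: "c \<in> weak_stable_subspace S"
    have coeff: "cmod (\<nu> j) \<le> 1" if "\<alpha> (cvec c) j \<noteq> 0" for j
      using weak_stable_subspace_coeff_zero[OF E c, of j] that by force
    let ?z = "y + t *\<^sub>R u"
    have "averages_to_zero (\<lambda>n. torus_char k ((torus_map S ^^ n) (abs_torus (?z + c))))" if k: "k \<noteq> 0" for k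
    proof -
      let ?X = "\<lambda>n. cis (2 * pi * int_pairing k (?F n ?z))"
      let ?\<kappa> = "\<lambda>j. 2 * pi * \<i> * (\<alpha> (cvec c) j * int_pairing k (W j))"
      \<comment> \<open>One eigenvalue is added at a time. A single factor need not be unimodular,
        only the full product is, so a bound is carried along in the induction.\<close>
      have tw: "averages_to_zero (\<lambda>n. ?X n * (\<Prod>j\<in>J. exp (?\<kappa> j * \<nu> j ^ n)) * \<zeta> ^ n)
          \<and> (\<exists>B. \<forall>n. cmod (?X n * (\<Prod>j\<in>J. exp (?\<kappa> j * \<nu> j ^ n))) \<le> B)"
        if "finite J" "\<zeta> \<in> G" for J \<zeta>
        using that
      proof (induction J arbitrary: \<zeta> rule: finite_induct)
        case empty
        have "averages_to_zero (\<lambda>n. ?X n * \<zeta> ^ n)" using elim k empty by blast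
        then show ?case by (simp add: exI[of _ 1])
      next
        case (insert i J)
        let ?g = "\<lambda>n. ?X n * (\<Prod>j\<in>J. exp (?\<kappa> j * \<nu> j ^ n))"
        obtain B where B: "\<And>n. cmod (?g n) \<le> B" using insert.IH[OF one] by blast
        have prod: "?X n * (\<Prod>j\<in>insert i J. exp (?\<kappa> j * \<nu> j ^ n)) = ?g n * exp (?\<kappa> i * \<nu> i ^ n)" for n
          using insert.hyps by (simp add: mult_ac)
        have "averages_to_zero (\<lambda>n. ?g n * exp (?\<kappa> i * \<nu> i ^ n) * \<zeta> ^ n)"
        proof (rule averages_to_zero_exp_twist[OF B, where G = G])
          show "averages_to_zero (\<lambda>n. ?g n * \<zeta> ^ n)" if "\<zeta> \<in> G" for \<zeta> using insert.IH[OF that] by blast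
          show "cmod (\<nu> i) \<le> 1" if "?\<kappa> i \<noteq> 0" using that coeff[of i] by auto
        qed (use G1 Gmult insert.prems in auto)
        moreover have "\<exists>B. \<forall>n. cmod (?g n * exp (?\<kappa> i * \<nu> i ^ n)) \<le> B"
        proof (intro exI allI)
          fix n
          have "cmod (exp (?\<kappa> i * \<nu> i ^ n)) \<le> exp (cmod (?\<kappa> i * \<nu> i ^ n))" by (rule norm_exp)
          also have "\<dots> \<le> exp (cmod (?\<kappa> i))"
          proof (cases "\<alpha> (cvec c) i = 0")
            case False
            have "cmod (\<nu> i) ^ n \<le> 1" using coeff[OF False] by (intro power_le_one) auto
            then have "cmod (?\<kappa> i) * cmod (\<nu> i) ^ n \<le> cmod (?\<kappa> i) * 1" by (intro mult_left_mono) auto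
            then show ?thesis by (simp only: norm_mult norm_power mult_1_right exp_le_cancel_iff)
          qed simp
          finally have "cmod (?g n) * cmod (exp (?\<kappa> i * \<nu> i ^ n)) \<le> B * exp (cmod (?\<kappa> i))"
            using B[of n] by (intro mult_mono) (auto intro: order_trans[OF norm_ge_zero B])
          then show "cmod (?g n * exp (?\<kappa> i * \<nu> i ^ n)) \<le> B * exp (cmod (?\<kappa> i))" by (simp only: norm_mult)
        qed
        ultimately show ?case by (simp only: prod)
      qed
      have "averages_to_zero (\<lambda>n. ?X n * (\<Prod>j\<in>UNIV. exp (?\<kappa> j * \<nu> j ^ n)) * 1 ^ n)"
        using tw[OF finite one] by blast
      moreover have "?X n * (\<Prod>j\<in>UNIV. exp (?\<kappa> j * \<nu> j ^ n)) * 1 ^ n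
          = torus_char k ((torus_map S ^^ n) (abs_torus (?z + c)))" for n
      proof -
        have "(\<Prod>j\<in>UNIV. exp (?\<kappa> j * \<nu> j ^ n)) = exp (\<Sum>j\<in>UNIV. ?\<kappa> j * \<nu> j ^ n)"
          by (rule exp_sum[symmetric]) simp
        also have "(\<Sum>j\<in>UNIV. ?\<kappa> j * \<nu> j ^ n) = \<i> * of_real (2 * pi * int_pairing k (?F n c))"
          by (simp add: int_pairing_funpow[OF E] sum_distrib_left mult_ac)
        finally have "(\<Prod>j\<in>UNIV. exp (?\<kappa> j * \<nu> j ^ n)) = cis (2 * pi * int_pairing k (?F n c))"
          by (simp only: cis_conv_exp)
        then show ?thesis
          by (simp add: torus_map_funpow torus_char_abs funpow_matrix_linear int_pairing_linear(1) cis_mult algebra_simps)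
      qed
      ultimately show ?thesis by (simp only:)
    qed
    then show "abs_torus (?z + c) \<in> Eq (torus_map S)"
      using weyl_criterion[where x = "\<lambda>n. (torus_map S ^^ n) (abs_torus (?z + c))"]
      unfolding Eq_def equidistributed_def averages_to_zero_def by blast
  qed
qed

section \<open>Covering the intersection by small sets\<close>

text \<open>A mass distribution principle for weighted covers. Applied successively to the Cantor
  parameter, the transversal parameter and the base point, it replaces a product measure.\<close>

lemma AE_cover_sum_lower_bound:
  fixes v m :: "nat \<Rightarrow> ennreal"
  assumes A: "A \<in> sets M" and B: "\<And>n. B n \<in> sets M"
    and cov: "AE x in M. x \<in> A \<longrightarrow> c \<le> (\<Sum>n. v n * indicator (B n) x)"
    and m: "\<And>n. emeasure M (A \<inter> B n) \<le> m n"
  shows "c * emeasure M A \<le> (\<Sum>n. v n * m n)"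
proof -
  have "c * emeasure M A = (\<integral>\<^sup>+x. c * indicator A x \<partial>M)"
    using A by (simp add: nn_integral_cmult_indicator)
  also have "\<dots> \<le> (\<integral>\<^sup>+x. (\<Sum>n. v n * indicator (A \<inter> B n) x) \<partial>M)"
    using cov by (intro nn_integral_mono_AE) (auto elim!: eventually_mono simp: indicator_def)
  also have "\<dots> = (\<Sum>n. \<integral>\<^sup>+x. v n * indicator (A \<inter> B n) x \<partial>M)"
    using A B by (intro nn_integral_suminf) auto
  also have "\<dots> = (\<Sum>n. v n * emeasure M (A \<inter> B n))"
    using A B by (simp add: nn_integral_cmult_indicator)
  also have "\<dots> \<le> (\<Sum>n. v n * m n)"
    using m by (intro suminf_le mult_left_mono) auto
  finally show ?thesis .
qed

lemma one_le_suminf_indicator: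
  fixes v :: "nat \<Rightarrow> ennreal"
  assumes "c \<le> v n * indicator (B n) x"
  shows "c \<le> (\<Sum>n. v n * indicator (B n) x)"
proof -
  have "f n \<le> suminf f" for f :: "nat \<Rightarrow> ennreal"
    using sum_le_suminf[of f "{n}"] by simp
  from order_trans[OF assms this[of "\<lambda>n. v n * indicator (B n) x"]] show ?thesis .
qed

lemma ND_if_avoids:
  assumes "\<epsilon> > 0" "\<And>n. \<epsilon> \<le> dist ((T ^^ n) p) q"
  shows "p \<in> ND T"
proof -
  have "q \<notin> closure {(T ^^ n) p | n. True}"
    using assms by (auto simp: closure_approachable not_less)
  then show ?thesis unfolding ND_def by auto
qed

lemma emeasure_lborel_interval_le:
  assumes "r \<ge> 0"
  shows "emeasure lborel (A \<inter> {t::real. \<bar>t - b\<bar> \<le> r}) \<le> ennreal (2 * r)"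
proof -
  have "emeasure lborel (A \<inter> {t. \<bar>t - b\<bar> \<le> r}) \<le> emeasure lborel {b - r..b + r}"
    by (intro emeasure_mono) auto
  then show ?thesis using assms by simp
qed

lemma totally_irreducible_imp_irreducible:
  "totally_irreducible A \<Longrightarrow> irreducible_matrix A"
  unfolding totally_irreducible_def
  by (drule spec[of _ 1]) (simp add: matrix_pow_def)

text \<open>Recorded in plane coordinates rather than by sets in the torus, so that the squares are
  measurable whatever \<open>X\<close> is. Radius 0 is allowed, for members that miss the
  slice.\<close>

definition slice_covered ::
  "'n::finite torus set \<Rightarrow> real ^ 'n \<Rightarrow> real ^ 'n \<Rightarrow> real ^ 'n \<Rightarrow> real \<Rightarrow> real \<Rightarrow>
    (nat \<Rightarrow> real) \<Rightarrow> (nat \<Rightarrow> real) \<Rightarrow> (nat \<Rightarrow> real) \<Rightarrow> bool" where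
  "slice_covered X w u y \<sigma> \<tau> a b r \<longleftrightarrow> (\<forall>s t. 0 \<le> s \<longrightarrow> s \<le> \<sigma> \<longrightarrow> 0 \<le> t \<longrightarrow> t \<le> \<tau> \<longrightarrow>
    abs_torus (y + s *\<^sub>R w + t *\<^sub>R u) \<in> X \<longrightarrow> (\<exists>n. \<bar>s - a n\<bar> \<le> r n \<and> \<bar>t - b n\<bar> \<le> r n))"

lemma slice_coveredD:
  assumes "slice_covered X w u y \<sigma> \<tau> a b r" "0 \<le> s" "s \<le> \<sigma>" "0 \<le> t" "t \<le> \<tau>"
    "abs_torus (y + s *\<^sub>R w + t *\<^sub>R u) \<in> X"
  obtains n where "\<bar>s - a n\<bar> \<le> r n" "\<bar>t - b n\<bar> \<le> r n"
  using assms unfolding slice_covered_def by blast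

text \<open>The two alternatives of \<open>uw\<close> dictate the order of integration. If
  \<open>w\<close> is weakly stable for \<open>S\<close>, almost every \<open>t\<close> makes the
  whole line in direction \<open>w\<close> equidistributed, and the Cantor parameter is integrated
  first. Otherwise one Cantor set tolerates all small \<open>t\<close>, and \<open>t\<close> is
  integrated first. Both orders produce the factors \<open>K * r n powr \<gamma>\<close> and
  \<open>2 * r n\<close>.\<close>

lemma slice_covering_bound:
  fixes S T :: "int ^ 'n ^ 'n"
  assumes S: "totally_irreducible S" and T: "totally_irreducible T"
    and u: "u \<notin> weak_stable_subspace S" and w: "w \<notin> weak_stable_subspace T"
    and uw: "w \<in> weak_stable_subspace S \<or> u \<in> weak_stable_subspace T"
    and \<gamma>: "0 < \<gamma>" "\<gamma> < 1" and \<eta>: "\<eta> > 0"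
  obtains \<sigma> \<tau> \<kappa> where "0 < \<sigma>" "\<sigma> \<le> \<eta>" "0 < \<tau>" "\<tau> \<le> \<eta>" "0 < \<kappa>"
    "\<And>y a b r. \<forall>n. r n \<ge> 0 \<Longrightarrow>
      slice_covered (Eq (torus_map S) \<inter> ND (torus_map T)) w u y \<sigma> \<tau> a b r \<Longrightarrow>
      ennreal \<kappa> \<le> (\<Sum>n. ennreal (r n powr (1 + \<gamma>)))"
proof -
  let ?X = "Eq (torus_map S) \<inter> ND (torus_map T)"
  note irrT = totally_irreducible_imp_irreducible[OF T]
  obtain \<sigma> \<epsilon> K where \<sigma>: "0 < \<sigma>" "\<sigma> \<le> \<eta>" and \<epsilon>: "0 < \<epsilon>" and K: "0 < K"
    and cantor: "\<And>y. \<exists>x :: real \<Rightarrow> real. x \<in> borel_measurable borel \<and> (\<forall>\<omega>. 0 \<le> x \<omega> \<and> x \<omega> \<le> \<sigma>)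
       \<and> (\<forall>\<omega> n. \<epsilon> \<le> dist ((torus_map T ^^ n) (abs_torus (y + x \<omega> *\<^sub>R w))) (abs_torus 0))
       \<and> (\<forall>a r. r \<ge> 0 \<longrightarrow> emeasure lborel {\<omega>\<in>{0..<1}. \<bar>x \<omega> - a\<bar> \<le> r} \<le> ennreal (K * r powr \<gamma>))"
    by (rule nondense_cantor_set[OF irrT w \<gamma> \<eta>]) (rule that)
  have final: "ennreal (\<tau> / (2 * K)) \<le> (\<Sum>n. ennreal (r n powr (1 + \<gamma>)))"
    if le: "ennreal \<tau> \<le> (\<Sum>n. ennreal (K * r n powr \<gamma>) * ennreal (2 * r n))" and r: "\<And>n. r n \<ge> 0" and \<tau>: "\<tau> > 0"
    for r :: "nat \<Rightarrow> real" and \<tau>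
  proof -
    have "ennreal (K * r n powr \<gamma>) * ennreal (2 * r n) = ennreal (2 * K) * ennreal (r n powr (1 + \<gamma>))" for n
    proof -
      have "r n powr (1 + \<gamma>) = r n * r n powr \<gamma>"
        using r[of n] by (cases "r n = 0") (auto simp: powr_add)
      then show ?thesis using K r[of n] by (simp add: ennreal_mult[symmetric] mult_ac)
    qed
    then have "ennreal \<tau> \<le> ennreal (2 * K) * (\<Sum>n. ennreal (r n powr (1 + \<gamma>)))"
      using le by simp
    then have "ennreal (1 / (2 * K)) * ennreal \<tau> \<le> ennreal (1 / (2 * K)) * (ennreal (2 * K) * (\<Sum>n. ennreal (r n powr (1 + \<gamma>))))"
      by (rule mult_left_mono) simp
    also have "\<dots> = (\<Sum>n. ennreal (r n powr (1 + \<gamma>)))"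
      using K by (simp add: mult.assoc[symmetric] ennreal_mult[symmetric])
    finally show ?thesis using K \<tau> by (simp add: ennreal_mult[symmetric])
  qed
  show ?thesis
  proof (cases "w \<in> weak_stable_subspace S")
    case True
    have main: "ennreal (\<eta> / (2 * K)) \<le> (\<Sum>n. ennreal (r n powr (1 + \<gamma>)))"
      if r0: "\<forall>n. r n \<ge> 0" and cov: "slice_covered ?X w u y \<sigma> \<eta> a b r" for y a b r
    proof (rule final[OF _ r0[rule_format] \<eta>])
      note r = r0[rule_format]
      let ?J = "\<lambda>n. {t. \<bar>t - b n\<bar> \<le> r n}"
      have "AE t in lborel. t \<in> {0..\<eta>} \<longrightarrow> 1 \<le> (\<Sum>n. ennreal (K * r n powr \<gamma>) * indicator (?J n) t)"
        using AE_equidistributed_translates[OF S u, of y]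
      proof eventually_elim
        case (elim t)
        show ?case
        proof
          assume t: "t \<in> {0..\<eta>}"
          \<comment> \<open>The Cantor map depends on \<open>t\<close> through an arbitrary choice;
            after integration over \<open>\<omega>\<close> only the intervals \<open>?J n\<close>
            depend on \<open>t\<close>.\<close>
          obtain x :: "real \<Rightarrow> real" where x: "x \<in> borel_measurable borel" "\<And>\<omega>. 0 \<le> x \<omega> \<and> x \<omega> \<le> \<sigma>"
            and av: "\<And>\<omega> n. \<epsilon> \<le> dist ((torus_map T ^^ n) (abs_torus (y + t *\<^sub>R u + x \<omega> *\<^sub>R w))) (abs_torus 0)"
            and fr: "\<And>a r. r \<ge> 0 \<Longrightarrow> emeasure lborel {\<omega>\<in>{0..<1}. \<bar>x \<omega> - a\<bar> \<le> r} \<le> ennreal (K * r powr \<gamma>)"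
            using cantor[of "y + t *\<^sub>R u"] by blast
          let ?I = "\<lambda>n. {\<omega>. \<bar>x \<omega> - a n\<bar> \<le> r n}"
          have "1 * emeasure lborel {0..<1::real} \<le> (\<Sum>n. indicator (?J n) t * ennreal (K * r n powr \<gamma>))"
          proof (rule AE_cover_sum_lower_bound)
            show "?I n \<in> sets lborel" for n using x(1) by measurable
            show "emeasure lborel ({0..<1} \<inter> ?I n) \<le> ennreal (K * r n powr \<gamma>)" for n
            proof -
              have "{0..<1} \<inter> ?I n = {\<omega>\<in>{0..<1}. \<bar>x \<omega> - a n\<bar> \<le> r n}" by auto
              then show ?thesis using fr[OF r] by simp
            qed
            show "AE \<omega> in lborel. \<omega> \<in> {0..<1} \<longrightarrow> 1 \<le> (\<Sum>n. indicator (?J n) t * indicator (?I n) \<omega> :: ennreal)"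
            proof (rule AE_I2, rule impI)
              fix \<omega> :: real
              have "x \<omega> *\<^sub>R w \<in> weak_stable_subspace S"
                using True unfolding weak_stable_subspace_def by (rule span_scale)
              then have "abs_torus (y + t *\<^sub>R u + x \<omega> *\<^sub>R w) \<in> ?X"
                using elim ND_if_avoids[OF \<epsilon> av] by blast
              then have "abs_torus (y + x \<omega> *\<^sub>R w + t *\<^sub>R u) \<in> ?X"
                by (simp only: add.assoc add.commute[of "t *\<^sub>R u"])
              moreover have "0 \<le> x \<omega>" "x \<omega> \<le> \<sigma>" "0 \<le> t" "t \<le> \<eta>" using x(2) t by auto
              ultimately obtain n where "\<bar>x \<omega> - a n\<bar> \<le> r n" "\<bar>t - b n\<bar> \<le> r n"
                using slice_coveredD[OF cov, of "x \<omega>" t] by blast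
              then have "(1::ennreal) \<le> indicator (?J n) t * indicator (?I n) \<omega>" by simp
              then show "1 \<le> (\<Sum>n. indicator (?J n) t * indicator (?I n) \<omega> :: ennreal)"
                by (rule one_le_suminf_indicator)
            qed
          qed simp
          then show "1 \<le> (\<Sum>n. ennreal (K * r n powr \<gamma>) * indicator (?J n) t)"
            by (simp add: mult.commute)
        qed
      qed
      from AE_cover_sum_lower_bound[OF _ _ this, of "\<lambda>n. ennreal (2 * r n)"]
      have "1 * emeasure lborel {0..\<eta>} \<le> (\<Sum>n. ennreal (K * r n powr \<gamma>) * ennreal (2 * r n))"
        using emeasure_lborel_interval_le[OF r] by simp
      then show "ennreal \<eta> \<le> (\<Sum>n. ennreal (K * r n powr \<gamma>) * ennreal (2 * r n))"
        using \<eta> by simp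
    qed
    have "0 < \<eta> / (2 * K)" using \<eta> K by simp
    from that[OF \<sigma> \<eta> order_refl this main] show ?thesis .
  next
    case False
    then have uT: "u \<in> weak_stable_subspace T" using uw by blast
    obtain C where C: "C > 0" "\<And>n. norm ((((*v) (map_matrix real_of_int T)) ^^ n) u) \<le> C"
      using weak_stable_subspace_bounded[OF irrT uT] by blast
    \<comment> \<open>Moving by at most \<open>\<tau>\<close> along \<open>u\<close> shifts the
      whole orbit by at most \<open>\<epsilon> / 2\<close>, so half of the avoided ball remains
      avoided.\<close>
    define \<tau> where "\<tau> = min \<eta> (\<epsilon> / (2 * C))"
    have \<tau>: "0 < \<tau>" "\<tau> \<le> \<eta>" using \<eta> \<epsilon> C by (auto simp: \<tau>_def)
    have "\<tau> \<le> \<epsilon> / (2 * C)" by (simp add: \<tau>_def)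
    then have \<tau>C: "\<tau> * C \<le> \<epsilon> / 2" using C(1) by (simp add: field_simps)
    have main: "ennreal (\<tau> / (2 * K)) \<le> (\<Sum>n. ennreal (r n powr (1 + \<gamma>)))"
      if r0: "\<forall>n. r n \<ge> 0" and cov: "slice_covered ?X w u y \<sigma> \<tau> a b r" for y a b r
    proof (rule final[OF _ r0[rule_format] \<tau>(1)])
      note r = r0[rule_format]
      obtain x :: "real \<Rightarrow> real" where x: "x \<in> borel_measurable borel" "\<And>\<omega>. 0 \<le> x \<omega> \<and> x \<omega> \<le> \<sigma>"
        and av: "\<And>\<omega> n. \<epsilon> \<le> dist ((torus_map T ^^ n) (abs_torus (y + x \<omega> *\<^sub>R w))) (abs_torus 0)"
        and fr: "\<And>a r. r \<ge> 0 \<Longrightarrow> emeasure lborel {\<omega>\<in>{0..<1}. \<bar>x \<omega> - a\<bar> \<le> r} \<le> ennreal (K * r powr \<gamma>)"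
        using cantor[of y] by blast
      let ?J = "\<lambda>n. {t. \<bar>t - b n\<bar> \<le> r n}" and ?I = "\<lambda>n. {\<omega>. \<bar>x \<omega> - a n\<bar> \<le> r n}"
      \<comment> \<open>The null set of exceptional \<open>t\<close> varies with
        \<open>\<omega>\<close>; integrating over \<open>t\<close> with \<open>\<omega>\<close>
        fixed disposes of it.\<close>
      have "ennreal \<tau> \<le> (\<Sum>n. ennreal (2 * r n) * indicator (?I n) \<omega>)" for \<omega>
      proof -
        have "1 * emeasure lborel {0..\<tau>} \<le> (\<Sum>n. indicator (?I n) \<omega> * ennreal (2 * r n))"
        proof (rule AE_cover_sum_lower_bound)
          show "?J n \<in> sets lborel" for n by measurable
          show "emeasure lborel ({0..\<tau>} \<inter> ?J n) \<le> ennreal (2 * r n)" for n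
            by (rule emeasure_lborel_interval_le[OF r])
          show "AE t in lborel. t \<in> {0..\<tau>} \<longrightarrow> 1 \<le> (\<Sum>n. indicator (?I n) \<omega> * indicator (?J n) t :: ennreal)"
            using AE_equidistributed_translates[OF S u, of "y + x \<omega> *\<^sub>R w"]
          proof eventually_elim
            case (elim t)
            show ?case
            proof
              assume t: "t \<in> {0..\<tau>}"
              have "0 \<in> weak_stable_subspace S" unfolding weak_stable_subspace_def by (rule span_zero)
              then have "abs_torus (y + x \<omega> *\<^sub>R w + t *\<^sub>R u + 0) \<in> Eq (torus_map S)" using elim by blast
              moreover have "abs_torus (y + x \<omega> *\<^sub>R w + t *\<^sub>R u) \<in> ND (torus_map T)"
              proof (rule ND_if_avoids)
                show "\<epsilon> / 2 > 0" using \<epsilon> by simp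
                fix n
                let ?F = "\<lambda>x. (((*v) (map_matrix real_of_int T)) ^^ n) x"
                have "dist (abs_torus (?F (y + x \<omega> *\<^sub>R w))) (abs_torus (?F (y + x \<omega> *\<^sub>R w + t *\<^sub>R u))) \<le> dist (?F (y + x \<omega> *\<^sub>R w)) (?F (y + x \<omega> *\<^sub>R w + t *\<^sub>R u))"
                  by (rule dist_abs_torus_le)
                also have "\<dots> = t * norm (?F u)"
                  using t by (simp add: dist_norm funpow_matrix_linear)
                also have "\<dots> \<le> \<tau> * C" using t C(2)[of n] \<tau> by (intro mult_mono) auto
                finally have "dist (abs_torus (?F (y + x \<omega> *\<^sub>R w))) (abs_torus (?F (y + x \<omega> *\<^sub>R w + t *\<^sub>R u))) \<le> \<epsilon> / 2"
                  using \<tau>C by linarith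
                moreover have "\<epsilon> \<le> dist (abs_torus (?F (y + x \<omega> *\<^sub>R w))) (abs_torus 0)"
                  using av[of n \<omega>] by (simp only: torus_map_funpow)
                ultimately show "\<epsilon> / 2 \<le> dist ((torus_map T ^^ n) (abs_torus (y + x \<omega> *\<^sub>R w + t *\<^sub>R u))) (abs_torus 0)"
                  unfolding torus_map_funpow
                  using dist_triangle[of "abs_torus (?F (y + x \<omega> *\<^sub>R w))" "abs_torus 0" "abs_torus (?F (y + x \<omega> *\<^sub>R w + t *\<^sub>R u))"]
                  by linarith
              qed
              ultimately have "abs_torus (y + x \<omega> *\<^sub>R w + t *\<^sub>R u) \<in> ?X" by simp
              moreover have "0 \<le> x \<omega>" "x \<omega> \<le> \<sigma>" "0 \<le> t" "t \<le> \<tau>" using x(2) t by auto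
              ultimately obtain n where "\<bar>x \<omega> - a n\<bar> \<le> r n" "\<bar>t - b n\<bar> \<le> r n"
                using slice_coveredD[OF cov, of "x \<omega>" t] by blast
              then have "(1::ennreal) \<le> indicator (?I n) \<omega> * indicator (?J n) t" by simp
              then show "1 \<le> (\<Sum>n. indicator (?I n) \<omega> * indicator (?J n) t :: ennreal)"
                by (rule one_le_suminf_indicator)
            qed
          qed
        qed simp
        then show ?thesis using \<tau> by (simp add: mult.commute)
      qed
      then have "ennreal \<tau> * emeasure lborel {0..<1::real} \<le> (\<Sum>n. ennreal (2 * r n) * ennreal (K * r n powr \<gamma>))"
      proof (intro AE_cover_sum_lower_bound[where B = ?I])
        show "?I n \<in> sets lborel" for n using x(1) by measurable
        show "emeasure lborel ({0..<1} \<inter> ?I n) \<le> ennreal (K * r n powr \<gamma>)" for n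
        proof -
          have "{0..<1} \<inter> ?I n = {\<omega>\<in>{0..<1}. \<bar>x \<omega> - a n\<bar> \<le> r n}" by auto
          then show ?thesis using fr[OF r] by simp
        qed
      qed auto
      then show "ennreal \<tau> \<le> (\<Sum>n. ennreal (K * r n powr \<gamma>) * ennreal (2 * r n))"
        by (simp add: mult.commute)
    qed
    have "0 < \<tau> / (2 * K)" using \<tau> K by simp
    from that[OF \<sigma> \<tau> this main] show ?thesis .
  qed
qed

section \<open>Hausdorff measure on the torus\<close>

lemma dist_abs_torus_eq_norm:
  assumes "norm (x - y) < 1/2"
  shows "dist (abs_torus x) (abs_torus y) = norm (x - y)"
proof (rule antisym)
  show "dist (abs_torus x) (abs_torus y) \<le> norm (x - y)"
    using dist_abs_torus_le[of x y] by (simp add: dist_norm)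
  show "norm (x - y) \<le> dist (abs_torus x) (abs_torus y)"
  proof (rule ccontr)
    assume "\<not> norm (x - y) \<le> dist (abs_torus x) (abs_torus y)"
    then obtain z where z: "\<And>i. z $ i \<in> \<int>" "norm (x - y - z) < norm (x - y)"
      unfolding not_le dist_torus_less_iff by blast
    have "z \<noteq> 0" using z(2) by auto
    \<comment> \<open>Every non-zero lattice vector is at least twice as long as the allowed
      distance, so subtracting one cannot shorten \<open>x - y\<close>.\<close>
    then have "1 \<le> norm z" using norm_integer_vector_ge_1 z(1) by blast
    moreover have "norm z \<le> norm (x - y) + norm (x - y - z)"
      using norm_triangle_ineq4[of "x - y" "x - y - z"] by simp
    ultimately show False using z(2) assms by linarith
  qed
qed

text \<open>Scale 1 suffices: diameters at most 1 are only needed to compare powers with different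
  exponents.\<close>

lemma hausdorff_measure_zero_cover:
  assumes "hausdorff_measure s X = 0" "e > 0"
  obtains U where "X \<subseteq> (\<Union>n. U n)" "\<And>n. bounded (U n)" "\<And>n. diameter (U n) \<le> 1"
    "(\<Sum>n. ennreal (diameter (U n) powr s)) < e"
proof -
  have "hausdorff_premeasure s 1 X \<le> hausdorff_measure s X"
    unfolding hausdorff_measure_def by (rule SUP_upper) simp
  then have "hausdorff_premeasure s 1 X < e" using assms by simp
  then show ?thesis unfolding hausdorff_premeasure_def INF_less_iff using that by blast
qed

text \<open>With \<open>d = CARD('n)\<close>, the torus is covered by \<open>N ^ d\<close> cubes of
  diameter at most \<open>d / N\<close>, whose sum is at most a constant times
  \<open>N powr (d - s)\<close> and tends to zero.\<close>

lemma hausdorff_measure_torus_zero: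
  fixes X :: "'n::finite torus set"
  assumes s: "s > real CARD('n)"
  shows "hausdorff_measure s X = 0"
proof -
  let ?d = "CARD('n)"
  have d: "?d > 0" by simp
  have "hausdorff_premeasure s \<delta> X \<le> 0" if \<delta>: "\<delta> > 0" for \<delta>
  proof -
    have le: "hausdorff_premeasure s \<delta> X \<le> ennreal (real ?d powr s * real N powr (real ?d - s))"
      if N: "N > 0" "real ?d / real N \<le> \<delta>" for N :: nat
    proof -
      let ?I = "(UNIV :: 'n set) \<rightarrow>\<^sub>E {..<N}"
      have cI: "card ?I = N ^ ?d" by (simp add: card_PiE)
      have "finite ?I" by (intro finite_PiE) auto
      then obtain f where f: "bij_betw f {..<N ^ ?d} ?I"
        using cI by (metis card_lessThan finite_lessThan finite_same_card_bij)
      \<comment> \<open>Empty sets extend the finite grid to a sequence; their diameter is 0, and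
        \<open>0 powr s = 0\<close>.\<close>
      define U :: "nat \<Rightarrow> 'n torus set" where "U = (\<lambda>n. if n < N ^ ?d then
          abs_torus ` cbox (\<chi> i. real (f n i) / real N) (\<chi> i. (real (f n i) + 1) / real N) else {})"
      have cover: "X \<subseteq> (\<Union>n. U n)"
      proof
        fix p :: "'n torus" assume "p \<in> X"
        obtain x where x: "p = abs_torus x" using abs_torus_surj by blast
        define g where "g = (\<lambda>i. nat \<lfloor>real N * frac (x $ i)\<rfloor>)"
        have g0: "0 \<le> real N * frac (x $ i)" for i using N by simp
        have gN: "g i < N" for i
        proof -
          have "real N * frac (x $ i) < real N * 1" using N frac_lt_1 by (intro mult_strict_left_mono) auto
          then show ?thesis using g0[of i] unfolding g_def by linarith
        qed
        then have "g \<in> ?I" by auto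
        then have "g \<in> f ` {..<N ^ ?d}" unfolding bij_betw_imp_surj_on[OF f] .
        then obtain n where n: "n < N ^ ?d" "f n = g" by auto
        have "torus_rel x (\<chi> i. frac (x $ i))" by (simp add: torus_rel_def frac_def)
        then have "p = abs_torus (\<chi> i. frac (x $ i))" unfolding x using torus.abs_eq_iff by blast
        moreover have "(\<chi> i. frac (x $ i)) \<in> cbox (\<chi> i. real (f n i) / real N) (\<chi> i. (real (f n i) + 1) / real N)"
        proof -
          have "real (g i) \<le> real N * frac (x $ i)" "real N * frac (x $ i) \<le> real (g i) + 1" for i
            using g0[of i] unfolding g_def by linarith+
          then show ?thesis using N by (simp add: mem_box_cart n divide_le_eq le_divide_eq mult.commute)
        qed
        ultimately have "p \<in> U n" using n by (auto simp: U_def)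
        then show "p \<in> (\<Union>n. U n)" by blast
      qed
      have diam: "diameter (U n) \<le> real ?d / real N" for n
      proof (cases "U n = {}")
        case False
        then have U: "U n = abs_torus ` cbox (\<chi> i. real (f n i) / real N) (\<chi> i. (real (f n i) + 1) / real N)"
          by (auto simp: U_def split: if_splits)
        have "dist p q \<le> real ?d / real N" if pq: "p \<in> U n" "q \<in> U n" for p q
        proof -
          obtain x y where xy: "p = abs_torus x" "q = abs_torus y"
            "x \<in> cbox (\<chi> i. real (f n i) / real N) (\<chi> i. (real (f n i) + 1) / real N)"
            "y \<in> cbox (\<chi> i. real (f n i) / real N) (\<chi> i. (real (f n i) + 1) / real N)"
            using pq unfolding U by (elim imageE) (rule that)
          have "dist p q \<le> norm (x - y)" using dist_abs_torus_le[of x y] xy by (simp add: dist_norm)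
          also have "\<dots> \<le> (\<Sum>i\<in>UNIV. \<bar>(x - y) $ i\<bar>)" by (rule norm_le_l1_cart)
          also have "\<dots> \<le> (\<Sum>i\<in>(UNIV :: 'n set). 1 / real N)"
          proof (rule sum_mono)
            fix i
            have "real (f n i) / real N \<le> x $ i" "x $ i \<le> real (f n i) / real N + 1 / real N"
              "real (f n i) / real N \<le> y $ i" "y $ i \<le> real (f n i) / real N + 1 / real N"
              using xy by (simp_all add: mem_box_cart add_divide_distrib)
            then show "\<bar>(x - y) $ i\<bar> \<le> 1 / real N" by (simp add: abs_le_iff)
          qed
          also have "\<dots> = real ?d / real N" by simp
          finally show ?thesis .
        qed
        then show ?thesis unfolding diameter_def using False by (auto intro!: cSUP_least)
      qed (use N in \<open>simp add: diameter_def\<close>)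
      have bd: "bounded (U n)" for n
        using compact_imp_bounded[OF compact_torus] by (rule bounded_subset) simp
      have "hausdorff_premeasure s \<delta> X \<le> (\<Sum>n. ennreal (diameter (U n) powr s))"
        unfolding hausdorff_premeasure_def
      proof (rule INF_lower)
        show "U \<in> {U. X \<subseteq> (\<Union>n. U n) \<and> (\<forall>n. bounded (U n) \<and> diameter (U n) \<le> \<delta>)}"
          using cover bd diam order_trans[OF diam N(2)] by blast
      qed
      also have "\<dots> = (\<Sum>n<N ^ ?d. ennreal (diameter (U n) powr s))"
        by (rule suminf_finite) (auto simp: U_def diameter_def)
      also have "\<dots> \<le> (\<Sum>n<N ^ ?d. ennreal ((real ?d / real N) powr s))"
        using diam s diameter_ge_0[OF bd] by (intro sum_mono ennreal_leI powr_mono2) auto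
      also have "\<dots> = ennreal (real (N ^ ?d) * (real ?d / real N) powr s)"
        by (simp add: ennreal_mult' ennreal_of_nat_eq_real_of_nat del: of_nat_power)
      also have "real (N ^ ?d) * (real ?d / real N) powr s = real ?d powr s * real N powr (real ?d - s)"
        using N by (simp add: powr_divide powr_diff powr_realpow)
      finally show ?thesis .
    qed
    have "(\<lambda>N. real ?d powr s * real N powr (real ?d - s)) \<longlonglongrightarrow> real ?d powr s * 0"
      using s by (intro tendsto_mult_left tendsto_neg_powr filterlim_real_sequentially) auto
    then have lim: "(\<lambda>N. ennreal (real ?d powr s * real N powr (real ?d - s))) \<longlonglongrightarrow> ennreal 0"
      by (intro tendsto_ennrealI) simp
    have "(\<lambda>N. real ?d / real N) \<longlonglongrightarrow> 0" by (rule lim_const_over_n)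
    then have "\<forall>\<^sub>F N in sequentially. real ?d / real N < \<delta>" using \<delta> by (rule order_tendstoD)
    then have "\<forall>\<^sub>F N in sequentially. hausdorff_premeasure s \<delta> X \<le> ennreal (real ?d powr s * real N powr (real ?d - s))"
      using eventually_gt_at_top[of 0] by eventually_elim (rule le, auto)
    then show ?thesis using tendsto_lowerbound[OF lim] by simp
  qed
  then show ?thesis
    unfolding hausdorff_measure_def by (intro antisym SUP_least) auto
qed

lemma hausdorff_dim_torus_le:
  fixes X :: "'n::finite torus set"
  shows "hausdorff_dim X \<le> of_nat CARD('n)"
proof (rule dense_ge)
  fix y :: ennreal assume y: "of_nat CARD('n) < y"
  show "hausdorff_dim X \<le> y"
  proof (cases y)
    case (real s)
    then have "real CARD('n) < s" using y by (simp add: ennreal_of_nat_eq_real_of_nat ennreal_less_iff)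
    then show ?thesis unfolding hausdorff_dim_def real
      by (intro Inf_lower) (auto intro!: exI[of _ s] hausdorff_measure_torus_zero)
  qed simp
qed

text \<open>In the coordinates \<open>x = y + s w + t u\<close> with \<open>y $ i = y $ j = 0\<close>, sets of small diameter lie in boxes
  of comparable size, so that a cover of \<open>X\<close> induces covers of all the slices \<open>y + span {w, u}\<close>.\<close>

lemma hausdorff_measure_positive_from_slices:
  fixes X :: "'n::finite torus set" and w u :: "real ^ 'n"
  assumes minor: "w $ i * u $ j - w $ j * u $ i \<noteq> 0" and \<gamma>: "0 < \<gamma>"
    and \<sigma>: "0 < \<sigma>" "\<sigma> * norm w \<le> 1/8" and \<tau>: "0 < \<tau>" "\<tau> * norm u \<le> 1/8" and \<kappa>: "0 < \<kappa>"
    and slices: "\<And>y a b r. \<forall>n. r n \<ge> 0 \<Longrightarrow> slice_covered X w u y \<sigma> \<tau> a b r \<Longrightarrow>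
      ennreal \<kappa> \<le> (\<Sum>n. ennreal (r n powr (1 + \<gamma>)))"
    and s: "s \<le> real CARD('n) - 1 + \<gamma>"
  shows "hausdorff_measure s X \<noteq> 0"
proof
  assume H0: "hausdorff_measure s X = 0"
  let ?d = "CARD('n)"
  have ij: "i \<noteq> j" using minor by auto
  define s' where "s' = real ?d - 1 + \<gamma>"
  \<comment> \<open>Together with the bounds on \<open>\<sigma>\<close> and \<open>\<tau>\<close>,
    this keeps all lifts within distance 3/8, so that the torus metric agrees with the norm on
    them.\<close>
  define \<eta> where "\<eta> = 1 / (8 * real ?d)"
  have \<eta>: "\<eta> > 0" by (simp add: \<eta>_def)
  define D where "D = \<bar>w $ i * u $ j - w $ j * u $ i\<bar>"
  have D: "D > 0" using minor by (simp add: D_def)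
  \<comment> \<open>From Cramer's rule in the coordinates \<open>i\<close> and \<open>j\<close>,
    where the determinant has modulus \<open>D\<close>; the remaining coordinates account for the
    mixed term.\<close>
  define C where "C = 1 + (2 * norm u + 2 * norm w + 4 * norm u * norm w) / D"
  have C1: "C \<ge> 1" and Cu: "2 * norm u / D \<le> C" and Cw: "2 * norm w / D \<le> C"
    and Cuw: "1 + 2 * norm u / D * norm w + 2 * norm w / D * norm u \<le> C"
    using D by (auto simp: C_def add_divide_distrib mult_ac intro!: add_nonneg_nonneg divide_nonneg_pos)
  \<comment> \<open>Erasing two coordinates makes \<open>P y\<close>, \<open>s\<close> and
    \<open>t\<close> independent coordinates. The point \<open>y\<close> still ranges over a
    full-dimensional box, so that \<open>lborel\<close> applies; the two idle directions contribute
    \<open>\<eta>\<^sup>2\<close>.\<close>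
  define P where "P = (\<lambda>y :: real ^ 'n. (\<chi> l. if l \<in> {i, j} then 0 else y $ l))"
  define pt where "pt = (\<lambda>y s t. P y + s *\<^sub>R w + t *\<^sub>R u)"
  define Box :: "(real ^ 'n) set" where "Box = cbox 0 (\<chi> l. \<eta>)"
  define reg where "reg = (\<lambda>y s t. y \<in> Box \<and> 0 \<le> s \<and> s \<le> \<sigma> \<and> 0 \<le> t \<and> t \<le> \<tau>)"
  have close: "norm (pt y s t - pt y' s' t') < 1/2" if "reg y s t" "reg y' s' t'" for y s t y' s' t'
  proof -
    have "norm (P y - P y') \<le> (\<Sum>l\<in>UNIV. \<bar>(P y - P y') $ l\<bar>)" by (rule norm_le_l1_cart)
    also have "\<dots> \<le> (\<Sum>l\<in>(UNIV :: 'n set). \<eta>)"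
    proof (rule sum_mono)
      fix l
      have "0 \<le> y $ l" "y $ l \<le> \<eta>" "0 \<le> y' $ l" "y' $ l \<le> \<eta>"
        using that by (auto simp: reg_def Box_def mem_box_cart)
      then show "\<bar>(P y - P y') $ l\<bar> \<le> \<eta>" using \<eta> by (auto simp: P_def abs_le_iff)
    qed
    also have "\<dots> = 1/8" by (simp add: \<eta>_def)
    finally have 1: "norm (P y - P y') \<le> 1/8" .
    have "norm ((s - s') *\<^sub>R w) \<le> \<sigma> * norm w"
      unfolding norm_scaleR using that by (intro mult_right_mono) (auto simp: reg_def abs_le_iff)
    moreover have "norm ((t - t') *\<^sub>R u) \<le> \<tau> * norm u"
      unfolding norm_scaleR using that by (intro mult_right_mono) (auto simp: reg_def abs_le_iff)
    moreover have eq: "pt y s t - pt y' s' t' = (P y - P y') + (s - s') *\<^sub>R w + (t - t') *\<^sub>R u"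
      by (simp add: pt_def algebra_simps)
    have "norm (pt y s t - pt y' s' t') \<le> norm (P y - P y') + norm ((s - s') *\<^sub>R w) + norm ((t - t') *\<^sub>R u)"
      unfolding eq using norm_triangle_ineq[of "(P y - P y') + (s - s') *\<^sub>R w" "(t - t') *\<^sub>R u"]
        norm_triangle_ineq[of "P y - P y'" "(s - s') *\<^sub>R w"] by linarith
    ultimately show ?thesis using 1 \<sigma> \<tau> by linarith
  qed
  have coords: "\<bar>s - s'\<bar> \<le> C * \<rho> \<and> \<bar>t - t'\<bar> \<le> C * \<rho> \<and> (\<forall>l. l \<notin> {i, j} \<longrightarrow> \<bar>y $ l - y' $ l\<bar> \<le> C * \<rho>)"
    if \<rho>: "norm (pt y s t - pt y' s' t') \<le> \<rho>" for y s t y' s' t' \<rho>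
  proof -
    let ?\<Delta> = "pt y s t - pt y' s' t'" and ?p = "s - s'" and ?q = "t - t'"
    have \<rho>0: "\<rho> \<ge> 0" using \<rho> norm_ge_zero order_trans by blast
    have comp: "\<bar>?\<Delta> $ l\<bar> \<le> \<rho>" for l using component_le_norm_cart[of ?\<Delta> l] \<rho> by linarith
    have \<Delta>: "?\<Delta> $ l = (P y $ l - P y' $ l) + ?p * w $ l + ?q * u $ l" for l
      by (simp add: pt_def algebra_simps)
    have \<Delta>i: "?\<Delta> $ i = ?p * w $ i + ?q * u $ i" and \<Delta>j: "?\<Delta> $ j = ?p * w $ j + ?q * u $ j"
      unfolding \<Delta> by (simp_all add: P_def)
    have "?p * (w $ i * u $ j - w $ j * u $ i) = ?\<Delta> $ i * u $ j - ?\<Delta> $ j * u $ i"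
      unfolding \<Delta>i \<Delta>j by (simp add: algebra_simps)
    then have "\<bar>?p\<bar> * D = \<bar>?\<Delta> $ i * u $ j - ?\<Delta> $ j * u $ i\<bar>"
      unfolding D_def by (metis abs_mult)
    also have "\<dots> \<le> \<bar>?\<Delta> $ i\<bar> * \<bar>u $ j\<bar> + \<bar>?\<Delta> $ j\<bar> * \<bar>u $ i\<bar>"
      unfolding abs_mult[symmetric] by (rule abs_triangle_ineq4)
    also have "\<dots> \<le> \<rho> * norm u + \<rho> * norm u"
      using comp \<rho>0 by (intro add_mono mult_mono component_le_norm_cart) auto
    finally have p: "\<bar>?p\<bar> \<le> 2 * norm u / D * \<rho>" using D by (simp add: pos_le_divide_eq mult_ac)
    have "?q * (w $ i * u $ j - w $ j * u $ i) = ?\<Delta> $ j * w $ i - ?\<Delta> $ i * w $ j"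
      unfolding \<Delta>i \<Delta>j by (simp add: algebra_simps)
    then have "\<bar>?q\<bar> * D = \<bar>?\<Delta> $ j * w $ i - ?\<Delta> $ i * w $ j\<bar>"
      unfolding D_def by (metis abs_mult)
    also have "\<dots> \<le> \<bar>?\<Delta> $ j\<bar> * \<bar>w $ i\<bar> + \<bar>?\<Delta> $ i\<bar> * \<bar>w $ j\<bar>"
      unfolding abs_mult[symmetric] by (rule abs_triangle_ineq4)
    also have "\<dots> \<le> \<rho> * norm w + \<rho> * norm w"
      using comp \<rho>0 by (intro add_mono mult_mono component_le_norm_cart) auto
    finally have q: "\<bar>?q\<bar> \<le> 2 * norm w / D * \<rho>" using D by (simp add: pos_le_divide_eq mult_ac)
    have "\<bar>y $ l - y' $ l\<bar> \<le> C * \<rho>" if l: "l \<notin> {i, j}" for l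
    proof -
      have "y $ l - y' $ l = ?\<Delta> $ l - ?p * w $ l - ?q * u $ l"
        unfolding \<Delta> using l by (simp add: P_def)
      then have "\<bar>y $ l - y' $ l\<bar> \<le> \<bar>?\<Delta> $ l\<bar> + \<bar>?p * w $ l\<bar> + \<bar>?q * u $ l\<bar>" by linarith
      also have "\<bar>?p * w $ l\<bar> \<le> (2 * norm u / D * \<rho>) * norm w"
        unfolding abs_mult using p D \<rho>0 by (intro mult_mono component_le_norm_cart) auto
      also have "\<bar>?q * u $ l\<bar> \<le> (2 * norm w / D * \<rho>) * norm u"
        unfolding abs_mult using q D \<rho>0 by (intro mult_mono component_le_norm_cart) auto
      also have "\<bar>?\<Delta> $ l\<bar> \<le> \<rho>" by (rule comp)
      finally have "\<bar>y $ l - y' $ l\<bar> \<le> (1 + 2 * norm u / D * norm w + 2 * norm w / D * norm u) * \<rho>"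
        by (simp add: algebra_simps)
      also have "\<dots> \<le> C * \<rho>" using Cuw \<rho>0 by (rule mult_right_mono)
      finally show ?thesis .
    qed
    moreover have "\<bar>?p\<bar> \<le> C * \<rho>" using p mult_right_mono[OF Cu \<rho>0] by linarith
    moreover have "\<bar>?q\<bar> \<le> C * \<rho>" using q mult_right_mono[OF Cw \<rho>0] by linarith
    ultimately show ?thesis by blast
  qed
  \<comment> \<open>The constants that appear when \<open>r n = C * diameter (U n)\<close> is
    inserted into the volume bound; they decide how small the cover has to be.\<close>
  define B where "B = 2 ^ (?d - 2) * \<eta>\<^sup>2 * C powr s'"
  have d2: "?d \<ge> 2"
  proof -
    have "card {i, j} \<le> ?d" by (intro card_mono) auto
    then show ?thesis using ij by simp
  qed
  have B0: "B > 0" using \<eta> C1 by (simp add: B_def)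
  have "ennreal (\<kappa> * \<eta> ^ ?d / B) > 0" using \<kappa> \<eta> B0 by simp
  from hausdorff_measure_zero_cover[OF H0 this] obtain U where
    U: "X \<subseteq> (\<Union>n. U n)" "\<And>n. bounded (U n)" "\<And>n. diameter (U n) \<le> 1"
    "(\<Sum>n. ennreal (diameter (U n) powr s)) < ennreal (\<kappa> * \<eta> ^ ?d / B)" by blast
  define hit where "hit = (\<lambda>n. \<exists>y s t. reg y s t \<and> abs_torus (pt y s t) \<in> U n)"
  have "\<exists>y s t. hit n \<longrightarrow> reg y s t \<and> abs_torus (pt y s t) \<in> U n" for n unfolding hit_def by blast
  \<comment> \<open>Any point of the region that lands in \<open>U n\<close> serves as the centre of
    its coordinate box.\<close>
  then obtain Y a b where Yab: "\<And>n. hit n \<Longrightarrow> reg (Y n) (a n) (b n) \<and> abs_torus (pt (Y n) (a n) (b n)) \<in> U n"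
    by metis
  define r where "r = (\<lambda>n. C * diameter (U n))"
  have r0: "r n \<ge> 0" for n using C1 diameter_ge_0[OF U(2)] by (simp add: r_def)
  define V where "V = (\<lambda>n. {y. hit n \<and> (\<forall>l. l \<notin> {i, j} \<longrightarrow> \<bar>y $ l - Y n $ l\<bar> \<le> r n)})"
  have near: "hit n \<and> y \<in> V n \<and> \<bar>s - a n\<bar> \<le> r n \<and> \<bar>t - b n\<bar> \<le> r n"
    if "reg y s t" "abs_torus (pt y s t) \<in> U n" for y s t n
  proof -
    have h: "hit n" using that unfolding hit_def by blast
    then have Y: "reg (Y n) (a n) (b n)" "abs_torus (pt (Y n) (a n) (b n)) \<in> U n" using Yab by auto
    have "norm (pt y s t - pt (Y n) (a n) (b n)) = dist (abs_torus (pt y s t)) (abs_torus (pt (Y n) (a n) (b n)))"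
      by (rule dist_abs_torus_eq_norm[symmetric, OF close[OF that(1) Y(1)]])
    also have "\<dots> \<le> diameter (U n)" by (rule diameter_bounded_bound[OF U(2) that(2) Y(2)])
    finally show ?thesis using coords[of y s t "Y n" "a n" "b n"] h by (simp add: V_def r_def)
  qed
  have slice: "ennreal \<kappa> \<le> (\<Sum>n. ennreal (r n powr (1 + \<gamma>)) * indicator (V n) y)" if y: "y \<in> Box" for y
  proof -
    \<comment> \<open>Members whose box misses \<open>y\<close> get radius 0: no point of this slice
      lies in them, and \<open>0 powr (1 + \<gamma>) = 0\<close> removes them from the sum.\<close>
    let ?r = "\<lambda>n. if y \<in> V n then r n else 0"
    have "slice_covered X w u (P y) \<sigma> \<tau> a b ?r"
      unfolding slice_covered_def
    proof (intro allI impI)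
      fix s t assume st: "0 \<le> s" "s \<le> \<sigma>" "0 \<le> t" "t \<le> \<tau>" "abs_torus (P y + s *\<^sub>R w + t *\<^sub>R u) \<in> X"
      then obtain n where n: "abs_torus (pt y s t) \<in> U n" using U(1) by (auto simp: pt_def)
      have "reg y s t" using y st by (simp add: reg_def)
      from near[OF this n] show "\<exists>n. \<bar>s - a n\<bar> \<le> ?r n \<and> \<bar>t - b n\<bar> \<le> ?r n" by (intro exI[of _ n]) simp
    qed
    then have "ennreal \<kappa> \<le> (\<Sum>n. ennreal (?r n powr (1 + \<gamma>)))" using r0 by (intro slices) auto
    also have "(\<lambda>n. ennreal (?r n powr (1 + \<gamma>))) = (\<lambda>n. ennreal (r n powr (1 + \<gamma>)) * indicator (V n) y)"
      by (auto simp: fun_eq_iff)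
    finally show ?thesis .
  qed
  have Vm: "V n \<in> sets lborel" for n
  proof -
    have "V n = (if hit n then (\<Inter>l\<in>-{i, j}. {y. \<bar>y $ l - Y n $ l\<bar> \<le> r n}) else {})"
      by (auto simp: V_def)
    moreover have "closed {y :: real ^ 'n. \<bar>y $ l - Y n $ l\<bar> \<le> r n}" for l
      by (intro closed_Collect_le continuous_intros)
    ultimately have "closed (V n)" by auto
    then show ?thesis by simp
  qed
  have Vvol: "emeasure lborel (Box \<inter> V n) \<le> ennreal (\<eta>\<^sup>2 * (2 * r n) ^ (?d - 2))" for n
  proof -
    let ?lo = "\<chi> l. if l \<in> {i, j} then 0 else Y n $ l - r n" and ?hi = "\<chi> l. if l \<in> {i, j} then \<eta> else Y n $ l + r n"
    have cardc: "card (- {i, j}) = ?d - 2"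
      using ij by (simp add: Compl_eq_Diff_UNIV card_Diff_subset numeral_2_eq_2)
    have "Box \<inter> V n \<subseteq> cbox ?lo ?hi"
      by (auto simp: Box_def V_def mem_box_cart abs_le_iff) (smt (verit) insertCI)+
    then have "emeasure lborel (Box \<inter> V n) \<le> emeasure lborel (cbox ?lo ?hi)"
      by (intro emeasure_mono) auto
    also have "\<dots> = ennreal (measure lborel (cbox ?lo ?hi))"
      by (rule emeasure_eq_ennreal_measure) (use emeasure_lborel_cbox_finite[of ?lo ?hi] in auto)
    also have "measure lborel (cbox ?lo ?hi) = (\<Prod>l\<in>UNIV. ?hi $ l - ?lo $ l)"
      by (rule content_cbox_cart) (use r0[of n] \<eta> in \<open>auto simp: interval_ne_empty_cart\<close>)
    also have "\<dots> = (\<Prod>l\<in>{i, j}. ?hi $ l - ?lo $ l) * (\<Prod>l\<in>-{i, j}. ?hi $ l - ?lo $ l)"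
      by (subst prod.union_disjoint[symmetric]) (auto simp: Compl_partition)
    also have "(\<Prod>l\<in>{i, j}. ?hi $ l - ?lo $ l) = \<eta>\<^sup>2" using ij by (simp add: power2_eq_square)
    also have "(\<Prod>l\<in>-{i, j}. ?hi $ l - ?lo $ l) = (\<Prod>l\<in>-{i, j}. 2 * r n)" by (rule prod.cong) auto
    also have "\<dots> = (2 * r n) ^ (?d - 2)" by (simp add: cardc)
    finally show ?thesis .
  qed
  have "ennreal \<kappa> * emeasure lborel Box \<le> (\<Sum>n. ennreal (r n powr (1 + \<gamma>)) * ennreal (\<eta>\<^sup>2 * (2 * r n) ^ (?d - 2)))"
    by (rule AE_cover_sum_lower_bound[where B = V]) (use slice Vm Vvol in \<open>auto simp: Box_def\<close>)
  also have "emeasure lborel Box = ennreal (\<eta> ^ ?d)"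
  proof -
    have "emeasure lborel Box = ennreal (measure lborel Box)" unfolding Box_def
      by (rule emeasure_eq_ennreal_measure) (use emeasure_lborel_cbox_finite[of "0 :: real ^ 'n" "\<chi> l. \<eta>"] in auto)
    also have "measure lborel Box = (\<Prod>l\<in>(UNIV :: 'n set). (\<chi> l. \<eta>) $ l - (0 :: real ^ 'n) $ l)"
      unfolding Box_def by (rule content_cbox_cart) (use \<eta> in \<open>auto simp: interval_ne_empty_cart\<close>)
    finally show ?thesis by simp
  qed
  also have "(\<Sum>n. ennreal (r n powr (1 + \<gamma>)) * ennreal (\<eta>\<^sup>2 * (2 * r n) ^ (?d - 2)))
      \<le> (\<Sum>n. ennreal B * ennreal (diameter (U n) powr s))"
  proof (rule suminf_le)
    fix n
    have "r n powr (1 + \<gamma>) * (\<eta>\<^sup>2 * (2 * r n) ^ (?d - 2)) = 2 ^ (?d - 2) * \<eta>\<^sup>2 * r n powr s'"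
    \<comment> \<open>In dimension two \<open>(2 * r n) ^ 0\<close> is 1 even for
      \<open>r n = 0\<close>, so the zero has to come from the first factor.\<close>
    proof (cases "r n = 0")
      case False
      then have "r n > 0" using r0[of n] by simp
      then have "r n powr (1 + \<gamma>) * r n ^ (?d - 2) = r n powr s'"
        using d2 by (simp add: powr_realpow[symmetric] powr_add[symmetric] s'_def of_nat_diff algebra_simps)
      then show ?thesis by (simp add: power_mult_distrib mult_ac)
    qed (use \<gamma> in simp)
    also have "r n powr s' = C powr s' * diameter (U n) powr s'"
      using C1 diameter_ge_0[OF U(2)] by (simp add: r_def powr_mult)
    also have "2 ^ (?d - 2) * \<eta>\<^sup>2 * (C powr s' * diameter (U n) powr s') = B * diameter (U n) powr s'"
      by (simp add: B_def)
    \<comment> \<open>As the diameters are at most 1, the smaller exponent gives the larger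
      power.\<close>
    also have "\<dots> \<le> B * diameter (U n) powr s"
      using B0 s U(3)[of n] diameter_ge_0[OF U(2)[of n]]
      by (intro mult_left_mono) (auto simp: s'_def intro!: powr_mono')
    finally show "ennreal (r n powr (1 + \<gamma>)) * ennreal (\<eta>\<^sup>2 * (2 * r n) ^ (?d - 2)) \<le> ennreal B * ennreal (diameter (U n) powr s)"
      using B0 r0[of n] by (simp add: ennreal_mult[symmetric] ennreal_leI)
  qed auto
  also have "\<dots> = ennreal B * (\<Sum>n. ennreal (diameter (U n) powr s))" by simp
  also have "\<dots> < ennreal B * ennreal (\<kappa> * \<eta> ^ ?d / B)"
    by (rule ennreal_mult_strict_left_mono[OF U(4)]) (use B0 in auto)
  also have "\<dots> = ennreal \<kappa> * ennreal (\<eta> ^ ?d)"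
    using B0 \<kappa> \<eta> by (simp add: ennreal_mult[symmetric])
  finally show False by simp
qed

lemma nonzero_minor:
  fixes w u :: "real ^ 'n"
  assumes "u \<noteq> 0" and "\<And>c. w \<noteq> c *\<^sub>R u"
  shows "\<exists>i j. w $ i * u $ j - w $ j * u $ i \<noteq> 0"
proof (rule ccontr)
  assume "\<nexists>i j. w $ i * u $ j - w $ j * u $ i \<noteq> 0"
  then have eq: "w $ i * u $ j = w $ j * u $ i" for i j by simp
  obtain j where j: "u $ j \<noteq> 0" using assms(1) by (auto simp: vec_eq_iff)
  have "w = (w $ j / u $ j) *\<^sub>R u"
    using j eq by (simp add: vec_eq_iff eq_divide_eq)
  then show False using assms(2) by blast
qed

theorem theorem1p1:
  fixes S T :: "int ^ 'n ^ 'n"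
  assumes "invertible S" and "invertible T"
    and "totally_irreducible S" and "totally_irreducible T"
    and "weak_stable_subspace S \<noteq> weak_stable_subspace T"
  shows "hausdorff_dim (Eq (torus_map S) \<inter> ND (torus_map T)) = of_nat CARD('n)"
proof (rule antisym[OF hausdorff_dim_torus_le])
  let ?X = "Eq (torus_map S) \<inter> ND (torus_map T)" and ?VS = "weak_stable_subspace S" and ?VT = "weak_stable_subspace T"
  note irrS = totally_irreducible_imp_irreducible[OF assms(3)] and irrT = totally_irreducible_imp_irreducible[OF assms(4)]
  have d1: "CARD('n) \<noteq> 1"
    using weak_stable_subspace_one_dim[OF _ assms(1) irrS] weak_stable_subspace_one_dim[OF _ assms(2) irrT] assms(5) by auto
  have scale: "c *\<^sub>R v \<in> weak_stable_subspace A" if "v \<in> weak_stable_subspace A" for c v and A :: "int ^ 'n ^ 'n"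
    using that unfolding weak_stable_subspace_def by (rule span_scale)
  have zero: "0 \<in> weak_stable_subspace A" for A :: "int ^ 'n ^ 'n"
    unfolding weak_stable_subspace_def by (rule span_zero)
  \<comment> \<open>A vector in one subspace but not in the other serves as \<open>w\<close> or as
    \<open>u\<close>; its partner only has to avoid a proper subspace.\<close>
  have "\<exists>u w. u \<notin> ?VS \<and> w \<notin> ?VT \<and> (w \<in> ?VS \<or> u \<in> ?VT)"
  proof (cases "?VS \<subseteq> ?VT")
    case False
    then show ?thesis using weak_stable_subspace_proper[OF d1 assms(1,3)] by blast
  next
    case True
    then have "\<not> ?VT \<subseteq> ?VS" using assms(5) by blast
    then show ?thesis using weak_stable_subspace_proper[OF d1 assms(2,4)] by blast
  qed
  then obtain u w where u: "u \<notin> ?VS" and w: "w \<notin> ?VT" and uw: "w \<in> ?VS \<or> u \<in> ?VT" by blast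
  have u0: "u \<noteq> 0" using u zero by blast
  have w0: "w \<noteq> 0" using w zero by blast
  \<comment> \<open>Non-zero parallel vectors lie in the same subspaces, which contradicts either
    alternative of \<open>uw\<close>.\<close>
  have indep: "w \<noteq> c *\<^sub>R u" for c
  proof
    assume wc: "w = c *\<^sub>R u"
    then have "c \<noteq> 0" using w0 by auto
    then have "u = (1 / c) *\<^sub>R w" using wc by simp
    then show False using uw u w scale wc by metis
  qed
  obtain i j where ij: "w $ i * u $ j - w $ j * u $ i \<noteq> 0" using nonzero_minor[OF u0 indep] by blast
  show "of_nat CARD('n) \<le> hausdorff_dim ?X"
    unfolding hausdorff_dim_def
  proof (rule Inf_greatest)
    fix x assume "x \<in> {ennreal s | s. 0 < s \<and> hausdorff_measure s ?X = 0}"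
    then obtain s where s: "x = ennreal s" "0 < s" "hausdorff_measure s ?X = 0" by blast
    have "real CARD('n) \<le> s"
    proof (rule ccontr)
      assume "\<not> real CARD('n) \<le> s"
      \<comment> \<open>The exponent is chosen so that the slices reach \<open>s\<close>; the 1/2
        keeps it positive when \<open>s\<close> is small.\<close>
      define \<gamma> where "\<gamma> = max (1/2) (s - real CARD('n) + 1)"
      have \<gamma>: "0 < \<gamma>" "\<gamma> < 1" "s \<le> real CARD('n) - 1 + \<gamma>"
        using \<open>\<not> real CARD('n) \<le> s\<close> by (auto simp: \<gamma>_def)
      define \<eta> where "\<eta> = 1 / (8 * (1 + norm w + norm u))"
      have den: "8 * (1 + norm w + norm u) > 0" by (intro mult_pos_pos add_pos_nonneg) auto
      have \<eta>: "\<eta> > 0" unfolding \<eta>_def using den by simp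
      have small: "\<eta> * norm w \<le> 1/8" "\<eta> * norm u \<le> 1/8"
        unfolding \<eta>_def using den by (simp_all add: divide_le_eq)
      obtain \<sigma> \<tau> \<kappa> where *: "0 < \<sigma>" "\<sigma> \<le> \<eta>" "0 < \<tau>" "\<tau> \<le> \<eta>" "0 < \<kappa>"
        "\<And>y a b r. \<forall>n. r n \<ge> 0 \<Longrightarrow> slice_covered ?X w u y \<sigma> \<tau> a b r \<Longrightarrow>
          ennreal \<kappa> \<le> (\<Sum>n. ennreal (r n powr (1 + \<gamma>)))"
        by (rule slice_covering_bound[OF assms(3,4) u w uw \<gamma>(1,2) \<eta>]) (rule that)
      have "\<sigma> * norm w \<le> 1/8" "\<tau> * norm u \<le> 1/8"
        using small mult_right_mono[OF *(2), of "norm w"] mult_right_mono[OF *(4), of "norm u"] by auto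
      then have "hausdorff_measure s ?X \<noteq> 0"
        by (rule hausdorff_measure_positive_from_slices[OF ij \<gamma>(1) *(1) _ *(3) _ *(5) _ \<gamma>(3)])
          (rule *(6))
      then show False using s(3) by blast
    qed
    then show "of_nat CARD('n) \<le> x"
      unfolding s(1) ennreal_of_nat_eq_real_of_nat by (rule ennreal_leI)
  qed
qed

end
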